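(* Let $G$ be a block. Then $G$ has no $K_{2,4}$ minor if and only if one of the following holds: (i) $G$ is outerplanar; (ii) there are vertices $x \neq y$ such that $G$ is the union of three $xy$-outerplanar graphs $H_1,H_2,H_3$ and possibly the edge $xy$, where $|V(H_i)|\ge 3$ for each $i$ and $V(H_i)\cap V(H_j) = \{x,y\}$ for $i\ne j$; (iii) $G$ is obtained from a $3$-connected $K_{2,4}$-minor-free graph $G_0$ by taking a (possibly empty) subdividable set of edges $\{x_1y_1,\ldots,x_ky_k\}$ of $G_0$ and replacing each edge $x_iy_i$ by an $x_iy_i$-outerplanar graph $H_i$, where $V(H_i)\cap V(G_0) = \{x_i,y_i\}$ for each $i$ and $V(H_i)\cap V(H_j) \subseteq V(G_0)$ for $i \ne j$.
   Context: A block is a connected graph with no cutvertex (an isolated vertex, an edge, or a $2$-connected graph). A graph is outerplanar if it has a plane embedding with all vertices on the outer face. A connected graph $H$ with $x,y\in V(H)$ is $xy$-outerplanar if it has an embedding in a closed disk such that some hamilton $xy$-path of $H$ lies in the boundary of the disk. If $G_0$ is $K_{2,4}$-minor-free, a set $F\subseteq E(G_0)$ is subdividable if the graph obtained from $G_0$ by subdividing every edge of $F$ once (replacing it by a path of length $2$) is $K_{2,4}$-minor-free. Replacing an edge $x_iy_i$ by $H_i$ means deleting the edge $x_iy_i$ and taking the union with $H_i$. *)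

theory Defs
  imports "HOL-Analysis.Analysis"
begin

datatype 'a ugraph = UGraph (verts: "'a set") (edges: "'a set set")

definition simple_graph :: "'a ugraph \<Rightarrow> bool" where
  "simple_graph G \<longleftrightarrow> finite (verts G) \<and> (\<forall>e\<in>edges G. e \<subseteq> verts G \<and> card e = 2)"

definition induced :: "'a ugraph \<Rightarrow> 'a set \<Rightarrow> 'a ugraph" where
  "induced G S = UGraph (verts G \<inter> S) {e \<in> edges G. e \<subseteq> S}"

definition delete_verts :: "'a ugraph \<Rightarrow> 'a set \<Rightarrow> 'a ugraph" where
  "delete_verts G S = induced G (verts G - S)"

definition graph_union :: "'a ugraph \<Rightarrow> 'a ugraph \<Rightarrow> 'a ugraph" where
  "graph_union G H = UGraph (verts G \<union> verts H) (edges G \<union> edges H)"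

definition reachable :: "'a ugraph \<Rightarrow> 'a \<Rightarrow> 'a \<Rightarrow> bool" where
  "reachable G u v \<longleftrightarrow> (u, v) \<in> {(a, b). {a, b} \<in> edges G}\<^sup>*"

text \<open>By convention the graph without vertices is not connected.\<close>

definition connected_graph :: "'a ugraph \<Rightarrow> bool" where
  "connected_graph G \<longleftrightarrow> verts G \<noteq> {} \<and> (\<forall>u\<in>verts G. \<forall>v\<in>verts G. reachable G u v)"

text \<open>A cutvertex separates two other vertices of its component.\<close>

definition cutvertex :: "'a ugraph \<Rightarrow> 'a \<Rightarrow> bool" where
  "cutvertex G c \<longleftrightarrow> c \<in> verts G \<and>
     (\<exists>u\<in>verts G - {c}. \<exists>v\<in>verts G - {c}.
        reachable G u v \<and> \<not> reachable (delete_verts G {c}) u v)"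

definition block :: "'a ugraph \<Rightarrow> bool" where
  "block G \<longleftrightarrow> connected_graph G \<and> (\<nexists>c. cutvertex G c)"

definition k_connected :: "nat \<Rightarrow> 'a ugraph \<Rightarrow> bool" where
  "k_connected k G \<longleftrightarrow> card (verts G) > k \<and>
     (\<forall>S \<subseteq> verts G. card S < k \<longrightarrow> connected_graph (delete_verts G S))"

definition hamilton_path :: "'a ugraph \<Rightarrow> 'a \<Rightarrow> 'a \<Rightarrow> 'a list \<Rightarrow> bool" where
  "hamilton_path G x y vs \<longleftrightarrow>
     vs \<noteq> [] \<and> hd vs = x \<and> last vs = y \<and> distinct vs \<and> set vs = verts G \<and>
     (\<forall>i. Suc i < length vs \<longrightarrow> {vs ! i, vs ! Suc i} \<in> edges G)"

text \<open>\<open>B\<close> assigns to each vertex of the minor \<open>H\<close> its branch set in \<open>G\<close>.\<close>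

definition is_minor :: "'b ugraph \<Rightarrow> 'a ugraph \<Rightarrow> bool" where
  "is_minor H G \<longleftrightarrow> (\<exists>B :: 'b \<Rightarrow> 'a set.
     (\<forall>u\<in>verts H. B u \<subseteq> verts G \<and> connected_graph (induced G (B u))) \<and>
     (\<forall>u\<in>verts H. \<forall>v\<in>verts H. u \<noteq> v \<longrightarrow> B u \<inter> B v = {}) \<and>
     (\<forall>u v. {u, v} \<in> edges H \<longrightarrow> (\<exists>a\<in>B u. \<exists>b\<in>B v. {a, b} \<in> edges G)))"

definition complete_bipartite :: "nat \<Rightarrow> nat \<Rightarrow> (nat + nat) ugraph" where
  "complete_bipartite m n = UGraph (Inl ` {..<m} \<union> Inr ` {..<n})
     {{Inl i, Inr j} | i j. i < m \<and> j < n}"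

definition K24_minor_free :: "'a ugraph \<Rightarrow> bool" where
  "K24_minor_free G \<longleftrightarrow> \<not> is_minor (complete_bipartite 2 4) G"

text \<open>Embeddings in the plane \<open>\<complex>\<close>: \<open>p\<close> places the vertices and \<open>g e\<close> is a simple arc
  representing the edge \<open>e\<close>, parametrized in either direction.\<close>

definition drawing :: "'a ugraph \<Rightarrow> ('a \<Rightarrow> complex) \<Rightarrow> ('a set \<Rightarrow> real \<Rightarrow> complex) \<Rightarrow> bool" where
  "drawing G p g \<longleftrightarrow> inj_on p (verts G) \<and>
     (\<forall>e\<in>edges G. arc (g e) \<and> {pathstart (g e), pathfinish (g e)} = p ` e \<and>
        path_image (g e) \<inter> p ` verts G = p ` e) \<and>
     (\<forall>e\<in>edges G. \<forall>f\<in>edges G. e \<noteq> f \<longrightarrow>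
        path_image (g e) \<inter> path_image (g f) = p ` (e \<inter> f))"

definition drawing_points ::
  "'a ugraph \<Rightarrow> ('a \<Rightarrow> complex) \<Rightarrow> ('a set \<Rightarrow> real \<Rightarrow> complex) \<Rightarrow> complex set" where
  "drawing_points G p g = p ` verts G \<union> (\<Union>e\<in>edges G. path_image (g e))"

text \<open>For a finite graph, \<^const>\<open>outside\<close> of the drawing is its outer face; the vertices
  on the outer face are those on the boundary of that open set.\<close>

definition outerplanar :: "'a ugraph \<Rightarrow> bool" where
  "outerplanar G \<longleftrightarrow> (\<exists>p g. drawing G p g \<and>
     p ` verts G \<subseteq> frontier (outside (drawing_points G p g)))"

definition xy_outerplanar :: "'a \<Rightarrow> 'a \<Rightarrow> 'a ugraph \<Rightarrow> bool" where
  "xy_outerplanar x y H \<longleftrightarrow>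
     simple_graph H \<and> connected_graph H \<and> x \<in> verts H \<and> y \<in> verts H \<and>
     (\<exists>p g. drawing H p g \<and> drawing_points H p g \<subseteq> cball 0 1 \<and>
       (\<exists>vs. hamilton_path H x y vs \<and> p ` set vs \<subseteq> sphere 0 1 \<and>
         (\<forall>i. Suc i < length vs \<longrightarrow> path_image (g {vs ! i, vs ! Suc i}) \<subseteq> sphere 0 1)))"

text \<open>\<open>Inr e\<close> is the new vertex in the middle of the edge \<open>e\<close>.\<close>

definition subdivide :: "'a ugraph \<Rightarrow> 'a set set \<Rightarrow> ('a + 'a set) ugraph" where
  "subdivide G F = UGraph (Inl ` verts G \<union> Inr ` F)
     ((\<lambda>e. Inl ` e) ` (edges G - F) \<union> {{Inl v, Inr e} | v e. e \<in> F \<and> v \<in> e})"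

definition subdividable :: "'a ugraph \<Rightarrow> 'a set set \<Rightarrow> bool" where
  "subdividable G F \<longleftrightarrow> F \<subseteq> edges G \<and> K24_minor_free (subdivide G F)"

definition replace_edges :: "'a ugraph \<Rightarrow> 'a set set \<Rightarrow> ('a set \<Rightarrow> 'a ugraph) \<Rightarrow> 'a ugraph" where
  "replace_edges G F H = UGraph (verts G \<union> (\<Union>e\<in>F. verts (H e)))
     ((edges G - F) \<union> (\<Union>e\<in>F. edges (H e)))"

end

theory Submission
  imports Defs
begin

text \<open>
  By the Jordan curve theorem and Janiszewski's theorem, three arcs with common ends cannot all
  have an inner point on the outer face. Hence an outerplanar graph has no \<open>K\<^bsub>2,3\<^esub>\<close> minor, and
  in an \<open>xy\<close>-outerplanar graph no two edges cross with respect to the hamilton \<open>xy\<close>-path;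
  conversely, a hamilton path without crossings is drawn on a circle with chords. With respect to
  such a path two disjoint connected sets cannot interleave. This excludes \<open>K\<^bsub>2,3\<^esub>\<close> minors (even
  after adding \<open>xy\<close>) and rooted \<open>K\<^bsub>2,2\<^esub>\<close> models, with \<open>x\<close> and \<open>y\<close> in the two hubs, so an
  \<open>xy\<close>-outerplanar piece of a graph may be exchanged for a path of length two without losing a
  \<open>K\<^bsub>2,4\<^esub>\<close> minor. That settles one direction.

  For the other one, a longest \<open>xy\<close>-path of a piece of a block is a hamilton path without
  crossings unless there is a rooted \<open>K\<^bsub>2,2\<^esub>\<close>; call such a piece good. If the removal of some
  \<open>x\<close>, \<open>y\<close> leaves three components, then these are good and there is no fourth one, since models
  rooted at \<open>x\<close> and \<open>y\<close> in different components add up. If two good components cover the rest,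
  their hamilton paths combine to one of the whole graph. Otherwise every 2-cut has exactly one
  good side. Take a smallest set \<open>W\<close> of at least four vertices outside which the graph consists
  of good pieces attached to pairs of vertices of \<open>W\<close>: replacing these pieces by edges yields a
  3-connected graph, as the good side of a 2-cut inside \<open>W\<close> could be removed from \<open>W\<close>.
\<close>

section \<open>Connected sets and models of bipartite minors\<close>

text \<open>All control over 2-cuts comes from one count. Each component left by the removal of
  \<open>x\<close> and \<open>y\<close> supplies a spoke between hubs at \<open>x\<close> and
  \<open>y\<close>, and two spokes if it is not good; so 1 + 1 + 1 + 1, 2 + 1 + 1 and 2 + 2 are the
  configurations excluded.

  The obstacle in shrinking \<open>W\<close> is to keep four vertices, the least order of a
  3-connected graph. Removing a good side leaves \<open>x\<close>, \<open>y\<close> and at least one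
  vertex \<open>c\<close> of the bad side. If nothing else remained, the bad side would consist of
  \<open>c\<close> and good pieces attached to pairs of \<open>x\<close>, \<open>y\<close>,
  \<open>c\<close>, and \<open>good_split\<close> shows that it would then be good itself.

  The subdividable set also comes from the pieces: each is connected and adjacent to both of its
  ends, so it contracts to a subdividing vertex.

  Minors are treated over bare edge sets, so that the same branch sets can be read in a graph, in a
  piece of it and in a modified graph.\<close>

definition adjs :: "'a set set \<Rightarrow> 'a set \<Rightarrow> 'a set \<Rightarrow> bool" where
  "adjs E X Y \<longleftrightarrow> (\<exists>a\<in>X. \<exists>b\<in>Y. {a, b} \<in> E)"

text \<open>Cut form of connectedness in the subgraph induced on \<open>S\<close>: edges leaving
  \<open>S\<close> do not count, and no vertex set of a graph is mentioned. The empty set is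
  excluded because branch sets must be nonempty.\<close>

definition conn :: "'a set set \<Rightarrow> 'a set \<Rightarrow> bool" where
  "conn E S \<longleftrightarrow> S \<noteq> {} \<and> (\<forall>T\<subseteq>S. T \<noteq> {} \<longrightarrow> T \<noteq> S \<longrightarrow> adjs E T (S - T))"

lemma adjs_sym: "adjs E X Y \<Longrightarrow> adjs E Y X"
  unfolding adjs_def by (metis insert_commute)

lemma adjs_mono: "adjs E X Y \<Longrightarrow> E \<subseteq> E' \<Longrightarrow> X \<subseteq> X' \<Longrightarrow> Y \<subseteq> Y' \<Longrightarrow> adjs E' X' Y'"
  unfolding adjs_def by blast

lemma adjsI: "a \<in> X \<Longrightarrow> b \<in> Y \<Longrightarrow> {a, b} \<in> E \<Longrightarrow> adjs E X Y"
  unfolding adjs_def by blast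

lemma conn_nonempty: "conn E S \<Longrightarrow> S \<noteq> {}"
  unfolding conn_def by blast

lemma conn_singleton: "conn E {v}"
  unfolding conn_def by (auto simp: subset_singleton_iff)

lemma conn_cut:
  assumes "conn E S" "s \<in> S" "s \<in> P" "t \<in> S" "t \<notin> P"
  obtains a b where "a \<in> S" "a \<in> P" "b \<in> S" "b \<notin> P" "{a, b} \<in> E"
proof -
  have "adjs E (S \<inter> P) (S - S \<inter> P)"
    using assms unfolding conn_def by blast
  then show ?thesis
    using that unfolding adjs_def by blast
qed

text \<open>Of a set and its complement in \<open>S\<close> one avoids the root, and adjacency is
  symmetric, so testing the sets without the root suffices.\<close>

lemma connI_root:
  assumes "r \<in> S" "\<And>T. T \<subseteq> S \<Longrightarrow> T \<noteq> {} \<Longrightarrow> r \<notin> T \<Longrightarrow> adjs E T (S - T)"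
  shows "conn E S"
  unfolding conn_def
proof (intro conjI allI impI)
  show "S \<noteq> {}" using assms(1) by blast
  fix T assume T: "T \<subseteq> S" "T \<noteq> {}" "T \<noteq> S"
  show "adjs E T (S - T)"
  proof (cases "r \<in> T")
    case True
    have "adjs E (S - T) (S - (S - T))"
      using assms(2)[of "S - T"] T True by blast
    moreover have "S - (S - T) = T" using T by blast
    ultimately show ?thesis using adjs_sym by metis
  qed (use assms T in blast)
qed

text \<open>The set \<open>D\<close> collects the vertices through which \<open>X\<close> leaves \<open>U\<close>; reconnecting
  these by \<open>E'\<close> makes up for the part of \<open>X\<close> that is cut off.\<close>

lemma conn_gate:
  assumes X: "conn E X" and D: "D = {} \<or> conn E' D \<and> D \<inter> X \<noteq> {}" and ne: "X \<inter> U \<union> D \<noteq> {}"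
    and step: "\<And>a b. a \<in> X \<Longrightarrow> a \<in> U \<Longrightarrow> a \<notin> D \<Longrightarrow> b \<in> X \<Longrightarrow> {a, b} \<in> E \<Longrightarrow> b \<in> U \<and> {a, b} \<in> E'"
  shows "conn E' (X \<inter> U \<union> D)"
proof -
  let ?S = "X \<inter> U \<union> D"
  have half: "adjs E' T (?S - T)" if T: "T \<subseteq> ?S" "T \<noteq> {}" "T \<noteq> ?S" "D \<inter> T = {}" for T
  proof -
    obtain t where t: "t \<in> T" using T by blast
    obtain u where u: "u \<in> X" "u \<notin> T"
      using D T by blast
    obtain a b where "a \<in> X" "a \<in> T" "b \<in> X" "b \<notin> T" "{a, b} \<in> E"
      using conn_cut[OF X, of t T u] t u T by blast
    moreover from this have "b \<in> U" "{a, b} \<in> E'"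
      using step[of a b] T by blast+
    ultimately show ?thesis
      by (intro adjsI[of a _ b]) auto
  qed
  show ?thesis unfolding conn_def
  proof (intro conjI allI impI)
    fix T assume T: "T \<subseteq> ?S" "T \<noteq> {}" "T \<noteq> ?S"
    consider "D \<inter> T = {}" | "D \<subseteq> T" | "D \<inter> T \<noteq> {}" "\<not> D \<subseteq> T" by blast
    then show "adjs E' T (?S - T)"
    proof cases
      case 2
      have "adjs E' (?S - T) (?S - (?S - T))"
        using half[of "?S - T"] T 2 by blast
      moreover have "?S - (?S - T) = T" using T by blast
      ultimately show ?thesis using adjs_sym by metis
    next
      case 3
      then have "adjs E' (D \<inter> T) (D - D \<inter> T)"
        using D unfolding conn_def by blast
      then show ?thesis by (rule adjs_mono) auto
    qed (use half T in blast)
  qed (use ne in blast)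
qed

text \<open>A set \<open>T\<close> without edges to the rest splits neither \<open>X\<close> nor
  \<open>Y\<close>, so it contains one of them and misses the other. The common vertex or the edge
  between them then contradicts this.\<close>

lemma conn_Un:
  assumes "conn E X" "conn E Y" "X \<inter> Y \<noteq> {} \<or> adjs E X Y"
  shows "conn E (X \<union> Y)"
  unfolding conn_def
proof (intro conjI allI impI)
  show "X \<union> Y \<noteq> {}" using assms conn_nonempty by blast
  fix T assume T: "T \<subseteq> X \<union> Y" "T \<noteq> {}" "T \<noteq> X \<union> Y"
  have cut: "adjs E T (X \<union> Y - T)" if "conn E Z" "Z \<subseteq> X \<union> Y" "Z \<inter> T \<noteq> {}" "\<not> Z \<subseteq> T" for Z
  proof -
    have "adjs E (Z \<inter> T) (Z - Z \<inter> T)" using that unfolding conn_def by blast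
    then show ?thesis by (rule adjs_mono) (use that in auto)
  qed
  show "adjs E T (X \<union> Y - T)"
  proof (rule ccontr)
    assume n: "\<not> adjs E T (X \<union> Y - T)"
    then have "X \<inter> T = {} \<or> X \<subseteq> T" "Y \<inter> T = {} \<or> Y \<subseteq> T"
      using cut[OF assms(1)] cut[OF assms(2)] by auto
    then consider "X \<inter> T = {}" "Y \<subseteq> T" | "Y \<inter> T = {}" "X \<subseteq> T" using T by blast
    then show False
    proof cases
      case 1
      then have "adjs E Y X" using assms(3) adjs_sym[of E X Y] by blast
      moreover have "X \<subseteq> X \<union> Y - T" using 1 by blast
      ultimately show False using n adjs_mono[OF _ order_refl \<open>Y \<subseteq> T\<close>] by blast
    next
      case 2
      then have "adjs E X Y" using assms(3) by blast
      moreover have "Y \<subseteq> X \<union> Y - T" using 2 by blast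
      ultimately show False using n adjs_mono[OF _ order_refl \<open>X \<subseteq> T\<close>] by blast
    qed
  qed
qed

lemma conn_Union:
  assumes "\<And>X. X \<in> A \<Longrightarrow> conn E X \<and> r \<in> X" "A \<noteq> {}"
  shows "conn E (\<Union>A)"
proof (rule connI_root)
  show "r \<in> \<Union>A" using assms by blast
  fix T assume T: "T \<subseteq> \<Union>A" "T \<noteq> {}" "r \<notin> T"
  then obtain t X where t: "t \<in> T" "X \<in> A" "t \<in> X" by blast
  obtain a b where "a \<in> X" "a \<in> T" "b \<in> X" "b \<notin> T" "{a, b} \<in> E"
    using conn_cut[of E X t T r] t T assms by blast
  then show "adjs E T (\<Union>A - T)" using t by (intro adjsI[of a _ b]) auto
qed

section \<open>Components, neighbourhoods and paths\<close>

definition is_comp :: "'a set set \<Rightarrow> 'a set \<Rightarrow> 'a set \<Rightarrow> bool" where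
  "is_comp E S C \<longleftrightarrow> C \<subseteq> S \<and> conn E C \<and> \<not> adjs E C (S - C)"

lemma conn_subset_comp:
  assumes "is_comp E S C" "conn E X" "X \<subseteq> S" "X \<inter> C \<noteq> {}"
  shows "X \<subseteq> C"
proof (rule ccontr)
  assume "\<not> X \<subseteq> C"
  then obtain t where t: "t \<in> X" "t \<notin> C" by blast
  obtain s where s: "s \<in> X" "s \<in> C" using assms(4) by blast
  obtain a b where "a \<in> X" "a \<in> C" "b \<in> X" "b \<notin> C" "{a, b} \<in> E"
    using conn_cut[OF assms(2) s t] .
  then show False using assms(1,3) unfolding is_comp_def adjs_def by blast
qed

lemma comp_eq: "is_comp E S C \<Longrightarrow> is_comp E S C' \<Longrightarrow> C \<inter> C' \<noteq> {} \<Longrightarrow> C = C'"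
  using conn_subset_comp[of E S C C'] conn_subset_comp[of E S C' C]
  unfolding is_comp_def by blast

text \<open>The component is the union of all connected subsets of \<open>S\<close> through
  \<open>u\<close>; a vertex of \<open>S\<close> adjacent to it could be added, hence belongs to it
  already.\<close>

lemma ex_comp:
  assumes "u \<in> S"
  obtains C where "is_comp E S C" "u \<in> C"
proof -
  let ?A = "{X. X \<subseteq> S \<and> conn E X \<and> u \<in> X}"
  have u: "{u} \<in> ?A" using assms conn_singleton by auto
  have c: "conn E (\<Union>?A)" using u by (intro conn_Union) auto
  have "\<not> adjs E (\<Union>?A) (S - \<Union>?A)"
  proof
    assume "adjs E (\<Union>?A) (S - \<Union>?A)"
    then obtain a b where ab: "a \<in> \<Union>?A" "b \<in> S" "b \<notin> \<Union>?A" "{a, b} \<in> E"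
      unfolding adjs_def by blast
    have "conn E (\<Union>?A \<union> {b})"
      using c conn_singleton ab by (intro conn_Un) (auto simp: adjs_def)
    moreover have "\<Union>?A \<union> {b} \<subseteq> S" "u \<in> \<Union>?A \<union> {b}" using ab(2) u by auto
    ultimately show False using ab(3) by blast
  qed
  then have "is_comp E S (\<Union>?A)" using c unfolding is_comp_def by blast
  then show thesis using that u by blast
qed

definition nbrs :: "'a set set \<Rightarrow> 'a set \<Rightarrow> 'a set" where
  "nbrs E C = {v. v \<notin> C \<and> (\<exists>u\<in>C. {u, v} \<in> E)}"

abbreviation walk :: "'a set set \<Rightarrow> 'a list \<Rightarrow> bool" where
  "walk E us \<equiv> successively (\<lambda>a b. {a, b} \<in> E) us"

lemma walk_conn: "walk E us \<Longrightarrow> us \<noteq> [] \<Longrightarrow> conn E (set us)"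
proof (induction us rule: induct_list012)
  case (3 a b us)
  then have "conn E ({a} \<union> set (b # us))"
    by (intro conn_Un) (auto simp: conn_singleton adjs_def)
  then show ?case by (simp add: insert_commute)
qed (auto simp: conn_singleton)

lemma walk_rev: "walk E (rev us) = walk E us"
  by (simp add: successively_rev insert_commute)

lemma conn_path:
  assumes "conn E S" "u \<in> S" "v \<in> S"
  obtains us where "us \<noteq> []" "distinct us" "walk E us" "hd us = u" "last us = v" "set us \<subseteq> S"
proof -
  define R where "R = {v. \<exists>us. us \<noteq> [] \<and> distinct us \<and> walk E us \<and> hd us = u \<and> last us = v \<and> set us \<subseteq> S}"
  have u: "u \<in> R" unfolding R_def using assms by (intro CollectI exI[of _ "[u]"]) auto
  have "v \<in> R"
  proof (rule ccontr)
    assume "v \<notin> R"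
    then obtain a b where ab: "a \<in> S" "a \<in> R" "b \<in> S" "b \<notin> R" "{a, b} \<in> E"
      using conn_cut[OF assms(1,2) u assms(3)] by blast
    then obtain us where us: "us \<noteq> []" "distinct us" "walk E us" "hd us = u" "last us = a" "set us \<subseteq> S"
      unfolding R_def by blast
    \<comment> \<open>If the path to \<open>a\<close> already ran through \<open>b\<close>, its part
      up to \<open>b\<close> would reach \<open>b\<close>.\<close>
    have "b \<notin> set us"
    proof
      assume "b \<in> set us"
      then obtain ys zs where e: "us = ys @ b # zs" by (meson split_list)
      then have "us = (ys @ [b]) @ zs" by simp
      then have "walk E (ys @ [b])" "distinct (ys @ [b])" "set (ys @ [b]) \<subseteq> S" "hd (ys @ [b]) = u"
        using us e by (auto simp: successively_append_iff hd_append)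
      then have "b \<in> R" unfolding R_def by (intro CollectI exI[of _ "ys @ [b]"]) simp
      then show False using ab(4) by blast
    qed
    then have "b \<in> R" unfolding R_def
      using us ab by (intro CollectI exI[of _ "us @ [b]"]) (auto simp: successively_append_iff hd_append)
    then show False using ab by blast
  qed
  then show thesis using that unfolding R_def by blast
qed

text \<open>For nonempty \<open>I\<close> every branch set has an incident edge, so the vertex set of the graph
  need not be mentioned.\<close>

definition K2_model ::
  "'a set set \<Rightarrow> 'i set \<Rightarrow> 'a set \<Rightarrow> 'a set \<Rightarrow> ('i \<Rightarrow> 'a set) \<Rightarrow> bool" where
  "K2_model E I A B S \<longleftrightarrow> conn E A \<and> conn E B \<and> A \<inter> B = {} \<and>
     (\<forall>i\<in>I. conn E (S i) \<and> S i \<inter> A = {} \<and> S i \<inter> B = {} \<and> adjs E A (S i) \<and> adjs E B (S i)) \<and>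
     (\<forall>i\<in>I. \<forall>j\<in>I. i \<noteq> j \<longrightarrow> S i \<inter> S j = {})"

definition has_K2 :: "'a set set \<Rightarrow> nat \<Rightarrow> bool" where
  "has_K2 E n \<longleftrightarrow> (\<exists>A B S. K2_model E {..<n} A B S)"

lemma has_K2I:
  assumes "K2_model E I A B S" "finite I" "n \<le> card I"
  shows "has_K2 E n"
proof -
  obtain J where J: "J \<subseteq> I" "card J = n" using assms(3) by (metis obtain_subset_with_card_n)
  then have "finite J" using assms(2) finite_subset by blast
  then obtain f where f: "bij_betw f {..<n} J"
    using J ex_bij_betw_nat_finite lessThan_atLeast0 by metis
  have fI: "f i \<in> I" if "i < n" for i using f J that unfolding bij_betw_def by auto
  have fj: "f i \<noteq> f j" if "i < n" "j < n" "i \<noteq> j" for i j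
    using f that unfolding bij_betw_def inj_on_def by auto
  have "K2_model E {..<n} A B (\<lambda>i. S (f i))"
    using assms(1) fI fj unfolding K2_model_def by simp
  then show ?thesis unfolding has_K2_def by blast
qed

lemma K2_model_lessThanD:
  assumes "K2_model E {..<n::nat} A B S"
  shows "conn E A" "conn E B" "A \<inter> B = {}" "\<And>i. i < n \<Longrightarrow> conn E (S i)"
    "\<And>i. i < n \<Longrightarrow> S i \<inter> A = {}" "\<And>i. i < n \<Longrightarrow> S i \<inter> B = {}"
    "\<And>i. i < n \<Longrightarrow> adjs E A (S i)" "\<And>i. i < n \<Longrightarrow> adjs E B (S i)"
    "\<And>i j. i < n \<Longrightarrow> j < n \<Longrightarrow> i \<noteq> j \<Longrightarrow> S i \<inter> S j = {}"
  using assms unfolding K2_model_def by auto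

lemma K2_model_swap: "K2_model E I A B S \<Longrightarrow> K2_model E I B A S"
  unfolding K2_model_def by (simp add: Int_commute)

lemma K2_model_subset: "K2_model E I A B S \<Longrightarrow> J \<subseteq> I \<Longrightarrow> K2_model E J A B S"
  unfolding K2_model_def by (simp add: subset_iff)

definition rooted_K22 :: "'a set set \<Rightarrow> 'a set \<Rightarrow> 'a \<Rightarrow> 'a \<Rightarrow> bool" where
  "rooted_K22 E U x y \<longleftrightarrow> (\<exists>A B S. K2_model E {..<2::nat} A B S \<and> x \<in> A \<and> y \<in> B \<and>
     A \<subseteq> U \<and> B \<subseteq> U \<and> (\<forall>i<2. S i \<subseteq> U))"

lemma rooted_K22_swap: "rooted_K22 E U x y \<Longrightarrow> rooted_K22 E U y x"
  unfolding rooted_K22_def using K2_model_swap by blast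

lemma rooted_K22I:
  assumes "conn E A" "conn E B" "conn E C" "conn E D" "x \<in> A" "y \<in> B"
    and "A \<union> B \<union> C \<union> D \<subseteq> U"
    and "A \<inter> B = {}" "A \<inter> C = {}" "A \<inter> D = {}" "B \<inter> C = {}" "B \<inter> D = {}" "C \<inter> D = {}"
    and "adjs E A C" "adjs E B C" "adjs E A D" "adjs E B D"
  shows "rooted_K22 E U x y"
  unfolding rooted_K22_def
  by (rule exI[of _ A], rule exI[of _ B], rule exI[of _ "\<lambda>i. if i = 0 then C else D"])
    (use assms in \<open>auto simp: K2_model_def\<close>)

definition noncrossing :: "'a set set \<Rightarrow> 'a list \<Rightarrow> bool" where
  "noncrossing E vs \<longleftrightarrow> (\<forall>i k j l. i < k \<and> k < j \<and> j < l \<and> l < length vs \<longrightarrow>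
     \<not> ({vs ! i, vs ! j} \<in> E \<and> {vs ! k, vs ! l} \<in> E))"

definition outer_path :: "'a set set \<Rightarrow> 'a set \<Rightarrow> 'a \<Rightarrow> 'a \<Rightarrow> 'a list \<Rightarrow> bool" where
  "outer_path E U x y vs \<longleftrightarrow> vs \<noteq> [] \<and> hd vs = x \<and> last vs = y \<and> distinct vs \<and> set vs = U \<and>
     walk E vs \<and> noncrossing E vs"

section \<open>Noncrossing hamilton paths\<close>

text \<open>The edge to \<open>Y\<close> puts one vertex of \<open>X\<close> into \<open>U\<close>;
  if another one were outside, connectedness would give an edge leaving \<open>U\<close>.\<close>

lemma conn_subset_edges:
  assumes "conn E X" "adjs E X Y" "\<Union>E \<subseteq> U"
  shows "X \<subseteq> U"
proof
  fix z assume z: "z \<in> X"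
  obtain a where a: "a \<in> X" "a \<in> U" using assms(2,3) unfolding adjs_def by blast
  show "z \<in> U"
  proof (rule ccontr)
    assume "z \<notin> U"
    then obtain c d where "d \<notin> U" "{c, d} \<in> E" using conn_cut[OF assms(1) a z] by blast
    then show False using assms(3) by blast
  qed
qed

lemma K2_model_subset_edges:
  assumes "K2_model E I A B S" "\<Union>E \<subseteq> U" "I \<noteq> {}"
  shows "A \<subseteq> U" "B \<subseteq> U" "i \<in> I \<Longrightarrow> S i \<subseteq> U"
  using assms conn_subset_edges adjs_sym unfolding K2_model_def by (metis ex_in_conv)+

lemma noncrossingD:
  "noncrossing E vs \<Longrightarrow> {vs ! i, vs ! j} \<in> E \<Longrightarrow> {vs ! k, vs ! l} \<in> E \<Longrightarrow>
    i < k \<Longrightarrow> k < j \<Longrightarrow> j < l \<Longrightarrow> l < length vs \<Longrightarrow> False"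
  unfolding noncrossing_def by blast

text \<open>An edge inside \<open>X\<close> from the interval between \<open>p\<close> and
  \<open>q\<close> to the outside would cross the edge joining these positions. It cannot end at
  them, since \<open>X\<close> avoids both vertices.\<close>

lemma noncrossing_separates:
  assumes nc: "noncrossing E vs" and d: "distinct vs" and X: "conn E X" "X \<subseteq> set vs"
    and e: "{vs ! p, vs ! q} \<in> E" "p < q" "q < length vs" "vs ! p \<notin> X" "vs ! q \<notin> X"
    and i: "p < i" "i < q" "vs ! i \<in> X"
    and j: "j < length vs" "vs ! j \<in> X"
  shows "p < j \<and> j < q"
proof (rule ccontr)
  assume j': "\<not> (p < j \<and> j < q)"
  let ?P = "(!) vs ` {p<..<q}"
  have i': "vs ! i \<in> ?P" using i by auto
  have j'': "vs ! j \<notin> ?P" using j' j(1) d e(3) by (auto simp: nth_eq_iff_index_eq)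
  obtain a b where ab: "a \<in> X" "a \<in> ?P" "b \<in> X" "b \<notin> ?P" "{a, b} \<in> E"
    by (rule conn_cut[OF X(1) i(3) i' j(2) j''])
  obtain r where r: "a = vs ! r" "p < r" "r < q" using ab(2) by auto
  obtain s where s: "b = vs ! s" "s < length vs" using ab(3) X(2) by (metis in_set_conv_nth subsetD)
  have "s \<noteq> p" "s \<noteq> q" using e ab s by auto
  moreover have "\<not> (p < s \<and> s < q)" using ab(4) s by auto
  ultimately consider "s < p" | "q < s" by linarith
  then show False
  proof cases
    case 1
    have "{vs ! s, vs ! r} \<in> E" using ab(5) r s by (simp add: insert_commute)
    from noncrossingD[OF nc this e(1) 1 r(2,3) e(3)] show False .
  next
    case 2
    have "{vs ! r, vs ! s} \<in> E" using ab(5) r s by simp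
    from noncrossingD[OF nc e(1) this r(2,3) 2 s(2)] show False .
  qed
qed

text \<open>As \<open>Y\<close> is connected, an edge with both ends in \<open>Y\<close> leads from
  the interval between \<open>i\<close> and \<open>j\<close> to the outside. Its ends are not in
  \<open>X\<close>, so it separates \<open>vs ! i\<close> from \<open>vs ! j\<close>, against the
  connectedness of \<open>X\<close>.\<close>

lemma noncrossing_no_interleave:
  assumes nc: "noncrossing E vs" and d: "distinct vs"
    and X: "conn E X" "X \<subseteq> set vs" and Y: "conn E Y" "Y \<subseteq> set vs" and "X \<inter> Y = {}"
    and o: "i < k" "k < j" "j < l" "l < length vs"
    and X2: "vs ! i \<in> X" "vs ! j \<in> X" and Y2: "vs ! k \<in> Y" "vs ! l \<in> Y"
  shows False
proof -
  let ?P = "(!) vs ` {i<..<j}"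
  have k: "vs ! k \<in> ?P" using o by auto
  have l: "vs ! l \<notin> ?P" using o d by (auto simp: nth_eq_iff_index_eq)
  obtain a b where ab: "a \<in> Y" "a \<in> ?P" "b \<in> Y" "b \<notin> ?P" "{a, b} \<in> E"
    by (rule conn_cut[OF Y(1) Y2(1) k Y2(2) l])
  obtain p where p: "a = vs ! p" "i < p" "p < j" using ab(2) by auto
  obtain q where q: "b = vs ! q" "q < length vs" using ab(3) Y(2) by (metis in_set_conv_nth subsetD)
  have nX: "vs ! p \<notin> X" "vs ! q \<notin> X" using assms(7) ab p q by auto
  have "q \<noteq> i" "q \<noteq> j" using nX X2 by auto
  moreover have "\<not> (i < q \<and> q < j)" using ab(4) q by auto
  ultimately consider "q < i" | "j < q" by linarith
  then show False
  proof cases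
    case 1
    have "{vs ! q, vs ! p} \<in> E" using ab(5) p q by (simp add: insert_commute)
    from noncrossing_separates[OF nc d X this _ _ nX(2,1) 1 p(2) X2(1) _ X2(2)] show False
      using 1 p o by simp
  next
    case 2
    have "{vs ! p, vs ! q} \<in> E" using ab(5) p q by simp
    from noncrossing_separates[OF nc d X this _ q(2) nX(1,2) p(3) 2 X2(2) _ X2(1)] show False
      using 2 p o by simp
  qed
qed

text \<open>Two spokes on the same side of the hubs would make the connected sets formed by one hub
  and one spoke each interleave.\<close>

lemma K2_model_spokes_same_side:
  assumes nc: "noncrossing E vs" and d: "distinct vs" and E: "\<Union>E \<subseteq> set vs"
    and M: "K2_model E I A B S" and ij: "i \<in> I" "j \<in> I" "i \<noteq> j"
    and p: "p < q" "q < length vs" "vs ! p \<in> A" "vs ! q \<in> B"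
    and s: "s < length vs" "t < length vs" "vs ! s \<in> S i" "vs ! t \<in> S j"
  shows "(p < s \<and> s < q) \<noteq> (p < t \<and> t < q)"
proof -
  have sub: "A \<subseteq> set vs" "B \<subseteq> set vs" "S i \<subseteq> set vs" "S j \<subseteq> set vs"
    using K2_model_subset_edges[OF M E] ij by auto
  have dis: "A \<inter> B = {}" "S i \<inter> A = {}" "S i \<inter> B = {}" "S j \<inter> A = {}" "S j \<inter> B = {}" "S i \<inter> S j = {}"
    using M ij unfolding K2_model_def by auto
  have cc: "conn E (A \<union> S i)" "conn E (A \<union> S j)" "conn E (B \<union> S i)" "conn E (B \<union> S j)"
    using M ij unfolding K2_model_def by (auto intro: conn_Un)
  \<comment> \<open>There are two ways to combine each hub with one spoke: \<open>c1\<close> and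
    \<open>c4\<close> pair \<open>A\<close> with \<open>S i\<close>, \<open>c2\<close> and
    \<open>c3\<close> pair \<open>A\<close> with \<open>S j\<close>. Within each pair the facts
    differ in which of the two sets comes first on the path.\<close>
  have c1: False if "m < k" "k < m'" "m' < l" "l < length vs" "vs ! m \<in> A \<union> S i" "vs ! m' \<in> A \<union> S i"
      "vs ! k \<in> B \<union> S j" "vs ! l \<in> B \<union> S j" for m k m' l
    by (rule noncrossing_no_interleave[OF nc d cc(1) _ cc(4) _ _ that]) (use sub dis in blast)+
  have c2: False if "m < k" "k < m'" "m' < l" "l < length vs" "vs ! m \<in> A \<union> S j" "vs ! m' \<in> A \<union> S j"
      "vs ! k \<in> B \<union> S i" "vs ! l \<in> B \<union> S i" for m k m' l
    by (rule noncrossing_no_interleave[OF nc d cc(2) _ cc(3) _ _ that]) (use sub dis in blast)+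
  have c3: False if "m < k" "k < m'" "m' < l" "l < length vs" "vs ! m \<in> B \<union> S i" "vs ! m' \<in> B \<union> S i"
      "vs ! k \<in> A \<union> S j" "vs ! l \<in> A \<union> S j" for m k m' l
    by (rule noncrossing_no_interleave[OF nc d cc(3) _ cc(2) _ _ that]) (use sub dis in blast)+
  have c4: False if "m < k" "k < m'" "m' < l" "l < length vs" "vs ! m \<in> B \<union> S j" "vs ! m' \<in> B \<union> S j"
      "vs ! k \<in> A \<union> S i" "vs ! l \<in> A \<union> S i" for m k m' l
    by (rule noncrossing_no_interleave[OF nc d cc(4) _ cc(1) _ _ that]) (use sub dis in blast)+
  have ne: "s \<noteq> t" "s \<noteq> p" "s \<noteq> q" "t \<noteq> p" "t \<noteq> q" using p s dis by auto
  show ?thesis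
  proof
    assume eq: "(p < s \<and> s < q) = (p < t \<and> t < q)"
    have "s < t \<Longrightarrow> p < s \<and> t < q \<or> t < p \<or> s < p \<and> q < t \<or> q < s"
      "t < s \<Longrightarrow> p < t \<and> s < q \<or> s < p \<or> t < p \<and> q < s \<or> q < t" "s < t \<or> t < s"
      using eq ne by linarith+
    then show False
      using c2[of p s t q] c1[of s t p q] c3[of s p q t] c1[of p q s t]
        c1[of p t s q] c2[of t s p q] c4[of t p q s] c2[of p q t s] p s by auto
  qed
qed

text \<open>Pigeonhole: one vertex from each hub divides the path into an inner and an outer part,
  and two of the three spokes would choose the same one.\<close>

lemma noncrossing_no_K23:
  assumes nc: "noncrossing E vs" and d: "distinct vs" and E: "\<Union>E \<subseteq> set vs"
  shows "\<not> has_K2 E 3"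
proof
  assume "has_K2 E 3"
  then obtain A B S where M: "K2_model E {..<3::nat} A B S" unfolding has_K2_def by blast
  have sub: "A \<subseteq> set vs" "B \<subseteq> set vs" "\<And>i. i < 3 \<Longrightarrow> S i \<subseteq> set vs"
    using K2_model_subset_edges[OF M E] by (simp_all add: lessThan_empty_iff)
  have ne: "A \<noteq> {}" "B \<noteq> {}" "\<And>i. i < 3 \<Longrightarrow> S i \<noteq> {}" "A \<inter> B = {}"
    using M conn_nonempty unfolding K2_model_def by auto
  obtain p where p: "p < length vs" "vs ! p \<in> A"
    using ne(1) sub(1) by (metis ex_in_conv in_set_conv_nth subsetD)
  obtain q where q: "q < length vs" "vs ! q \<in> B"
    using ne(2) sub(2) by (metis ex_in_conv in_set_conv_nth subsetD)
  have "\<exists>s. s < length vs \<and> vs ! s \<in> S i" if "i < 3" for i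
    using ne(3)[OF that] sub(3)[OF that] by (metis ex_in_conv in_set_conv_nth subsetD)
  then obtain s where s: "\<And>i. i < 3 \<Longrightarrow> s i < length vs \<and> vs ! s i \<in> S i" by metis
  have "p \<noteq> q" using p q ne(4) by auto
  then obtain A' B' p' q' where M': "K2_model E {..<3} A' B' S"
    and o: "p' < q'" "q' < length vs" "vs ! p' \<in> A'" "vs ! q' \<in> B'"
    using M K2_model_swap[OF M] p q by (metis linorder_neqE_nat)
  define f where "f i \<longleftrightarrow> p' < s i \<and> s i < q'" for i
  have "f i \<noteq> f j" if "i < 3" "j < 3" "i \<noteq> j" for i j
    unfolding f_def using K2_model_spokes_same_side[OF nc d E M' _ _ that(3) o] s that by auto
  from this[of 0 1] this[of 0 2] this[of 1 2] show False by auto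
qed

lemma outer_path_ends:
  assumes "outer_path E U x y vs"
  shows "vs ! 0 = x" "vs ! (length vs - 1) = y" "0 < length vs"
  using assms unfolding outer_path_def by (auto simp: hd_conv_nth last_conv_nth)

text \<open>The hubs contain the two ends of the path, so both spokes lie between them and thus on
  the same side.\<close>

lemma outer_path_no_rooted_K22:
  assumes "outer_path E U x y vs" and E: "\<Union>E \<subseteq> U"
  shows "\<not> rooted_K22 E U x y"
proof
  assume "rooted_K22 E U x y"
  then obtain A B S where M: "K2_model E {..<2::nat} A B S" and xy: "x \<in> A" "y \<in> B"
    unfolding rooted_K22_def by blast
  have nc: "noncrossing E vs" and d: "distinct vs" and U: "set vs = U"
    using assms(1) unfolding outer_path_def by auto
  note ends = outer_path_ends[OF assms(1)]
  have sub: "S i \<subseteq> set vs" if "i < 2" for i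
    using K2_model_subset_edges(3)[OF M E] that U by auto
  have dis: "A \<inter> B = {}" "S i \<noteq> {}" "S i \<inter> A = {}" "S i \<inter> B = {}" if "i < 2" for i
    using M that conn_nonempty unfolding K2_model_def by auto
  have "\<exists>s. s < length vs \<and> vs ! s \<in> S i" if "i < 2" for i
    using dis(2)[OF that] sub[OF that] by (metis ex_in_conv in_set_conv_nth subsetD)
  then obtain s where s: "\<And>i. i < 2 \<Longrightarrow> s i < length vs \<and> vs ! s i \<in> S i" by metis
  have pos: "0 < s i \<and> s i < length vs - 1" if "i < 2" for i
  proof -
    have "vs ! s i \<noteq> x" "vs ! s i \<noteq> y" using s[OF that] dis[OF that] xy by auto
    then have "s i \<noteq> 0" "s i \<noteq> length vs - 1" using ends by metis+
    then show ?thesis using s[OF that] by linarith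
  qed
  have "0 \<noteq> length vs - 1" using pos[of 0] by linarith
  then show False
    using K2_model_spokes_same_side[OF nc d _ M, of 0 1 0 "length vs - 1" "s 0" "s 1"]
      E U s[of 0] s[of 1] pos[of 0] pos[of 1] xy ends by auto
qed

text \<open>In a crossing the two middle positions are inner vertices of the path, and each of the
  crossing edges uses one of them. So the edge joining the ends of the path takes part in no
  crossing.\<close>

lemma outer_path_insert_no_K23:
  assumes op: "outer_path E U x y vs" and E: "\<Union>E \<subseteq> U"
  shows "\<not> has_K2 (insert {x, y} E) 3"
proof (rule noncrossing_no_K23)
  have nc: "noncrossing E vs" and d: "distinct vs" and U: "set vs = U"
    using op unfolding outer_path_def by auto
  note ends = outer_path_ends[OF op]
  show "distinct vs" by fact
  have "x \<in> set vs" "y \<in> set vs" using op unfolding outer_path_def by auto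
  then show "\<Union>(insert {x, y} E) \<subseteq> set vs" using E U by auto
  show "noncrossing (insert {x, y} E) vs" unfolding noncrossing_def
  proof (intro allI impI notI)
    fix i k j l
    assume o: "i < k \<and> k < j \<and> j < l \<and> l < length vs"
      and e: "{vs ! i, vs ! j} \<in> insert {x, y} E \<and> {vs ! k, vs ! l} \<in> insert {x, y} E"
    have "vs ! j \<noteq> x" "vs ! j \<noteq> y" "vs ! k \<noteq> x" "vs ! k \<noteq> y"
      using o d ends(3) nth_eq_iff_index_eq[OF d, of _ 0] nth_eq_iff_index_eq[OF d, of _ "length vs - 1"]
      by (auto simp: ends(1,2)[symmetric])
    then have "{vs ! i, vs ! j} \<in> E" "{vs ! k, vs ! l} \<in> E" using e by (auto simp: doubleton_eq_iff)
    then show False using nc o unfolding noncrossing_def by blast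
  qed
qed

section \<open>Replacing an outerplanar piece by a path of length two\<close>

text \<open>\<open>EH\<close> is the piece on \<open>U\<close>, attached to the rest
  \<open>E1\<close> at \<open>x\<close> and \<open>y\<close>. The new vertex \<open>w\<close> only
  has to avoid \<open>V1\<close>, so both a fresh vertex and an inner vertex of the piece can
  serve.\<close>

locale outer_attachment =
  fixes E1 EH :: "'a set set" and V1 U :: "'a set" and x y w :: 'a and vs :: "'a list"
  assumes op: "outer_path EH U x y vs" and EH: "\<Union>EH \<subseteq> U" and xy: "x \<noteq> y"
    and E1: "\<Union>E1 \<subseteq> V1" and VU: "V1 \<inter> U = {x, y}" and w: "w \<notin> V1"
begin

abbreviation "E \<equiv> E1 \<union> EH"
abbreviation "E2 \<equiv> E1 \<union> {{x, w}, {w, y}}"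
abbreviation "H0 \<equiv> U - {x, y}"

lemma xyV: "x \<in> V1" "y \<in> V1" "x \<in> U" "y \<in> U" "w \<noteq> x" "w \<noteq> y"
  using VU w by auto

lemma E1_mem: "{a, b} \<in> E1 \<Longrightarrow> a \<in> V1 \<and> b \<in> V1"
  using E1 by auto

lemma EH_mem: "{a, b} \<in> EH \<Longrightarrow> a \<in> U \<and> b \<in> U"
  using EH by auto

lemma inner_edge:
  assumes "{a, b} \<in> E" "a \<in> H0"
  shows "{a, b} \<in> EH" "b \<in> U"
proof -
  have "a \<notin> V1" using assms(2) VU by auto
  then show "{a, b} \<in> EH" using assms(1) E1_mem by blast
  then show "b \<in> U" using EH_mem by blast
qed

lemma inner_edge':
  assumes "{a, b} \<in> E" "b \<in> H0"
  shows "{a, b} \<in> EH" "a \<in> U"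
  using inner_edge[of b a] assms by (simp_all add: insert_commute)

lemma outer_edge:
  assumes "{a, b} \<in> E" "a \<in> V1 - {x, y}"
  shows "{a, b} \<in> E1" "b \<in> V1"
proof -
  have "a \<notin> U" using assms(2) VU by auto
  then show "{a, b} \<in> E1" using assms(1) EH_mem by blast
  then show "b \<in> V1" using E1_mem by blast
qed

lemma conn_pair: "{a, b} \<in> E' \<Longrightarrow> conn E' {a, b}"
  using conn_Un[of E' "{a}" "{b}"] conn_singleton[of E'] by (auto simp: adjs_def insert_commute)

lemma gateI:
  "D \<subseteq> X \<Longrightarrow> D = {} \<or> conn E' D \<Longrightarrow> D = {} \<or> conn E' D \<and> D \<inter> X \<noteq> {}"
  by (metis Int_absorb2)

text \<open>If \<open>X\<close> contains both \<open>x\<close> and \<open>y\<close>, they may be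
  connected only through the part of \<open>X\<close> outside \<open>U\<close>; the added edge takes
  its place.\<close>

lemma conn_inside_plus:
  assumes "conn E X" "X \<inter> U \<noteq> {}"
  shows "conn (insert {x, y} EH) (X \<inter> U)"
proof -
  have D: "X \<inter> {x, y} = {} \<or> X \<inter> {x, y} = {x} \<or> X \<inter> {x, y} = {y} \<or> X \<inter> {x, y} = {x, y}" by auto
  have "conn (insert {x, y} EH) (X \<inter> U \<union> X \<inter> {x, y})"
  proof (rule conn_gate[OF assms(1)])
    show "X \<inter> {x, y} = {} \<or> conn (insert {x, y} EH) (X \<inter> {x, y}) \<and> X \<inter> {x, y} \<inter> X \<noteq> {}"
      using D conn_pair[of x y "insert {x, y} EH"] conn_singleton[of _ x] conn_singleton[of _ y]
      by (intro gateI Int_lower1) (metis insertI1)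
  qed (use assms(2) inner_edge in auto)
  moreover have "X \<inter> U \<union> X \<inter> {x, y} = X \<inter> U" using xyV by auto
  ultimately show ?thesis by simp
qed

lemma conn_inside:
  assumes "conn E X" "X \<inter> U \<noteq> {}" "\<not> (x \<in> X \<and> y \<in> X)"
  shows "conn EH (X \<inter> U)"
proof -
  have D: "X \<inter> {x, y} = {} \<or> X \<inter> {x, y} = {x} \<or> X \<inter> {x, y} = {y}" using assms(3) by auto
  have "conn EH (X \<inter> U \<union> X \<inter> {x, y})"
  proof (rule conn_gate[OF assms(1)])
    show "X \<inter> {x, y} = {} \<or> conn EH (X \<inter> {x, y}) \<and> X \<inter> {x, y} \<inter> X \<noteq> {}"
      using D conn_singleton[of _ x] conn_singleton[of _ y]
      by (intro gateI Int_lower1) metis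
  qed (use assms(2) inner_edge in auto)
  moreover have "X \<inter> U \<union> X \<inter> {x, y} = X \<inter> U" using xyV by auto
  ultimately show ?thesis by simp
qed

lemma conn_outside:
  assumes "conn E X" "X \<inter> V1 \<noteq> {}" "\<not> (x \<in> X \<and> y \<in> X)"
  shows "conn E2 (X \<inter> V1)"
proof -
  have D: "X \<inter> {x, y} = {} \<or> X \<inter> {x, y} = {x} \<or> X \<inter> {x, y} = {y}" using assms(3) by auto
  have "conn E2 (X \<inter> V1 \<union> X \<inter> {x, y})"
  proof (rule conn_gate[OF assms(1)])
    show "X \<inter> {x, y} = {} \<or> conn E2 (X \<inter> {x, y}) \<and> X \<inter> {x, y} \<inter> X \<noteq> {}"
      using D conn_singleton[of _ x] conn_singleton[of _ y]
      by (intro gateI Int_lower1) metis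
  qed (use assms(2) outer_edge in auto)
  moreover have "X \<inter> V1 \<union> X \<inter> {x, y} = X \<inter> V1" using xyV by auto
  ultimately show ?thesis by simp
qed

text \<open>The new vertex is given to the branch set containing \<open>x\<close>, so disjoint sets
  keep disjoint images. If this set contains \<open>y\<close> too, \<open>w\<close> restores a
  connection that ran through the piece.\<close>

definition shrink :: "'a set \<Rightarrow> 'a set" where
  "shrink X = X \<inter> V1 \<union> (if x \<in> X then {w} else {})"

lemma conn_shrink:
  assumes X: "conn E X" "X \<inter> V1 \<noteq> {}"
  shows "conn E2 (shrink X)"
proof (cases "x \<in> X")
  case False
  then show ?thesis using conn_outside[OF X] unfolding shrink_def by simp
next
  case True
  have xw: "conn E2 {x, w}" by (rule conn_pair) simp
  have "conn E2 ({x, w} \<union> {y})"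
    using xw by (intro conn_Un) (auto simp: conn_singleton adjs_def)
  then have c3: "conn E2 {x, w, y}" by (simp add: insert_commute)
  let ?D = "insert w (X \<inter> {x, y})"
  have D: "?D = {x, w} \<or> ?D = {x, w, y}" using True by auto
  have "conn E2 (X \<inter> V1 \<union> ?D)"
  proof (rule conn_gate[OF X(1)])
    show "?D = {} \<or> conn E2 ?D \<and> ?D \<inter> X \<noteq> {}" using D xw c3 True by auto
  qed (use outer_edge in auto)
  moreover have "X \<inter> V1 \<union> ?D = shrink X" using xyV True unfolding shrink_def by auto
  ultimately show ?thesis by simp
qed

lemma touches:
  assumes "conn E X" "X \<inter> H0 \<noteq> {}" "\<not> X \<subseteq> H0"
  shows "x \<in> X \<or> y \<in> X"
proof -
  obtain s t where st: "s \<in> X" "s \<in> H0" "t \<in> X" "t \<notin> H0" using assms(2,3) by blast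
  obtain a b where "a \<in> X" "a \<in> H0" "b \<in> X" "b \<notin> H0" "{a, b} \<in> E"
    by (rule conn_cut[OF assms(1) st])
  then show ?thesis using inner_edge[of a b] by auto
qed

text \<open>An edge lost in the exchange lies in the piece, so each of the two sets contains one of
  the attachment vertices. One set has \<open>x\<close> and with it \<open>w\<close>, the other has
  \<open>y\<close>, and the edge between \<open>w\<close> and \<open>y\<close> replaces the lost
  one.\<close>

lemma adjs_shrink:
  assumes "conn E X" "conn E Y" "X \<inter> Y = {}" "\<not> X \<subseteq> H0" "\<not> Y \<subseteq> H0" "adjs E X Y"
  shows "adjs E2 (shrink X) (shrink Y)"
proof -
  obtain u v where uv: "u \<in> X" "v \<in> Y" "{u, v} \<in> E" using assms(6) unfolding adjs_def by blast
  show ?thesis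
  proof (cases "{u, v} \<in> E1")
    case True
    then show ?thesis using uv E1_mem[of u v] unfolding shrink_def by (intro adjsI[of u _ v]) auto
  next
    case False
    then have "u \<in> U" "v \<in> U" using uv(3) EH_mem by auto
    then have "x \<in> X \<or> y \<in> X" "x \<in> Y \<or> y \<in> Y"
      using touches[OF assms(1) _ assms(4)] touches[OF assms(2) _ assms(5)] uv by blast+
    then consider "x \<in> X" "y \<in> Y" | "y \<in> X" "x \<in> Y" using assms(3) by blast
    then show ?thesis
    proof cases
      case 1
      then show ?thesis using xyV unfolding shrink_def by (intro adjsI[of w _ y]) auto
    next
      case 2
      then show ?thesis using xyV unfolding shrink_def
        by (intro adjsI[of y _ w]) (auto simp: insert_commute)
    qed
  qed
qed

lemma at_most_one:
  assumes "\<And>i j. i \<in> I \<Longrightarrow> j \<in> I \<Longrightarrow> i \<noteq> j \<Longrightarrow> S i \<inter> S j = {}"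
  shows "card {i \<in> I. z \<in> S i} \<le> 1"
proof -
  have "\<exists>k. {i \<in> I. z \<in> S i} \<subseteq> {k}"
    using assms by blast
  then obtain k where "{i \<in> I. z \<in> S i} \<subseteq> {k}" by blast
  from card_mono[OF _ this] show ?thesis by simp
qed

text \<open>A hub inside the piece forces every spoke to reach into \<open>U\<close>. Trimmed to
  \<open>U\<close>, at least three spokes survive and give a K_{2,3} in the piece with the edge
  between \<open>x\<close> and \<open>y\<close> added.\<close>

lemma hub_not_inside:
  assumes M: "K2_model E {..<4::nat} A B S"
  shows "\<not> A \<subseteq> H0"
proof
  assume A: "A \<subseteq> H0"
  note m = K2_model_lessThanD[OF M]
  have AS: "\<exists>a\<in>A. \<exists>s\<in>S i \<inter> U. {a, s} \<in> EH" if i: "i < 4" for i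
  proof -
    obtain a s where as: "a \<in> A" "s \<in> S i" "{a, s} \<in> E" using m(7)[OF i] unfolding adjs_def by blast
    then have "a \<in> H0" using A by blast
    from inner_edge[OF as(3) this] show ?thesis using as by blast
  qed
  let ?J = "\<lambda>z. {i \<in> {..<4::nat}. z \<in> S i}"
  have Jz: "card (?J z) \<le> 1" for z
    by (rule at_most_one) (use m(9) in auto)
  have Sin: "S i \<subseteq> H0" if "i < 4" "x \<notin> S i" "y \<notin> S i" for i
  proof (rule ccontr)
    assume n: "\<not> S i \<subseteq> H0"
    have "S i \<inter> H0 \<noteq> {}" using AS[OF that(1)] that(2,3) by blast
    then show False using touches[OF m(4)[OF that(1)] _ n] that by blast
  qed
  \<comment> \<open>For these spokes every edge to \<open>B\<close> has an end among the inner
    vertices of the piece and thus survives the trimming.\<close>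
  define I0 where "I0 = {i \<in> {..<4}. B \<subseteq> H0 \<or> S i \<subseteq> H0}"
  have key: "B \<inter> U \<noteq> {} \<and> 3 \<le> card I0"
  proof (cases "B \<subseteq> H0")
    case True
    then have "I0 = {..<4}" unfolding I0_def by auto
    moreover have "B \<noteq> {}" using m(2) conn_nonempty by blast
    ultimately show ?thesis using True by auto
  next
    case False
    \<comment> \<open>\<open>x\<close> and \<open>y\<close> lie in at most two of the four spokes,
      so some spoke is entirely inside the piece and brings \<open>B\<close> into
      \<open>U\<close>.\<close>
    have "card (?J x \<union> ?J y) \<le> 2" using card_Un_le[of "?J x" "?J y"] Jz[of x] Jz[of y] by linarith
    then have "?J x \<union> ?J y \<noteq> {..<4}" by (intro notI) simp
    then obtain i where i: "i < 4" "x \<notin> S i" "y \<notin> S i" by blast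
    then obtain b s where b: "b \<in> B" "s \<in> S i" "{b, s} \<in> E" using m(8) unfolding adjs_def by blast
    then have bU: "b \<in> U" using inner_edge[of s b] Sin[OF i] by (auto simp: insert_commute)
    \<comment> \<open>One of \<open>x\<close> and \<open>y\<close> belongs to \<open>B\<close>; only
      the other one, \<open>z\<close>, can keep a spoke from lying inside, and at most one spoke
      contains it.\<close>
    have "x \<in> B \<or> y \<in> B" using touches[OF m(2) _ False] bU b(1) by blast
    then obtain z where z: "\<And>i. i < 4 \<Longrightarrow> z \<notin> S i \<Longrightarrow> S i \<subseteq> H0"
      using Sin m(6) by (metis disjoint_iff)
    have "{..<4} - ?J z \<subseteq> I0" using z unfolding I0_def by auto
    then have "card ({..<4} - ?J z) \<le> card I0" by (intro card_mono) (auto simp: I0_def)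
    moreover have "card ({..<4} - ?J z) = 4 - card (?J z)" by (subst card_Diff_subset) auto
    ultimately show ?thesis using Jz[of z] b(1) bU by auto
  qed
  have "K2_model (insert {x, y} EH) I0 (A \<inter> U) (B \<inter> U) (\<lambda>i. S i \<inter> U)"
    unfolding K2_model_def
  proof (intro conjI ballI impI)
    show "conn (insert {x, y} EH) (A \<inter> U)"
      by (rule conn_inside_plus[OF m(1)]) (use conn_nonempty[OF m(1)] A in auto)
    show "conn (insert {x, y} EH) (B \<inter> U)"
      by (rule conn_inside_plus[OF m(2)]) (use key in auto)
    show "A \<inter> U \<inter> (B \<inter> U) = {}" using m(3) by blast
  next
    fix i assume "i \<in> I0"
    then have i: "i < 4" "B \<subseteq> H0 \<or> S i \<subseteq> H0" unfolding I0_def by auto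
    show "conn (insert {x, y} EH) (S i \<inter> U)"
      by (rule conn_inside_plus[OF m(4)[OF i(1)]]) (use AS[OF i(1)] in auto)
    show "S i \<inter> U \<inter> (A \<inter> U) = {}" "S i \<inter> U \<inter> (B \<inter> U) = {}" using m(5,6) i by auto
    show "adjs (insert {x, y} EH) (A \<inter> U) (S i \<inter> U)"
    proof -
      obtain a s where "a \<in> A" "s \<in> S i" "s \<in> U" "{a, s} \<in> EH" using AS[OF i(1)] by blast
      then show ?thesis using A by (intro adjsI[of a _ s]) auto
    qed
    obtain b s where b: "b \<in> B" "s \<in> S i" "{b, s} \<in> E" using m(8) i unfolding adjs_def by blast
    have "{b, s} \<in> EH"
      using i(2) inner_edge(1)[OF b(3)] inner_edge'(1)[OF b(3)] b(1,2) by blast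
    moreover from this have "b \<in> U" "s \<in> U" using EH_mem by blast+
    ultimately show "adjs (insert {x, y} EH) (B \<inter> U) (S i \<inter> U)"
      using b by (intro adjsI[of b _ s]) auto
  next
    fix i j assume "i \<in> I0" "j \<in> I0" "i \<noteq> j"
    then show "S i \<inter> U \<inter> (S j \<inter> U) = {}" using m(9)[of i j] unfolding I0_def by auto
  qed
  then have "has_K2 (insert {x, y} EH) 3"
    by (rule has_K2I) (use key in \<open>auto simp: I0_def\<close>)
  then show False using outer_path_insert_no_K23[OF op EH] by blast
qed

text \<open>Two spokes inside the piece would form a rooted K_{2,2} there. So \<open>S k\<close> is
  the only one, and the others, containing neither \<open>x\<close> nor \<open>y\<close>, avoid
  \<open>U\<close>. The hubs keep \<open>x\<close> and \<open>y\<close>, and the single vertex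
  \<open>w\<close> between them replaces \<open>S k\<close>.\<close>

lemma spoke_inside:
  assumes M: "K2_model E {..<4::nat} A B S" and k: "k < 4" "S k \<subseteq> H0" and xA: "x \<in> A" and yB: "y \<in> B"
  shows "has_K2 E2 4"
proof -
  note m = K2_model_lessThanD[OF M]
  have ny: "y \<notin> A" "x \<notin> B" using xA yB m(3) by auto
  have nS: "x \<notin> S i" "y \<notin> S i" if "i < 4" for i using m(5,6)[OF that] xA yB by auto
  have adj: "adjs EH (X \<inter> U) (S i)" if X: "adjs E X (S i)" "S i \<subseteq> H0" for X i
  proof -
    obtain a s where "a \<in> X" "s \<in> S i" "{a, s} \<in> E" using X(1) unfolding adjs_def by blast
    then show ?thesis using inner_edge[of s a] X(2)
      by (intro adjsI[of a _ s]) (auto simp: insert_commute)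
  qed
  have cS: "conn EH (S i)" if "i < 4" "S i \<subseteq> H0" for i
  proof -
    have "S i \<inter> U = S i" using that by auto
    then show ?thesis using conn_inside[OF m(4)[OF that(1)]] conn_nonempty[OF m(4)[OF that(1)]] nS that by auto
  qed
  have uniq: "i = k" if "i < 4" "S i \<subseteq> H0" for i
  proof (rule ccontr)
    assume ne: "i \<noteq> k"
    have "rooted_K22 EH U x y"
    proof (rule rooted_K22I)
      show "conn EH (A \<inter> U)" "conn EH (B \<inter> U)"
        using conn_inside[OF m(1)] conn_inside[OF m(2)] ny xA yB xyV by auto
      show "conn EH (S k)" "conn EH (S i)" using cS k that by auto
      show "S k \<inter> S i = {}" using m(9)[of k i] k that ne by auto
    qed (use m(3) m(5,6)[OF k(1)] m(5,6)[OF that(1)] k that adj m(7,8) xA yB xyV in auto)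
    then show False using outer_path_no_rooted_K22[OF op EH] by blast
  qed
  have out: "S i \<inter> U = {}" if "i < 4" "i \<noteq> k" for i
    using touches[OF m(4)[OF that(1)]] uniq[OF that(1)] that(2) nS[OF that(1)] by auto
  have VUs: "S i \<subseteq> V1 \<union> U" if "i < 4" for i
  proof -
    have "\<Union>E \<subseteq> V1 \<union> U" using E1 EH by auto
    then show ?thesis using K2_model_subset_edges(3)[OF M _ _, of "V1 \<union> U" i] that by auto
  qed
  define S' where "S' i = (if i = k then {w} else S i)" for i
  have "K2_model E2 {..<4} (A \<inter> V1) (B \<inter> V1) S'"
    unfolding K2_model_def
  proof (intro conjI ballI impI)
    show "conn E2 (A \<inter> V1)" "conn E2 (B \<inter> V1)"
      using conn_outside[OF m(1)] conn_outside[OF m(2)] xA yB ny xyV by auto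
    show "A \<inter> V1 \<inter> (B \<inter> V1) = {}" using m(3) by blast
  next
    fix i assume "i \<in> {..<4::nat}"
    then have i: "i < 4" by simp
    have eq: "i \<noteq> k \<Longrightarrow> S i \<inter> V1 = S i" using VUs[OF i] out[OF i] by blast
    show "conn E2 (S' i)"
      using conn_outside[OF m(4)[OF i]] conn_nonempty[OF m(4)[OF i]] nS[OF i] eq
      by (cases "i = k") (auto simp: S'_def conn_singleton)
    show "S' i \<inter> (A \<inter> V1) = {}" "S' i \<inter> (B \<inter> V1) = {}"
      using m(5,6)[OF i] w unfolding S'_def by auto
    have adjV: "adjs E2 (X \<inter> V1) (S i)" if X: "adjs E X (S i)" "i \<noteq> k" for X
    proof -
      obtain a s where as: "a \<in> X" "s \<in> S i" "{a, s} \<in> E" using X(1) unfolding adjs_def by blast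
      have "s \<notin> U" using out[OF i X(2)] as(2) by auto
      then have "{a, s} \<in> E1" using as(3) EH_mem by blast
      then show ?thesis using as E1_mem by (intro adjsI[of a _ s]) auto
    qed
    show "adjs E2 (A \<inter> V1) (S' i)"
      using adjV[OF m(7)[OF i]] xA xyV by (cases "i = k") (auto simp: S'_def adjs_def)
    show "adjs E2 (B \<inter> V1) (S' i)"
      using adjV[OF m(8)[OF i]] yB xyV by (cases "i = k") (auto simp: S'_def adjs_def insert_commute)
  next
    fix i j assume ij: "i \<in> {..<4::nat}" "j \<in> {..<4::nat}" "i \<noteq> j"
    have "w \<notin> S l" if "l < 4" "l \<noteq> k" for l using VUs[OF that(1)] out[OF that] w by blast
    then show "S' i \<inter> S' j = {}" using ij m(9)[of i j] unfolding S'_def by auto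
  qed
  then show ?thesis unfolding has_K2_def by blast
qed

text \<open>If no branch set lies inside the piece, all of them can be shrunk. A hub never lies
  inside; a spoke inside must be reached by both hubs, which puts \<open>x\<close> and
  \<open>y\<close> into different hubs.\<close>

lemma has_K24_replace:
  assumes "has_K2 E 4"
  shows "has_K2 E2 4"
proof -
  obtain A B S where M: "K2_model E {..<4::nat} A B S" using assms unfolding has_K2_def by blast
  note m = K2_model_lessThanD[OF M]
  have A: "\<not> A \<subseteq> H0" using hub_not_inside[OF M] .
  have B: "\<not> B \<subseteq> H0" using hub_not_inside[OF K2_model_swap[OF M]] .
  show ?thesis
  proof (cases "\<exists>k<4. S k \<subseteq> H0")
    case True
    then obtain k where k: "k < 4" "S k \<subseteq> H0" by blast
    have meet: "x \<in> X \<or> y \<in> X" if X: "conn E X" "\<not> X \<subseteq> H0" "adjs E X (S k)" for X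
    proof -
      obtain a s where as: "a \<in> X" "s \<in> S k" "{a, s} \<in> E" using X(3) unfolding adjs_def by blast
      then have "a \<in> U" using inner_edge[of s a] k(2) by (auto simp: insert_commute)
      then show ?thesis using touches[OF X(1) _ X(2)] as(1) by blast
    qed
    consider "x \<in> A" "y \<in> B" | "x \<in> B" "y \<in> A"
      using meet[OF m(1) A m(7)[OF k(1)]] meet[OF m(2) B m(8)[OF k(1)]] m(3) by blast
    then show ?thesis
    proof cases
      case 1
      then show ?thesis using spoke_inside[OF M k] by blast
    next
      case 2
      then show ?thesis using spoke_inside[OF K2_model_swap[OF M] k] by blast
    qed
  next
    case False
    have sub: "A \<subseteq> V1 \<union> U" "B \<subseteq> V1 \<union> U" "\<And>i. i < 4 \<Longrightarrow> S i \<subseteq> V1 \<union> U"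
    proof -
      have *: "\<Union>E \<subseteq> V1 \<union> U" "{..<4::nat} \<noteq> {}" using E1 EH by (auto simp: lessThan_empty_iff)
      show "A \<subseteq> V1 \<union> U" "B \<subseteq> V1 \<union> U" "\<And>i. i < 4 \<Longrightarrow> S i \<subseteq> V1 \<union> U"
        using K2_model_subset_edges[OF M *] by auto
    qed
    have ne: "X \<inter> V1 \<noteq> {}" if "X \<subseteq> V1 \<union> U" "\<not> X \<subseteq> H0" for X using that xyV by auto
    have dis: "shrink X \<inter> shrink Y = {}" if "X \<inter> Y = {}" for X Y
      using that w unfolding shrink_def by auto
    have "K2_model E2 {..<4} (shrink A) (shrink B) (\<lambda>i. shrink (S i))"
      unfolding K2_model_def
    proof (intro conjI ballI impI)
      show "conn E2 (shrink A)" by (rule conn_shrink[OF m(1) ne[OF sub(1) A]])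
      show "conn E2 (shrink B)" by (rule conn_shrink[OF m(2) ne[OF sub(2) B]])
      show "shrink A \<inter> shrink B = {}" by (rule dis[OF m(3)])
    next
      fix i assume "i \<in> {..<4::nat}"
      then have i: "i < 4" by simp
      have nS: "\<not> S i \<subseteq> H0" using False i by blast
      show "conn E2 (shrink (S i))" by (rule conn_shrink[OF m(4)[OF i] ne[OF sub(3)[OF i] nS]])
      show "shrink (S i) \<inter> shrink A = {}" "shrink (S i) \<inter> shrink B = {}"
        by (rule dis[OF m(5)[OF i]], rule dis[OF m(6)[OF i]])
      have "A \<inter> S i = {}" "B \<inter> S i = {}" using m(5,6)[OF i] by blast+
      then show "adjs E2 (shrink A) (shrink (S i))" "adjs E2 (shrink B) (shrink (S i))"
        using adjs_shrink[OF m(1) m(4)[OF i] _ A nS m(7)[OF i]]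
          adjs_shrink[OF m(2) m(4)[OF i] _ B nS m(8)[OF i]] by blast+
    next
      fix i j assume "i \<in> {..<4::nat}" "j \<in> {..<4::nat}" "i \<noteq> j"
      then show "shrink (S i) \<inter> shrink (S j) = {}" by (intro dis m(9)) auto
    qed
    then show ?thesis unfolding has_K2_def by blast
  qed
qed

end

section \<open>Paths of a drawn graph\<close>

lemma two_arcs_Jordan:
  fixes c d :: "real \<Rightarrow> complex"
  assumes "arc c" "arc d" "pathstart c = a" "pathstart d = a" "pathfinish c = b" "pathfinish d = b"
    and "path_image c \<inter> path_image d = {a, b}"
  defines "J \<equiv> path_image c \<union> path_image d"
  shows "inside J \<noteq> {}" "open (inside J)" "connected (inside J)" "open (outside J)"
    "connected (outside J)" "inside J \<inter> outside J = {}" "inside J \<union> outside J = - J"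
    "frontier (inside J) = J"
proof -
  have "simple_path (c +++ reversepath d)"
    using assms by (intro simple_path_join_loop) (auto simp: arc_reversepath)
  moreover have "path_image (c +++ reversepath d) = J"
    using assms by (simp add: path_image_join)
  moreover have "pathfinish (c +++ reversepath d) = pathstart (c +++ reversepath d)"
    using assms by simp
  ultimately show "inside J \<noteq> {}" "open (inside J)" "connected (inside J)" "open (outside J)"
    "connected (outside J)" "inside J \<inter> outside J = {}" "inside J \<union> outside J = - J"
    "frontier (inside J) = J"
    using Jordan_inside_outside[of "c +++ reversepath d"] by auto
qed

text \<open>Without its ends the third arc is connected and misses the cycle, so it lies on one side
  of it. Its point \<open>z\<close> in the closure of the outer face cannot be inside.\<close>

lemma third_arc_outside:
  fixes c d e :: "real \<Rightarrow> complex"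
  assumes cd: "arc c" "arc d" "pathstart c = a" "pathstart d = a" "pathfinish c = b" "pathfinish d = b"
    "path_image c \<inter> path_image d = {a, b}"
    and e: "arc e" "pathstart e = a" "pathfinish e = b"
    "path_image c \<inter> path_image e = {a, b}" "path_image d \<inter> path_image e = {a, b}"
    and D: "path_image c \<union> path_image d \<subseteq> D"
    and z: "z \<in> path_image e - {a, b}" "z \<in> closure (outside D)"
  shows "path_image e - {a, b} \<subseteq> outside (path_image c \<union> path_image d)"
proof -
  let ?J = "path_image c \<union> path_image d" and ?K = "path_image e - {a, b}"
  note J = two_arcs_Jordan[OF cd]
  have K: "connected ?K"
    using connected_simple_path_endless[of e] e arc_imp_simple_path by auto
  have "?K \<inter> ?J = {}" using e by blast
  then have cover: "?K \<subseteq> inside ?J \<union> outside ?J" using J(7) by blast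
  have "inside ?J \<inter> closure (outside ?J) = {}"
    using J(2,6) open_Int_closure_eq_empty by blast
  then have "z \<notin> inside ?J" using z(2) closure_mono[OF outside_mono[OF D]] by blast
  then have "outside ?J \<inter> ?K \<noteq> {}" using z(1) cover by blast
  then have "inside ?J \<inter> ?K = {}"
    using connectedD[OF K J(2,4)] J(6) cover by blast
  then show ?thesis using cover by blast
qed

text \<open>Each arc runs outside the cycle of the other two, so the inside of the first cycle is
  not nested in that of another one. A point inside the first cycle is therefore outside both
  others, although it is enclosed by arcs belonging to these.\<close>

lemma theta_outer_points:
  fixes c1 c2 c3 :: "real \<Rightarrow> complex"
  assumes arcs: "arc c1" "arc c2" "arc c3"
    and st: "pathstart c1 = a" "pathstart c2 = a" "pathstart c3 = a"
    and fin: "pathfinish c1 = b" "pathfinish c2 = b" "pathfinish c3 = b"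
    and int: "path_image c1 \<inter> path_image c2 = {a, b}" "path_image c1 \<inter> path_image c3 = {a, b}"
      "path_image c2 \<inter> path_image c3 = {a, b}"
    and D: "path_image c1 \<subseteq> D" "path_image c2 \<subseteq> D" "path_image c3 \<subseteq> D"
    and z: "z1 \<in> path_image c1 - {a, b}" "z2 \<in> path_image c2 - {a, b}" "z3 \<in> path_image c3 - {a, b}"
    and zD: "z1 \<in> closure (outside D)" "z2 \<in> closure (outside D)" "z3 \<in> closure (outside D)"
  shows False
proof -
  let ?J12 = "path_image c1 \<union> path_image c2" and ?J13 = "path_image c1 \<union> path_image c3"
    and ?J23 = "path_image c2 \<union> path_image c3"
  note J12 = two_arcs_Jordan[OF arcs(1,2) st(1,2) fin(1,2) int(1)]
  note J13 = two_arcs_Jordan[OF arcs(1,3) st(1,3) fin(1,3) int(2)]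
  note J23 = two_arcs_Jordan[OF arcs(2,3) st(2,3) fin(2,3) int(3)]
  have int': "path_image c2 \<inter> path_image c1 = {a, b}" "path_image c3 \<inter> path_image c1 = {a, b}"
    "path_image c3 \<inter> path_image c2 = {a, b}" using int by auto
  have o3: "path_image c3 - {a, b} \<subseteq> outside ?J12"
    using third_arc_outside[OF arcs(1,2) st(1,2) fin(1,2) int(1) arcs(3) st(3) fin(3) int(2,3) _ z(3) zD(3)] D by blast
  have o2: "path_image c2 - {a, b} \<subseteq> outside ?J13"
    using third_arc_outside[OF arcs(1,3) st(1,3) fin(1,3) int(2) arcs(2) st(2) fin(2) int(1) int'(3) _ z(2) zD(2)] D by blast
  have o1: "path_image c1 - {a, b} \<subseteq> outside ?J23"
    using third_arc_outside[OF arcs(2,3) st(2,3) fin(2,3) int(3) arcs(1) st(1) fin(1) int'(1,2) _ z(1) zD(1)] D by blast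
  have ab: "{a, b} \<subseteq> ?J12" using int(1) by blast
  have I3: "inside ?J12 \<inter> path_image c3 = {}" using o3 J12(6,7) ab by blast
  have I12: "inside ?J12 \<inter> ?J12 = {}" using J12(7) by blast
  \<comment> \<open>The inside of the first cycle is connected and misses \<open>K\<close>. If it
    met the inside of \<open>K\<close>, it would be contained in it, and its closure, which includes
    \<open>z\<close>, could not reach the outside of \<open>K\<close>.\<close>
  have nested: False
    if K: "open (inside K)" "open (outside K)" "inside K \<inter> outside K = {}" "inside K \<union> outside K = - K"
        "frontier (inside K) = K" and m: "inside ?J12 \<inter> K = {}" "w \<in> inside ?J12" "w \<in> inside K"
      and z: "z \<in> ?J12" "z \<in> outside K" for K w z
  proof -
    have cov: "inside ?J12 \<subseteq> inside K \<union> outside K" using K(4) m(1) by blast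
    have "inside K \<inter> outside K \<inter> inside ?J12 = {}" using K(3) by blast
    then have "outside K \<inter> inside ?J12 = {}"
      using connectedD[OF J12(3) K(1,2)] cov m by blast
    then have "inside ?J12 \<subseteq> inside K" using cov by blast
    then have "closure (inside ?J12) \<subseteq> inside K \<union> K"
      using closure_mono closure_Un_frontier K(5) by metis
    moreover have "z \<in> closure (inside ?J12)" using J12(8) z(1) closure_Un_frontier by blast
    ultimately show False using z(2) K(3,4) by blast
  qed
  txt \<open>If \<open>w\<close> were outside both other cycles, which share only \<open>c3\<close>, Janiszewski's theorem would
    join it to infinity in the complement of all three arcs.\<close>
  obtain w where w: "w \<in> inside ?J12" using J12(1) by blast
  have "w \<notin> inside ?J13"
    using nested[OF J13(2,4,6,7,8) _ w, of z2] I3 I12 z(2) o2 by blast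
  moreover have "w \<notin> inside ?J23"
    using nested[OF J23(2,4,6,7,8) _ w, of z1] I3 I12 z(1) o1 by blast
  moreover have "w \<notin> ?J13" "w \<notin> ?J23" using w I3 I12 by blast+
  ultimately have w13: "w \<in> outside ?J13" and w23: "w \<in> outside ?J23" using J13(7) J23(7) by blast+
  let ?T = "?J13 \<union> ?J23"
  have cpt: "compact ?J13" "compact ?J23" using arcs arc_imp_path compact_path_image by blast+
  then have "outside ?T \<noteq> {}" using outside_bounded_nonempty compact_imp_bounded bounded_Un by metis
  then obtain v where v: "v \<in> outside ?T" by blast
  then have v': "v \<in> outside ?J13" "v \<in> outside ?J23" "v \<in> outside ?J12"
    using outside_mono[of ?J13 ?T] outside_mono[of ?J23 ?T] outside_mono[of ?J12 ?T] by blast+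
  have "connected_component (- ?T) w v"
  proof (rule Janiszewski)
    have "?J13 \<inter> ?J23 = path_image c3" using int by blast
    then show "connected (?J13 \<inter> ?J23)" using arcs(3) by (simp add: arc_imp_path connected_path_image)
    show "connected_component (- ?J13) w v" unfolding connected_component_def
      using J13(5,7) w13 v' by (intro exI[of _ "outside ?J13"]) blast
    show "connected_component (- ?J23) w v" unfolding connected_component_def
      using J23(5,7) w23 v' by (intro exI[of _ "outside ?J23"]) blast
  qed (use cpt compact_imp_closed in auto)
  then obtain C where C: "connected C" "C \<subseteq> - ?T" "w \<in> C" "v \<in> C" unfolding connected_component_def by blast
  have "C \<subseteq> inside ?J12 \<union> outside ?J12" using C(2) J12(7) by blast
  moreover have "inside ?J12 \<inter> outside ?J12 \<inter> C = {}" using J12(6) by blast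
  ultimately show False using connectedD[OF C(1) J12(2,4)] w v'(3) C(3,4) by blast
qed

section \<open>Arcs along walks in a drawing\<close>

definition walk_edges :: "'a list \<Rightarrow> 'a set set" where
  "walk_edges us = (\<lambda>i. {us ! i, us ! Suc i}) ` {i. Suc i < length us}"

lemma walk_edges_simps [simp]:
  "walk_edges [] = {}" "walk_edges [a] = {}"
  "walk_edges (a # b # us) = insert {a, b} (walk_edges (b # us))"
proof -
  have "{i. Suc i < length (a # b # us)} = insert 0 (Suc ` {i. Suc i < length (b # us)})"
    by (auto simp: image_iff) (metis Suc_less_eq gr0_conv_Suc not_gr0)
  then show "walk_edges (a # b # us) = insert {a, b} (walk_edges (b # us))"
    unfolding walk_edges_def by (simp add: image_image)
qed (auto simp: walk_edges_def)

lemma walk_edges_subset: "walk E us \<Longrightarrow> walk_edges us \<subseteq> E"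
  unfolding walk_edges_def by (auto simp: successively_conv_nth)

lemma walk_edges_verts: "e \<in> walk_edges us \<Longrightarrow> e \<subseteq> set us"
  unfolding walk_edges_def by auto

lemma ends_notin_walk_edges:
  assumes "distinct us" "3 \<le> length us"
  shows "{hd us, last us} \<notin> walk_edges us"
proof
  assume "{hd us, last us} \<in> walk_edges us"
  then obtain i where i: "Suc i < length us" "{us ! 0, us ! (length us - 1)} = {us ! i, us ! Suc i}"
    unfolding walk_edges_def using assms(2) hd_conv_nth[of us] last_conv_nth[of us] by fastforce
  then have "us ! 0 = us ! i \<and> us ! (length us - 1) = us ! Suc i \<or> us ! 0 = us ! Suc i"
    by (auto simp: doubleton_eq_iff)
  moreover have eq: "us ! m = us ! n \<longleftrightarrow> m = n" if "m < length us" "n < length us" for m n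
    using nth_eq_iff_index_eq[OF assms(1) that] .
  ultimately show False using eq[of 0 i] eq[of "length us - 1" "Suc i"] eq[of 0 "Suc i"] i(1) assms(2) by linarith
qed

definition walk_image :: "('a set \<Rightarrow> real \<Rightarrow> complex) \<Rightarrow> 'a list \<Rightarrow> complex set" where
  "walk_image g us = (\<Union>e\<in>walk_edges us. path_image (g e))"

lemma drawing_Int:
  "drawing G p g \<Longrightarrow> e \<in> edges G \<Longrightarrow> f \<in> edges G \<Longrightarrow> e \<noteq> f \<Longrightarrow>
    path_image (g e) \<inter> path_image (g f) = p ` (e \<inter> f)"
  unfolding drawing_def by simp

lemma drawing_edge:
  assumes "drawing G p g" "e \<in> edges G"
  shows "arc (g e)" "{pathstart (g e), pathfinish (g e)} = p ` e" "path_image (g e) \<inter> p ` verts G = p ` e"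
  using assms unfolding drawing_def by auto

lemma drawing_walk_arc:
  assumes dr: "drawing G p g" and V: "\<Union>(edges G) \<subseteq> verts G"
    and us: "walk (edges G) us" "distinct us" "2 \<le> length us"
  shows "\<exists>c. arc c \<and> pathstart c = p (hd us) \<and> pathfinish c = p (last us) \<and> path_image c = walk_image g us"
  using us
proof (induction us rule: induct_list012)
  case (3 a b us)
  have e: "{a, b} \<in> edges G" using 3 by simp
  have ab: "a \<noteq> b" using 3 by simp
  have inj: "inj_on p (verts G)" using dr unfolding drawing_def by blast
  have abV: "a \<in> verts G" "b \<in> verts G" using e V by auto
  have g: "arc (g {a, b})" "{pathstart (g {a, b}), pathfinish (g {a, b})} = {p a, p b}"
    using dr e unfolding drawing_def by auto
  \<comment> \<open>The arc of an edge is parametrized in an arbitrary direction and has to be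
    reversed where the walk runs the other way.\<close>
  obtain c where c: "arc c" "pathstart c = p a" "pathfinish c = p b" "path_image c = path_image (g {a, b})"
  proof (cases "pathstart (g {a, b}) = p a")
    case True
    then have "pathfinish (g {a, b}) = p b"
      using g(2) ab abV inj by (auto simp: doubleton_eq_iff inj_on_eq_iff)
    then show ?thesis using that[of "g {a, b}"] True g by blast
  next
    case False
    then have "pathfinish (g {a, b}) = p a" "pathstart (g {a, b}) = p b"
      using g(2) by (auto simp: doubleton_eq_iff)
    then show ?thesis using that[of "reversepath (g {a, b})"] g(1) by (simp add: arc_reversepath)
  qed
  show ?case
  proof (cases "us = []")
    case True
    then show ?thesis using c by (intro exI[of _ c]) (simp add: walk_image_def)
  next
    case False
    then have "2 \<le> length (b # us)" by (cases us) auto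
    then obtain d where d: "arc d" "pathstart d = p b" "pathfinish d = p (last (b # us))"
        "path_image d = walk_image g (b # us)"
      using "3.IH"(2) "3.prems" by auto
    have disj: "path_image c \<inter> path_image d \<subseteq> {p b}"
    proof
      fix z assume "z \<in> path_image c \<inter> path_image d"
      then obtain f where f: "f \<in> walk_edges (b # us)" "z \<in> path_image (g f)" "z \<in> path_image (g {a, b})"
        unfolding d(4) c(4) walk_image_def by blast
      have fs: "f \<subseteq> set (b # us)" using walk_edges_verts f(1) by metis
      then have "a \<notin> f" using "3.prems" by auto
      then have ne: "f \<noteq> {a, b}" by auto
      have fE: "f \<in> edges G" using walk_edges_subset[of "edges G" "b # us"] f(1) "3.prems" by auto
      have "path_image (g {a, b}) \<inter> path_image (g f) = p ` ({a, b} \<inter> f)"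
        using drawing_Int[OF dr e fE] ne by blast
      then have "z \<in> p ` ({a, b} \<inter> f)" using f by blast
      then show "z \<in> {p b}" using \<open>a \<notin> f\<close> by auto
    qed
    have "arc (c +++ d)" using c d disj by (intro arc_join) auto
    moreover have "path_image (c +++ d) = walk_image g (a # b # us)"
      using c d by (simp add: path_image_join walk_image_def)
    ultimately show ?thesis using c d False by (intro exI[of _ "c +++ d"]) auto
  qed
qed auto

lemma walk_image_Int:
  assumes dr: "drawing G p g"
    and us: "walk (edges G) us" "2 \<le> length us" and vs: "walk (edges G) vs" "2 \<le> length vs"
    and ends: "hd us = a" "hd vs = a" "last us = b" "last vs = b"
    and int: "set us \<inter> set vs = {a, b}" and de: "walk_edges us \<inter> walk_edges vs = {}"
  shows "walk_image g us \<inter> walk_image g vs = {p a, p b}"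
proof
  show "walk_image g us \<inter> walk_image g vs \<subseteq> {p a, p b}"
  proof
    fix z assume "z \<in> walk_image g us \<inter> walk_image g vs"
    then obtain e f where ef: "e \<in> walk_edges us" "f \<in> walk_edges vs" "z \<in> path_image (g e)" "z \<in> path_image (g f)"
      unfolding walk_image_def by auto
    then have "e \<in> edges G" "f \<in> edges G" "e \<noteq> f"
      using walk_edges_subset[OF us(1)] walk_edges_subset[OF vs(1)] de by auto
    then have "path_image (g e) \<inter> path_image (g f) = p ` (e \<inter> f)"
      using drawing_Int[OF dr] by blast
    moreover have "e \<inter> f \<subseteq> {a, b}" using walk_edges_verts[OF ef(1)] walk_edges_verts[OF ef(2)] int by blast
    ultimately show "z \<in> {p a, p b}" using ef by blast
  qed
  have *: "{p (hd ws), p (last ws)} \<subseteq> walk_image g ws" if ws: "walk (edges G) ws" "2 \<le> length ws" for ws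
  proof -
    have im: "p ` e \<subseteq> walk_image g ws" if "e \<in> walk_edges ws" for e
    proof -
      have "e \<in> edges G" using walk_edges_subset[OF ws(1)] that by blast
      then have "p ` e \<subseteq> path_image (g e)" using drawing_edge(3)[OF dr] by blast
      then show ?thesis using that unfolding walk_image_def by blast
    qed
    have "{ws ! 0, ws ! Suc 0} \<in> walk_edges ws" "{ws ! (length ws - 2), ws ! Suc (length ws - 2)} \<in> walk_edges ws"
      using ws(2) unfolding walk_edges_def by auto
    moreover have "Suc (length ws - 2) = length ws - 1" "ws \<noteq> []" using ws(2) by auto
    ultimately show ?thesis using im by (fastforce simp: hd_conv_nth last_conv_nth)
  qed
  show "{p a, p b} \<subseteq> walk_image g us \<inter> walk_image g vs"
    using *[OF us] *[OF vs] ends by auto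
qed

lemma theta_walks:
  fixes us :: "nat \<Rightarrow> 'a list"
  assumes dr: "drawing G p g" and V: "\<Union>(edges G) \<subseteq> verts G"
    and w: "\<And>i. i < 3 \<Longrightarrow> walk (edges G) (us i) \<and> distinct (us i) \<and> 2 \<le> length (us i) \<and>
      hd (us i) = a \<and> last (us i) = b"
    and int: "\<And>i j. i < j \<Longrightarrow> j < 3 \<Longrightarrow> set (us i) \<inter> set (us j) = {a, b} \<and> walk_edges (us i) \<inter> walk_edges (us j) = {}"
    and z: "\<And>i. i < 3 \<Longrightarrow> z i \<in> walk_image g (us i) - {p a, p b} \<and> z i \<in> closure (outside (drawing_points G p g))"
  shows False
proof -
  have "\<exists>c. arc c \<and> pathstart c = p a \<and> pathfinish c = p b \<and> path_image c = walk_image g (us i)" if "i < 3" for i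
    using drawing_walk_arc[OF dr V, of "us i"] w[OF that] by auto
  then obtain c where c: "\<And>i. i < (3::nat) \<Longrightarrow> arc (c i) \<and> pathstart (c i) = p a \<and> pathfinish (c i) = p b \<and>
      path_image (c i) = walk_image g (us i)" by metis
  have i: "path_image (c i) \<inter> path_image (c j) = {p a, p b}" if "i < j" "j < 3" for i j
    using walk_image_Int[OF dr, of "us i" "us j" a b] w[of i] w[of j] int[OF that] c[of i] c[of j] that by auto
  have D: "path_image (c i) \<subseteq> drawing_points G p g" if "i < 3" for i
    using c[OF that] walk_edges_subset[of "edges G" "us i"] w[OF that]
    unfolding drawing_points_def walk_image_def by auto
  show False
    using theta_outer_points[of "c 0" "c 1" "c 2" "p a" "p b" "drawing_points G p g" "z 0" "z 1" "z 2"]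
      c[of 0] c[of 1] c[of 2] i[of 0 1] i[of 0 2] i[of 1 2] D[of 0] D[of 1] D[of 2] z[of 0] z[of 1] z[of 2]
    by simp
qed

text \<open>A common edge has both ends in \<open>{a, b}\<close>, so it joins the two ends of
  \<open>us\<close>, which no path with at least three vertices contains. The other walk may consist
  of just this edge.\<close>

lemma walk_edges_disjoint:
  assumes us: "distinct us" "3 \<le> length us" "hd us = a" "last us = b"
    and int: "set us \<inter> set vs = {a, b}"
  shows "walk_edges us \<inter> walk_edges vs = {}"
proof (rule ccontr)
  assume "walk_edges us \<inter> walk_edges vs \<noteq> {}"
  then obtain e where e: "e \<in> walk_edges us" "e \<in> walk_edges vs" by blast
  then have sub: "e \<subseteq> {a, b}" using walk_edges_verts int by blast
  obtain i where i: "Suc i < length us" "e = {us ! i, us ! Suc i}"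
    using e(1) unfolding walk_edges_def by auto
  have "us ! i \<noteq> us ! Suc i" using us(1) i(1) by (simp add: nth_eq_iff_index_eq)
  then have "e = {a, b}" using sub i(2) by auto
  then show False using ends_notin_walk_edges[OF us(1,2)] us(3,4) e(1) by simp
qed

lemma vertex_in_walk_image:
  assumes dr: "drawing G p g" and us: "walk (edges G) us" "2 \<le> length us" and v: "v \<in> set us"
  shows "p v \<in> walk_image g us"
proof -
  obtain i where i: "i < length us" "v = us ! i" using v by (metis in_set_conv_nth)
  have "\<exists>e\<in>walk_edges us. v \<in> e"
  proof (cases "Suc i < length us")
    case True
    then show ?thesis using i unfolding walk_edges_def by auto
  next
    case False
    then have "i = Suc (i - 1)" "Suc (i - 1) < length us" using i us(2) by auto
    then have "{us ! (i - 1), us ! i} \<in> walk_edges us" unfolding walk_edges_def by (intro image_eqI[of _ _ "i - 1"]) auto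
    then show ?thesis using i by blast
  qed
  then obtain e where e: "e \<in> walk_edges us" "v \<in> e" by blast
  then have "p v \<in> path_image (g e)"
    using drawing_edge(3)[OF dr, of e] walk_edges_subset[OF us(1)] by blast
  then show ?thesis using e unfolding walk_image_def by blast
qed

text \<open>Two legs are the parts of a path from \<open>s 0\<close> to \<open>s 1\<close>, split at
  the first vertex where a path from \<open>s 2\<close> to \<open>s 0\<close> meets it; the initial
  part of the latter is the third leg. A leg may consist of the centre alone.\<close>

lemma tripod:
  assumes A: "conn E A" and s: "s 0 \<in> A" "s 1 \<in> A" "s 2 \<in> A"
  shows "\<exists>a L. (\<forall>i<3. L i \<noteq> [] \<and> hd (L i) = a \<and> last (L i) = s i \<and> walk E (L i) \<and>
      distinct (L i) \<and> set (L i) \<subseteq> A) \<and>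
    (\<forall>i<3::nat. \<forall>j<3. i \<noteq> j \<longrightarrow> set (L i) \<inter> set (L j) = {a})"
proof -
  obtain P where P: "P \<noteq> []" "distinct P" "walk E P" "hd P = s 0" "last P = s 1" "set P \<subseteq> A"
    using conn_path[OF A s(1,2)] .
  obtain Q where Q: "Q \<noteq> []" "distinct Q" "walk E Q" "hd Q = s 2" "last Q = s 0" "set Q \<subseteq> A"
    using conn_path[OF A s(3,1)] .
  have "\<exists>q\<in>set Q. q \<in> set P" using P Q by (metis hd_in_set last_in_set)
  then obtain ys q zs where q: "Q = ys @ q # zs" "q \<in> set P" "\<forall>z\<in>set ys. z \<notin> set P"
    using split_list_first_prop[of Q "\<lambda>z. z \<in> set P"] by blast
  obtain ps rs where pr: "P = ps @ q # rs" using q(2) by (meson split_list)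
  define L where "L i = (if i = 0 then rev (ps @ [q]) else if i = 1 then q # rs else rev (ys @ [q]))" for i :: nat
  have w: "walk E (ps @ [q])" "walk E (q # rs)" "walk E (ys @ [q])"
    using P(3) Q(3) unfolding pr q(1) by (auto simp: successively_append_iff)
  show ?thesis
  proof (rule exI[of _ q], rule exI[of _ L], intro conjI[of "\<forall>i<3. _ i"] allI impI)
    fix i :: nat assume "i < 3"
    then consider "i = 0" | "i = 1" | "i = 2" by linarith
    then show "L i \<noteq> [] \<and> hd (L i) = q \<and> last (L i) = s i \<and> walk E (L i) \<and> distinct (L i) \<and> set (L i) \<subseteq> A"
    proof cases
      case 1
      have "last (rev (ps @ [q])) = s 0" using P(4) pr by (cases ps) simp_all
      moreover have "distinct (ps @ [q])" "set (ps @ [q]) \<subseteq> A" using P(2,6) pr by auto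
      ultimately show ?thesis using 1 w(1) unfolding L_def
        by (simp add: walk_rev[of E "ps @ [q]", simplified])
    next
      case 2
      then show ?thesis using w(2) P(2,5,6) pr unfolding L_def by auto
    next
      case 3
      have "last (rev (ys @ [q])) = s 2" using Q(4) q(1) by (cases ys) simp_all
      moreover have "distinct (ys @ [q])" "set (ys @ [q]) \<subseteq> A" using Q(2,6) q(1) by auto
      ultimately show ?thesis using 3 w(3) unfolding L_def
        by (simp add: walk_rev[of E "ys @ [q]", simplified])
    qed
  next
    fix i j :: nat assume "i < 3" "j < 3" "i \<noteq> j"
    moreover have "set (L 0) \<inter> set (L 1) = {q}" "set (L 0) \<inter> set (L 2) = {q}" "set (L 1) \<inter> set (L 2) = {q}"
      using P(2) q(3) unfolding L_def pr by auto
    moreover have "i = 0 \<or> i = 1 \<or> i = 2" "j = 0 \<or> j = 1 \<or> j = 2" using \<open>i < 3\<close> \<open>j < 3\<close> by auto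
    ultimately show "set (L i) \<inter> set (L j) = {q}" by (auto simp: Int_commute)
  qed
qed

text \<open>A tripod in each hub, joined through the three spokes, gives three paths that share only
  their ends. Each has a spoke vertex as an inner vertex, and this vertex is on the outer
  face.\<close>

lemma outerplanar_no_K23:
  assumes op: "outerplanar G" and sg: "simple_graph G"
  shows "\<not> has_K2 (edges G) 3"
proof
  let ?E = "edges G"
  assume "has_K2 ?E 3"
  then obtain A B S where M: "K2_model ?E {..<3::nat} A B S" unfolding has_K2_def by blast
  note m = K2_model_lessThanD[OF M]
  have V: "\<Union>?E \<subseteq> verts G" using sg unfolding simple_graph_def by auto
  obtain p g where dr: "drawing G p g" and fr: "p ` verts G \<subseteq> frontier (outside (drawing_points G p g))"
    using op unfolding outerplanar_def by blast
  have inj: "inj_on p (verts G)" using dr unfolding drawing_def by blast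
  have "\<exists>a s. a \<in> A \<and> s \<in> S i \<and> {a, s} \<in> ?E" if "i < 3" for i
    using m(7)[OF that] unfolding adjs_def by blast
  then obtain a s where as: "\<And>i. i < 3 \<Longrightarrow> a i \<in> A \<and> s i \<in> S i \<and> {a i, s i} \<in> ?E" by metis
  have "\<exists>b t. b \<in> B \<and> t \<in> S i \<and> {b, t} \<in> ?E" if "i < 3" for i
    using m(8)[OF that] unfolding adjs_def by blast
  then obtain b t where bt: "\<And>i. i < 3 \<Longrightarrow> b i \<in> B \<and> t i \<in> S i \<and> {b i, t i} \<in> ?E" by metis
  have aA: "a 0 \<in> A" "a 1 \<in> A" "a 2 \<in> A" and bB: "b 0 \<in> B" "b 1 \<in> B" "b 2 \<in> B"
    using as bt by auto
  obtain c L where L': "\<forall>i<3. L i \<noteq> [] \<and> hd (L i) = c \<and> last (L i) = a i \<and> walk ?E (L i) \<and>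
      distinct (L i) \<and> set (L i) \<subseteq> A"
    and LL': "\<forall>i<3::nat. \<forall>j<3. i \<noteq> j \<longrightarrow> set (L i) \<inter> set (L j) = {c}"
    using tripod[OF m(1) aA] by (elim exE conjE) (rule that, assumption+)
  obtain d N where N': "\<forall>i<3. N i \<noteq> [] \<and> hd (N i) = d \<and> last (N i) = b i \<and> walk ?E (N i) \<and>
      distinct (N i) \<and> set (N i) \<subseteq> B"
    and NN': "\<forall>i<3::nat. \<forall>j<3. i \<noteq> j \<longrightarrow> set (N i) \<inter> set (N j) = {d}"
    using tripod[OF m(2) bB] by (elim exE conjE) (rule that, assumption+)
  note L = L'[rule_format] and LL = LL'[rule_format] and N = N'[rule_format] and NN = NN'[rule_format]
  have "\<exists>us. us \<noteq> [] \<and> distinct us \<and> walk ?E us \<and> hd us = s i \<and> last us = t i \<and> set us \<subseteq> S i" if i: "i < 3" for i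
  proof -
    have st: "s i \<in> S i" "t i \<in> S i" using as[OF i] bt[OF i] by blast+
    show ?thesis by (rule conn_path[OF m(4)[OF i] st]) blast
  qed
  then obtain M where M: "\<And>i. i < (3::nat) \<Longrightarrow> M i \<noteq> [] \<and> distinct (M i) \<and> walk ?E (M i) \<and> hd (M i) = s i \<and>
      last (M i) = t i \<and> set (M i) \<subseteq> S i" by metis
  define us where "us i = L i @ M i @ rev (N i)" for i
  have len: "3 \<le> length (us i)" if "i < 3" for i
  proof -
    have "0 < length (L i)" "0 < length (M i)" "0 < length (N i)" using L M N that by auto
    then show ?thesis unfolding us_def length_append length_rev by linarith
  qed
  have W: "walk ?E (us i) \<and> distinct (us i) \<and> 2 \<le> length (us i) \<and> hd (us i) = c \<and> last (us i) = d" if "i < 3" for i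
  proof -
    have "distinct (us i)" using L[OF that] M[OF that] N[OF that] m(3) m(5,6)[OF that]
      unfolding us_def by auto
    moreover have "walk ?E (us i)" unfolding us_def
      using L[OF that] M[OF that] N[OF that] as[OF that] bt[OF that]
      by (simp add: successively_append_iff walk_rev hd_rev insert_commute del: successively_rev)
    ultimately show ?thesis using len[OF that] L[OF that] N[OF that] unfolding us_def by (simp add: last_rev)
  qed
  have I: "set (us i) \<inter> set (us j) = {c, d}" if ij: "i < j" "j < 3" for i j
  proof -
    have i3: "i < 3" using that by simp
    have "set (L i) \<inter> set (L j) = {c}" "set (N i) \<inter> set (N j) = {d}" "set (M i) \<inter> set (M j) = {}"
      using LL[of i j] NN[of i j] M[OF i3] M[OF ij(2)] m(9)[of i j] that by auto
    moreover have "set (L i) \<inter> set (M j) = {}" "set (L i) \<inter> set (N j) = {}" "set (M i) \<inter> set (L j) = {}"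
      "set (M i) \<inter> set (N j) = {}" "set (N i) \<inter> set (L j) = {}" "set (N i) \<inter> set (M j) = {}"
      using L[OF i3] L[OF ij(2)] M[OF i3] M[OF ij(2)] N[OF i3] N[OF ij(2)] m(3) m(5,6)[OF i3] m(5,6)[OF ij(2)]
      by blast+
    ultimately show ?thesis unfolding us_def by (simp add: Int_Un_distrib Int_Un_distrib2 insert_commute)
  qed
  have cd: "c \<in> A" "d \<in> B" using L[of 0] N[of 0] by (auto intro: subsetD hd_in_set)
  have cdV: "c \<in> verts G" "d \<in> verts G"
    using cd K2_model_subset_edges(1,2)[OF \<open>K2_model ?E {..<3} A B S\<close> V] by (auto simp: lessThan_empty_iff)
  show False
  proof (rule theta_walks[OF dr V, of us c d "\<lambda>i. p (s i)"])
    show "set (us i) \<inter> set (us j) = {c, d} \<and> walk_edges (us i) \<inter> walk_edges (us j) = {}" if ij: "i < j" "j < 3" for i j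
      using walk_edges_disjoint[of "us i" c d "us j"] I[OF ij] W[of i] len[of i] that by auto
    fix i :: nat assume i: "i < 3"
    have sV: "s i \<in> verts G" using as[OF i] V by auto
    have "s i \<in> set (M i)" using M[OF i] hd_in_set[of "M i"] by auto
    then have "p (s i) \<in> walk_image g (us i)"
      using W[OF i] by (intro vertex_in_walk_image[OF dr]) (auto simp: us_def)
    moreover have "s i \<noteq> c" "s i \<noteq> d" using as[OF i] cd m(5,6)[OF i] by auto
    then have "p (s i) \<noteq> p c" "p (s i) \<noteq> p d" using inj_on_eq_iff[OF inj] sV cdV by blast+
    moreover have "p (s i) \<in> closure (outside (drawing_points G p g))"
      using fr sV unfolding frontier_def by blast
    ultimately show "p (s i) \<in> walk_image g (us i) - {p c, p d} \<and> p (s i) \<in> closure (outside (drawing_points G p g))"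
      by blast
  qed (use W in blast)
qed

lemma sphere_subset_closure_outside:
  fixes D :: "complex set"
  assumes "D \<subseteq> cball 0 1"
  shows "sphere 0 1 \<subseteq> closure (outside D)"
proof -
  have "- cball 0 1 \<subseteq> outside D"
    using outside_mono[OF assms] outside_convex[OF convex_cball, of "0::complex" 1] by simp
  then have "closure (- cball 0 1) \<subseteq> closure (outside D)" by (rule closure_mono)
  then show ?thesis by (auto simp: closure_complement dist_norm)
qed

lemma walk_segment:
  assumes "walk E vs" "b \<le> length vs"
  shows "walk E (map ((!) vs) [a..<b])"
  using assms by (auto simp: successively_conv_nth)

text \<open>Two crossing edges yield three paths between the positions \<open>k\<close> and
  \<open>j\<close>: \<open>u1\<close> follows the hamilton path, \<open>u2\<close> goes back to
  \<open>i\<close> and takes the first edge, \<open>u3\<close> takes the second edge to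
  \<open>l\<close> and goes back to \<open>j\<close>. Each has a point on the circle other than its
  ends.\<close>

lemma xy_outerplanar_imp_outer_path:
  assumes "xy_outerplanar x y H"
  obtains vs where "outer_path (edges H) (verts H) x y vs"
proof -
  let ?E = "edges H"
  obtain p g vs where dr: "drawing H p g" and cb: "drawing_points H p g \<subseteq> cball 0 1"
    and ham: "hamilton_path H x y vs" and ps: "p ` set vs \<subseteq> sphere 0 1"
    and es: "\<And>i. Suc i < length vs \<Longrightarrow> path_image (g {vs ! i, vs ! Suc i}) \<subseteq> sphere 0 1"
    using assms unfolding xy_outerplanar_def by blast
  have V: "\<Union>?E \<subseteq> verts H" using assms unfolding xy_outerplanar_def simple_graph_def by auto
  have vs: "vs \<noteq> []" "hd vs = x" "last vs = y" "distinct vs" "set vs = verts H" "walk ?E vs"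
    using ham unfolding hamilton_path_def by (auto simp: successively_conv_nth)
  have inj: "inj_on p (verts H)" using dr unfolding drawing_def by blast
  have out: "sphere 0 1 \<subseteq> closure (outside (drawing_points H p g))"
    by (rule sphere_subset_closure_outside[OF cb])
  have "noncrossing ?E vs" unfolding noncrossing_def
  proof (intro allI impI notI)
    fix i k j l
    assume o: "i < k \<and> k < j \<and> j < l \<and> l < length vs"
      and e: "{vs ! i, vs ! j} \<in> ?E \<and> {vs ! k, vs ! l} \<in> ?E"
    let ?f = "(!) vs"
    have injf: "inj_on ?f {..<length vs}" using vs(4) by (simp add: inj_on_nth)
    have neq: "?f m = ?f n \<longleftrightarrow> m = n" if "m < length vs" "n < length vs" for m n
      using nth_eq_iff_index_eq[OF vs(4) that] .
    define u1 where "u1 = map ?f [k..<Suc j]"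
    define u2 where "u2 = rev (map ?f [i..<Suc k]) @ [?f j]"
    define u3 where "u3 = ?f k # rev (map ?f [j..<Suc l])"
    have s1: "set u1 = ?f ` {k..j}" unfolding u1_def by (simp add: atLeastLessThanSuc_atLeastAtMost del: upt_Suc)
    have s2: "set u2 = ?f ` ({i..k} \<union> {j})" unfolding u2_def by (simp add: atLeastLessThanSuc_atLeastAtMost del: upt_Suc)
    have s3: "set u3 = ?f ` ({k} \<union> {j..l})" unfolding u3_def by (simp add: atLeastLessThanSuc_atLeastAtMost del: upt_Suc)
    have int: "?f ` X \<inter> ?f ` Y = ?f ` (X \<inter> Y)" if "X \<subseteq> {..<length vs}" "Y \<subseteq> {..<length vs}" for X Y
      using inj_on_image_Int[OF injf that] by simp
    have i12: "set u1 \<inter> set u2 = {?f k, ?f j}"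
    proof -
      have "{k..j} \<inter> ({i..k} \<union> {j}) = {k, j}" using o by auto
      moreover have "?f ` ({k..j}) \<inter> ?f ` ({i..k} \<union> {j}) = ?f ` (({k..j}) \<inter> ({i..k} \<union> {j}))" using o by (intro int) auto
      ultimately show ?thesis unfolding s1 s2 by simp
    qed
    have i13: "set u1 \<inter> set u3 = {?f k, ?f j}"
    proof -
      have "{k..j} \<inter> ({k} \<union> {j..l}) = {k, j}" using o by auto
      moreover have "?f ` ({k..j}) \<inter> ?f ` ({k} \<union> {j..l}) = ?f ` (({k..j}) \<inter> ({k} \<union> {j..l}))" using o by (intro int) auto
      ultimately show ?thesis unfolding s1 s3 by simp
    qed
    have i23: "set u2 \<inter> set u3 = {?f k, ?f j}"
    proof -
      have "({i..k} \<union> {j}) \<inter> ({k} \<union> {j..l}) = {k, j}" using o by auto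
      moreover have "?f ` ({i..k} \<union> {j}) \<inter> ?f ` ({k} \<union> {j..l}) = ?f ` (({i..k} \<union> {j}) \<inter> ({k} \<union> {j..l}))" using o by (intro int) auto
      ultimately show ?thesis unfolding s2 s3 by simp
    qed
    have w1: "walk ?E u1" "distinct u1" "2 \<le> length u1" "hd u1 = ?f k" "last u1 = ?f j"
      using o walk_segment[OF vs(6), of "Suc j" k] vs(4) unfolding u1_def
      by (auto simp: distinct_map hd_map last_map intro: inj_on_subset[OF injf] simp del: upt_Suc)
    have dseg: "distinct (map ?f [a..<b])" if "b \<le> length vs" for a b
      using that by (auto simp: distinct_map intro: inj_on_subset[OF injf])
    have w2: "walk ?E u2" "distinct u2" "3 \<le> length u2" "hd u2 = ?f k" "last u2 = ?f j"
    proof -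
      have "walk ?E (rev (map ?f [i..<Suc k]))"
        unfolding walk_rev using o by (intro walk_segment[OF vs(6)]) auto
      moreover have "last (rev (map ?f [i..<Suc k])) = ?f i"
        using o by (simp add: last_rev hd_map del: upt_Suc)
      ultimately show "walk ?E u2" unfolding u2_def successively_append_iff using e by auto
      have "distinct (rev (map ?f [i..<Suc k]))" using dseg[of "Suc k" i] o by (simp del: upt_Suc)
      moreover have "?f j \<notin> set (rev (map ?f [i..<Suc k]))"
      proof
        assume "?f j \<in> set (rev (map ?f [i..<Suc k]))"
        then obtain m where "m < Suc k" "?f j = ?f m" by (auto simp del: upt_Suc)
        then show False using neq[of j m] o by simp
      qed
      ultimately show "distinct u2" unfolding u2_def by simp
      show "3 \<le> length u2" using o unfolding u2_def length_append length_rev length_map length_upt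
        by simp linarith
      show "hd u2 = ?f k" using o unfolding u2_def by simp
      show "last u2 = ?f j" unfolding u2_def by simp
    qed
    have w3: "walk ?E u3" "distinct u3" "3 \<le> length u3" "hd u3 = ?f k" "last u3 = ?f j"
    proof -
      have "walk ?E (rev (map ?f [j..<Suc l]))"
        unfolding walk_rev using o by (intro walk_segment[OF vs(6)]) auto
      moreover have "rev (map ?f [j..<Suc l]) = ?f l # rev (map ?f [j..<l])" using o by simp
      ultimately have "walk ?E (?f l # rev (map ?f [j..<l]))" by (simp only:)
      then have "walk ?E (?f k # ?f l # rev (map ?f [j..<l]))"
        using e unfolding successively.simps by blast
      then show "walk ?E u3" unfolding u3_def using o by simp
      have "distinct (rev (map ?f [j..<Suc l]))" using dseg[of "Suc l" j] o by (simp del: upt_Suc)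
      moreover have "?f k \<notin> set (rev (map ?f [j..<Suc l]))"
      proof
        assume "?f k \<in> set (rev (map ?f [j..<Suc l]))"
        then obtain m where "j \<le> m" "m < Suc l" "?f k = ?f m" by (auto simp del: upt_Suc)
        then show False using neq[of k m] o by simp
      qed
      ultimately show "distinct u3" unfolding u3_def by simp
      show "3 \<le> length u3" using o unfolding u3_def list.size length_rev length_map length_upt
        by linarith
      show "hd u3 = ?f k" unfolding u3_def by simp
      show "last u3 = ?f j" using o unfolding u3_def by (simp add: last_rev hd_map del: upt_Suc)
    qed
    have d12: "walk_edges u1 \<inter> walk_edges u2 = {}"
      using walk_edges_disjoint[OF w2(2-5), of u1] i12 by (simp add: Int_commute)
    have d13: "walk_edges u1 \<inter> walk_edges u3 = {}"
      using walk_edges_disjoint[OF w3(2-5), of u1] i13 by (simp add: Int_commute)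
    have d23: "walk_edges u2 \<inter> walk_edges u3 = {}"
      using walk_edges_disjoint[OF w2(2-5), of u3] i23 by simp
    have mem: "?f m \<in> verts H" if "m < length vs" for m using vs(5) that nth_mem by blast
    let ?e = "{?f k, ?f (Suc k)}"
    have eE: "?e \<in> ?E" using vs(6) o by (auto simp: successively_conv_nth)
    have arcE: "arc (g ?e)" and endE: "{pathstart (g ?e), pathfinish (g ?e)} = p ` ?e"
      and onlyE: "path_image (g ?e) \<inter> p ` verts H = p ` ?e"
      using drawing_edge[OF dr eE] by auto
    \<comment> \<open>\<open>k\<close> and \<open>j\<close> may be consecutive, so \<open>u1\<close>
      need not have an inner vertex. A point in the middle of its first edge serves instead; it is
      on the circle because the edges of the hamilton path are.\<close>
    define z1 where "z1 = g ?e (1/2)"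
    have z1im: "z1 \<in> path_image (g ?e)" unfolding z1_def path_image_def by auto
    have z1ends: "z1 \<noteq> g ?e 0" "z1 \<noteq> g ?e 1"
      using arcE unfolding z1_def arc_def inj_on_def by fastforce+
    have z1p: "z1 \<notin> p ` verts H"
      using onlyE z1im endE z1ends unfolding pathstart_def pathfinish_def by blast
    have "?e \<in> walk_edges u1" unfolding walk_edges_def u1_def
      using o by (intro image_eqI[of _ _ 0]) (auto simp: nth_append simp del: upt_Suc)
    then have z1w: "z1 \<in> walk_image g u1" using z1im unfolding walk_image_def by blast
    have z1o: "z1 \<in> closure (outside (drawing_points H p g))" using es[of k] o z1im out by auto
    have z2w: "p (?f i) \<in> walk_image g u2"
      using w2 s2 o by (intro vertex_in_walk_image[OF dr]) auto
    have z3w: "p (?f l) \<in> walk_image g u3"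
      using w3 s3 o by (intro vertex_in_walk_image[OF dr]) auto
    have pn: "p (?f m) \<noteq> p (?f n)" if "m < length vs" "n < length vs" "m \<noteq> n" for m n
      using inj_on_eq_iff[OF inj] mem neq that by blast
    have po: "p (?f m) \<in> closure (outside (drawing_points H p g))" if "m < length vs" for m
      using ps out that by (auto intro!: subsetD[OF out])
    have ol: "i < length vs" "k < length vs" "j < length vs" "l < length vs" using o by auto
    have zk: "z1 \<noteq> p (?f k)" "z1 \<noteq> p (?f j)" using z1p mem ol by blast+
    define us where "us n = (if n = 0 then u1 else if n = 1 then u2 else u3)" for n :: nat
    define z where "z n = (if n = 0 then z1 else if n = 1 then p (?f i) else p (?f l))" for n :: nat
    show False
    proof (rule theta_walks[OF dr V, of us "?f k" "?f j" z])
      fix n :: nat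
      show "walk ?E (us n) \<and> distinct (us n) \<and> 2 \<le> length (us n) \<and> hd (us n) = ?f k \<and> last (us n) = ?f j"
        using w1 w2 w3 unfolding us_def by auto
      show "z n \<in> walk_image g (us n) - {p (?f k), p (?f j)} \<and> z n \<in> closure (outside (drawing_points H p g))"
        using z1w z2w z3w zk z1o po ol pn o unfolding us_def z_def by auto
    next
      fix m n :: nat assume "m < n" "n < 3"
      then consider "m = 0" "n = 1" | "m = 0" "n = 2" | "m = 1" "n = 2" by linarith
      then show "set (us m) \<inter> set (us n) = {?f k, ?f j} \<and> walk_edges (us m) \<inter> walk_edges (us n) = {}"
        using i12 i13 i23 d12 d13 d23 unfolding us_def by cases auto
    qed
  qed
  then show thesis using that[of vs] vs unfolding outer_path_def by blast
qed

section \<open>Drawing a noncrossing hamilton path\<close>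

lemma cis_inj:
  assumes "0 \<le> s" "s \<le> pi" "0 \<le> t" "t \<le> pi" "cis s = cis t"
  shows "s = t"
proof -
  have "cos s = cos t" using assms(5) by (metis cis.simps(1))
  then show ?thesis using assms cos_inj_pi by blast
qed

lemma arc_cis:
  assumes "0 \<le> a" "a < b" "b \<le> pi"
  shows "arc (cis \<circ> linepath a b)" "path_image (cis \<circ> linepath a b) = cis ` {a..b}"
proof -
  have im: "path_image (linepath a b) = {a..b}" using assms by (simp add: closed_segment_eq_real_ivl)
  show "path_image (cis \<circ> linepath a b) = cis ` {a..b}" by (simp only: path_image_compose im)
  have "arc (linepath a b)" using assms by (intro arc_linepath) auto
  then have l: "inj_on (linepath a b) {0..1}" "path (linepath a b)" unfolding arc_def by auto
  have "path (cis \<circ> linepath a b)"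
    using l(2) by (intro path_continuous_image) (auto intro!: continuous_intros)
  moreover have "inj_on cis (linepath a b ` {0..1})"
    using im assms unfolding path_image_def by (intro inj_onI cis_inj) auto
  ultimately show "arc (cis \<circ> linepath a b)"
    unfolding arc_def using comp_inj_on[OF l(1)] by blast
qed

text \<open>The signed distance of \<open>z\<close> from the line through \<open>cis a\<close> and \<open>cis b\<close>.\<close>

definition chord_side :: "real \<Rightarrow> real \<Rightarrow> complex \<Rightarrow> real" where
  "chord_side a b z = Re (z * cis (- (a + b) / 2)) - cos ((b - a) / 2)"

lemma chord_side_cis: "chord_side a b (cis t) = cos (t - (a + b) / 2) - cos ((b - a) / 2)"
proof -
  have "t + - (a + b) / 2 = t - (a + b) / 2" by argo
  then show ?thesis unfolding chord_side_def cis_mult by (simp only: cis.simps)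
qed

text \<open>On the circle the value depends only on the distance of \<open>t\<close> from the
  midpoint of \<open>a\<close> and \<open>b\<close>, and the cosine decreases on
  \<open>{0..pi}\<close>.\<close>

lemma chord_side_sign:
  assumes "0 \<le> a" "a < b" "b \<le> pi" "0 \<le> t" "t \<le> pi"
  shows "a < t \<Longrightarrow> t < b \<Longrightarrow> 0 < chord_side a b (cis t)"
    and "t < a \<or> b < t \<Longrightarrow> chord_side a b (cis t) < 0"
    and "chord_side a b (cis a) = 0" "chord_side a b (cis b) = 0"
proof -
  have e: "chord_side a b (cis t) = cos \<bar>t - (a + b) / 2\<bar> - cos ((b - a) / 2)"
    unfolding chord_side_cis by simp
  show "0 < chord_side a b (cis t)" if "a < t" "t < b"
  proof -
    have "\<bar>t - (a + b) / 2\<bar> < (b - a) / 2" using that unfolding abs_less_iff by argo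
    from cos_monotone_0_pi[OF _ this] show ?thesis using assms unfolding e by simp
  qed
  show "chord_side a b (cis t) < 0" if "t < a \<or> b < t"
  proof -
    have "(b - a) / 2 < \<bar>t - (a + b) / 2\<bar>" using that unfolding abs_if by argo
    moreover have "\<bar>t - (a + b) / 2\<bar> \<le> pi" using assms unfolding abs_le_iff by argo
    ultimately have "(b - a) / 2 < \<bar>t - (a + b) / 2\<bar>" "\<bar>t - (a + b) / 2\<bar> \<le> pi" .
    from cos_monotone_0_pi[OF _ this] show ?thesis using assms unfolding e by simp
  qed
  have *: "a - (a + b) / 2 = - ((b - a) / 2)" "b - (a + b) / 2 = (b - a) / 2" by argo+
  show "chord_side a b (cis a) = 0" "chord_side a b (cis b) = 0"
    unfolding chord_side_cis * cos_minus by simp_all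
qed

lemma chord_side_affine:
  "chord_side a b ((1 - s) *\<^sub>R u + s *\<^sub>R v) = (1 - s) * chord_side a b u + s * chord_side a b v"
  unfolding chord_side_def by (simp add: algebra_simps)

text \<open>As the chords do not interleave, \<open>cis c\<close> and \<open>cis d\<close> lie
  weakly on the same side of the line through \<open>cis a\<close> and \<open>cis b\<close>. In a
  convex combination on this line both terms vanish, so a common point is an end of both
  chords.\<close>

lemma chords_Int:
  assumes ab: "0 \<le> a" "a < b" "b \<le> pi" and cd: "0 \<le> c" "c < d" "d \<le> pi"
    and ne: "\<not> (a = c \<and> b = d)" and nc: "\<not> (a < c \<and> c < b \<and> b < d)" "\<not> (c < a \<and> a < d \<and> d < b)"
  shows "closed_segment (cis a) (cis b) \<inter> closed_segment (cis c) (cis d) \<subseteq> cis ` ({a, b} \<inter> {c, d})"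
proof
  fix z assume z: "z \<in> closed_segment (cis a) (cis b) \<inter> closed_segment (cis c) (cis d)"
  let ?L = "chord_side a b"
  note S = chord_side_sign[OF ab]
  have S0: "?L (cis a) = 0" "?L (cis b) = 0" using S(3,4)[of 0] pi_ge_zero by auto
  obtain r where "z = (1 - r) *\<^sub>R cis a + r *\<^sub>R cis b" using z unfolding closed_segment_def by blast
  then have Lz: "?L z = 0" using S0 by (simp only: chord_side_affine)
  obtain s where s: "z = (1 - s) *\<^sub>R cis c + s *\<^sub>R cis d" "0 \<le> s" "s \<le> 1"
    using z unfolding closed_segment_def by blast
  then have sum: "(1 - s) * ?L (cis c) + s * ?L (cis d) = 0" using Lz by (simp only: chord_side_affine)
  have c: "a < c \<Longrightarrow> c < b \<Longrightarrow> 0 < ?L (cis c)" "c < a \<or> b < c \<Longrightarrow> ?L (cis c) < 0" "c = a \<or> c = b \<Longrightarrow> ?L (cis c) = 0"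
    and d: "a < d \<Longrightarrow> d < b \<Longrightarrow> 0 < ?L (cis d)" "d < a \<or> b < d \<Longrightarrow> ?L (cis d) < 0" "d = a \<or> d = b \<Longrightarrow> ?L (cis d) = 0"
    using S[of c] S[of d] S0 cd by auto
  have "0 \<le> ?L (cis c) \<and> 0 \<le> ?L (cis d) \<or> ?L (cis c) \<le> 0 \<and> ?L (cis d) \<le> 0"
    using c d nc cd(2) by (smt (verit))
  then have "(1 - s) * ?L (cis c) = 0 \<and> s * ?L (cis d) = 0"
  proof
    assume "0 \<le> ?L (cis c) \<and> 0 \<le> ?L (cis d)"
    then show ?thesis using sum s(2,3) add_nonneg_eq_0_iff[of "(1 - s) * ?L (cis c)" "s * ?L (cis d)"] by simp
  next
    assume "?L (cis c) \<le> 0 \<and> ?L (cis d) \<le> 0"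
    then have "(1 - s) * ?L (cis c) \<le> 0" "s * ?L (cis d) \<le> 0" using s(2,3) by (simp_all add: mult_nonneg_nonpos)
    then show ?thesis using sum by linarith
  qed
  moreover have c0: "?L (cis c) = 0 \<Longrightarrow> c \<in> {a, b}" using c by fastforce
  moreover have d0: "?L (cis d) = 0 \<Longrightarrow> d \<in> {a, b}" using d by fastforce
  moreover have "\<not> (c \<in> {a, b} \<and> d \<in> {a, b})" using ne cd(2) ab(2) by auto
  ultimately consider "s = 0" "c \<in> {a, b}" | "s = 1" "d \<in> {a, b}" by fastforce
  then show "z \<in> cis ` ({a, b} \<inter> {c, d})" using s(1) by cases auto
qed

lemma segment_Int_sphere:
  fixes u v :: complex
  assumes "norm u = 1" "norm v = 1"
  shows "closed_segment u v \<inter> sphere 0 1 \<subseteq> {u, v}"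
proof
  fix z assume z: "z \<in> closed_segment u v \<inter> sphere 0 1"
  show "z \<in> {u, v}"
  proof (rule ccontr)
    assume "z \<notin> {u, v}"
    then have "z \<in> open_segment u v" using z unfolding open_segment_def by auto
    then show False using dist_decreases_open_segment[of z u v 0] z assms by (auto simp: dist_norm)
  qed
qed

lemma outer_path_drawing:
  assumes sg: "simple_graph H" and op: "outer_path (edges H) (verts H) x y vs"
  obtains p g where "drawing H p g" "drawing_points H p g \<subseteq> cball 0 1" "p ` verts H \<subseteq> sphere 0 1"
    "\<And>i. Suc i < length vs \<Longrightarrow> path_image (g {vs ! i, vs ! Suc i}) \<subseteq> sphere 0 1"
proof -
  have vs: "distinct vs" "set vs = verts H" "walk (edges H) vs" "noncrossing (edges H) vs"
    using op unfolding outer_path_def by auto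
  define n where "n = length vs"
  \<comment> \<open>Dividing by \<open>n\<close> rather than \<open>n - 1\<close> also covers a
    single vertex. All angles stay between 0 and pi, where \<open>cis\<close> is injective and the
    signs of \<open>chord_side\<close> are known.\<close>
  define th where "th k = pi * real k / real n" for k
  have th_mono: "th i < th j \<longleftrightarrow> i < j" if "j < n" for i j
    unfolding th_def using that by (simp add: divide_less_cancel)
  have th_le: "th i \<le> th j \<longleftrightarrow> i \<le> j" if "i < n" for i j
    using th_mono[OF that, of j] by linarith
  have th_eq: "th i = th j \<longleftrightarrow> i = j" if "i < n" "j < n" for i j
    using th_le[OF that(1), of j] th_le[OF that(2), of i] by linarith
  have th0: "0 \<le> th i" for i unfolding th_def by simp
  have thpi: "th i \<le> pi" if "i < n" for i
    unfolding th_def using that by (simp add: divide_le_eq mult_left_mono)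
  define q where "q k = cis (th k)" for k
  have q_inj: "q i = q j \<longleftrightarrow> i = j" if "i < n" "j < n" for i j
    using cis_inj[of "th i" "th j"] th0 thpi that th_eq[OF that] unfolding q_def by blast
  have nq: "norm (q i) = 1" for i unfolding q_def by simp
  define idx where "idx = inv_into {..<n} ((!) vs)"
  have injn: "inj_on ((!) vs) {..<n}" using vs(1) unfolding n_def by (simp add: inj_on_nth)
  have idx: "idx (vs ! i) = i" if "i < n" for i
    unfolding idx_def using inv_into_f_f[OF injn] that by auto
  have vert: "\<exists>i<n. v = vs ! i" if "v \<in> verts H" for v
    using that vs(2) unfolding n_def by (metis in_set_conv_nth)
  define p where "p v = q (idx v)" for v
  have pv: "p (vs ! i) = q i" if "i < n" for i unfolding p_def using idx[OF that] by simp
  have inV: "vs ! i \<in> verts H" if "i < n" for i using that vs(2) nth_mem unfolding n_def by blast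
  have pV: "p ` verts H = q ` {..<n}"
    using vert pv inV by (force simp: image_iff)
  \<comment> \<open>Edges between consecutive vertices must follow the circle, since the hamilton
    path has to lie on the boundary of the disk; all other edges are chords.\<close>
  define c where "c i j = (if j = Suc i then cis \<circ> linepath (th i) (th j) else linepath (q i) (q j))" for i j
  have c_arc: "arc (c i j)" "pathstart (c i j) = q i" "pathfinish (c i j) = q j" if "i < j" "j < n" for i j
  proof -
    have "th i < th j" "q i \<noteq> q j" using th_mono q_inj that by auto
    then show "arc (c i j)"
      using arc_cis(1)[of "th i" "th j"] th0 thpi[OF that(2)] unfolding c_def
      by (cases "j = Suc i") (simp_all add: arc_linepath)
    show "pathstart (c i j) = q i" "pathfinish (c i j) = q j"
      unfolding c_def by (auto simp: pathstart_def pathfinish_def linepath_def q_def)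
  qed
  have c_im: "path_image (c i j) = (if j = Suc i then cis ` {th i..th j} else closed_segment (q i) (q j))"
    if "i < j" "j < n" for i j
    using arc_cis(2)[of "th i" "th j"] th0 thpi th_mono that unfolding c_def by auto
  have q_im: "q i \<in> path_image (c i j)" "q j \<in> path_image (c i j)" if "i < j" "j < n" for i j
    using c_arc[OF that] pathstart_in_path_image pathfinish_in_path_image by metis+
  have c_cball: "path_image (c i j) \<subseteq> cball 0 1" if "i < j" "j < n" for i j
  proof -
    have "closed_segment (q i) (q j) \<subseteq> cball 0 1"
      using nq by (intro closed_segment_subset) auto
    then show ?thesis using c_im[OF that] by auto
  qed
  have c_sphere: "path_image (c i j) \<inter> sphere 0 1 \<subseteq> {q i, q j}" if "i < j" "j < n" "j \<noteq> Suc i" for i j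
    using segment_Int_sphere[OF nq nq] c_im[OF that(1,2)] that(3) by auto
  have c_verts: "m = i \<or> m = j" if ij: "i < j" "j < n" "m < n" "q m \<in> path_image (c i j)" for i j m
  proof (cases "j = Suc i")
    case True
    then obtain t where t: "q m = cis t" "th i \<le> t" "t \<le> th j" using ij c_im[OF ij(1,2)] by auto
    then have "th m = t" using cis_inj[of "th m" t] th0 thpi ij unfolding q_def by (meson order_trans)
    then show ?thesis using t th_le[of i m] th_le[of m j] ij True by auto
  next
    case False
    then have "q m \<in> {q i, q j}" using c_sphere[OF ij(1,2)] ij(4) nq by auto
    then show ?thesis using q_inj ij by auto
  qed
  \<comment> \<open>Two circle arcs meet at most in a common end, and a circle arc meets a chord
    only in a vertex. The noncrossing condition matters for two chords.\<close>
  have c_Int: "path_image (c i j) \<inter> path_image (c k l) \<subseteq> q ` ({i, j} \<inter> {k, l})"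
    if ij: "i < j" "j < n" and kl: "k < l" "l < n" and ne: "\<not> (i = k \<and> j = l)"
      and nc: "\<not> (i < k \<and> k < j \<and> j < l)" "\<not> (k < i \<and> i < l \<and> l < j)" for i j k l
  proof -
    consider "j = Suc i" "l = Suc k" | "j = Suc i" "l \<noteq> Suc k" | "j \<noteq> Suc i" "l = Suc k" | "j \<noteq> Suc i" "l \<noteq> Suc k"
      by blast
    then show ?thesis
    proof cases
      case 1
      show ?thesis
      proof
        fix z assume "z \<in> path_image (c i j) \<inter> path_image (c k l)"
        then have "z \<in> cis ` {th i..th j}" "z \<in> cis ` {th k..th l}"
          using c_im[OF ij] c_im[OF kl] 1 by auto
        then obtain s t where "z = cis s" "s \<in> {th i..th j}" "z = cis t" "t \<in> {th k..th l}"
          by (elim imageE) (rule that)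
        then have st: "z = cis s" "th i \<le> s" "s \<le> th j" "z = cis t" "th k \<le> t" "t \<le> th l" by auto
        then have eq: "s = t" using cis_inj[of s t] th0 thpi ij kl by (meson order_trans)
        have "i \<noteq> k" using ne 1 by auto
        then consider "j = k" | "l = i" | "j < k" | "l < i" using 1 by linarith
        then show "z \<in> q ` ({i, j} \<inter> {k, l})"
        proof cases
          case 1
          then have "s = th j" using st eq by auto
          then show ?thesis using st 1 unfolding q_def by auto
        next
          case 2
          then have "s = th i" using st eq by auto
          then show ?thesis using st 2 unfolding q_def by auto
        next
          case 3
          then have "th j < th k" using th_mono kl by auto
          then show ?thesis using st eq by linarith
        next
          case 4
          then have "th l < th i" using th_mono ij by auto
          then show ?thesis using st eq by linarith
        qed
      qed
    next
      case 2
      have "path_image (c i j) \<subseteq> sphere 0 1" using c_im[OF ij] 2 by auto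
      then have "path_image (c i j) \<inter> path_image (c k l) \<subseteq> {q k, q l}" using c_sphere[OF kl 2(2)] by blast
      then show ?thesis using c_verts[OF ij, of k] c_verts[OF ij, of l] kl by auto
    next
      case 3
      have "path_image (c k l) \<subseteq> sphere 0 1" using c_im[OF kl] 3 by auto
      then have "path_image (c i j) \<inter> path_image (c k l) \<subseteq> {q i, q j}" using c_sphere[OF ij 3(1)] by blast
      then show ?thesis using c_verts[OF kl, of i] c_verts[OF kl, of j] ij by auto
    next
      case 4
      have "path_image (c i j) \<inter> path_image (c k l) \<subseteq> cis ` ({th i, th j} \<inter> {th k, th l})"
        using chords_Int[of "th i" "th j" "th k" "th l"] c_im[OF ij] c_im[OF kl] 4 th0 thpi th_mono th_eq ij kl ne nc
        unfolding q_def by auto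
      moreover have "{th i, th j} \<inter> {th k, th l} = th ` ({i, j} \<inter> {k, l})"
        using th_eq ij kl by auto
      ultimately show ?thesis unfolding q_def by (simp add: image_image)
    qed
  qed
  \<comment> \<open>An edge is an unordered set; the smaller and the larger position of its ends
    recover the order that \<open>c\<close> expects.\<close>
  define g where "g e = c (Min (idx ` e)) (Max (idx ` e))" for e
  have ge: "g {vs ! i, vs ! j} = c i j" if "i < j" "j < n" for i j
    unfolding g_def using idx[of i] idx[of j] that by (simp add: min_def max_def)
  have edge: "\<exists>i j. i < j \<and> j < n \<and> e = {vs ! i, vs ! j}" if e: "e \<in> edges H" for e
  proof -
    obtain u v where uv: "e = {u, v}" "u \<noteq> v" "u \<in> verts H" "v \<in> verts H"
      using sg e unfolding simple_graph_def by (metis card_2_iff insert_subset)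
    obtain i j where ij: "i < n" "u = vs ! i" "j < n" "v = vs ! j" using vert[OF uv(3)] vert[OF uv(4)] by blast
    then have "i \<noteq> j" using uv(2) by auto
    then show ?thesis using ij uv(1) by (metis insert_commute linorder_neqE_nat)
  qed
  have "drawing H p g" unfolding drawing_def
  proof (intro conjI ballI impI)
    show "inj_on p (verts H)"
    proof (rule inj_onI)
      fix u v assume "u \<in> verts H" "v \<in> verts H" "p u = p v"
      then show "u = v" using vert pv q_inj by metis
    qed
  next
    fix e assume e: "e \<in> edges H"
    then obtain i j where ij: "i < j" "j < n" "e = {vs ! i, vs ! j}" using edge by blast
    have g: "g e = c i j" using ge ij by auto
    show "arc (g e)" "{pathstart (g e), pathfinish (g e)} = p ` e"
      using c_arc[OF ij(1,2)] g ij pv by auto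
    show "path_image (g e) \<inter> p ` verts H = p ` e"
      using c_verts[OF ij(1,2)] q_im[OF ij(1,2)] g ij pv pV by auto
  next
    fix e f assume ef: "e \<in> edges H" "f \<in> edges H" "e \<noteq> f"
    obtain i j where ij: "i < j" "j < n" "e = {vs ! i, vs ! j}" using edge[OF ef(1)] by blast
    obtain k l where kl: "k < l" "l < n" "f = {vs ! k, vs ! l}" using edge[OF ef(2)] by blast
    have nc: "\<not> (i < k \<and> k < j \<and> j < l)" "\<not> (k < i \<and> i < l \<and> l < j)"
      using noncrossingD[OF vs(4)] ef ij kl unfolding n_def by blast+
    have "path_image (g e) \<inter> path_image (g f) \<subseteq> q ` ({i, j} \<inter> {k, l})"
      using c_Int[OF ij(1,2) kl(1,2) _ nc] ge ij kl ef(3) by auto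
    also have "\<dots> \<subseteq> p ` (e \<inter> f)"
    proof
      fix z assume "z \<in> q ` ({i, j} \<inter> {k, l})"
      then obtain m where m: "z = q m" "m \<in> {i, j}" "m \<in> {k, l}" by auto
      then have "m < n" using ij by auto
      then show "z \<in> p ` (e \<inter> f)" using m pv ij(3) kl(3) by (intro image_eqI[of _ _ "vs ! m"]) auto
    qed
    finally have "path_image (g e) \<inter> path_image (g f) \<subseteq> p ` (e \<inter> f)" .
    moreover have "p ` e \<subseteq> path_image (g e)" "p ` f \<subseteq> path_image (g f)"
      using q_im[OF ij(1,2)] q_im[OF kl(1,2)] ge ij kl pv by auto
    ultimately show "path_image (g e) \<inter> path_image (g f) = p ` (e \<inter> f)" by blast
  qed
  moreover have sph: "p ` verts H \<subseteq> sphere 0 1" unfolding pV using nq by auto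
  moreover have "drawing_points H p g \<subseteq> cball 0 1"
  proof -
    have "path_image (g e) \<subseteq> cball 0 1" if "e \<in> edges H" for e
      using edge[OF that] ge c_cball by metis
    moreover have "p ` verts H \<subseteq> cball 0 1" using sph sphere_cball by blast
    ultimately show ?thesis unfolding drawing_points_def by blast
  qed
  moreover have "path_image (g {vs ! i, vs ! Suc i}) \<subseteq> sphere 0 1" if "Suc i < length vs" for i
    using that ge[of i "Suc i"] c_im[of i "Suc i"] unfolding n_def by auto
  ultimately show thesis using that by blast
qed

section \<open>Connectedness and minors in terms of edge sets\<close>

lemma induced_verts: "simple_graph G \<Longrightarrow> induced G (verts G) = G"
  unfolding induced_def simple_graph_def by (cases G) auto

text \<open>The cut form and reachability agree because the set of vertices reached from
  \<open>u\<close> is left by no edge.\<close>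

lemma connected_graph_induced_iff:
  assumes "S \<subseteq> verts G"
  shows "connected_graph (induced G S) \<longleftrightarrow> conn (edges G) S"
proof -
  let ?R = "{(a, b). {a, b} \<in> edges (induced G S)}"
  have vS: "verts (induced G S) = S" using assms unfolding induced_def by auto
  have eS: "{a, b} \<in> edges (induced G S) \<longleftrightarrow> {a, b} \<in> edges G \<and> a \<in> S \<and> b \<in> S" for a b
    unfolding induced_def by simp
  show ?thesis
  proof
    assume c: "connected_graph (induced G S)"
    show "conn (edges G) S" unfolding conn_def
    proof (intro conjI allI impI)
      show "S \<noteq> {}" using c vS unfolding connected_graph_def by simp
      fix T assume T: "T \<subseteq> S" "T \<noteq> {}" "T \<noteq> S"
      then obtain u v where uv: "u \<in> T" "v \<in> S" "v \<notin> T" by blast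
      have step: "w \<in> T" if n: "\<not> adjs (edges G) T (S - T)" and w: "(u, w) \<in> ?R\<^sup>*" for w
        using w
      proof (induction rule: rtrancl_induct)
        case (step y z)
        have "{y, z} \<in> edges G" "z \<in> S" using step(2) eS by simp_all
        then show ?case using n step(3) unfolding adjs_def by blast
      qed (rule uv)
      have "(u, v) \<in> ?R\<^sup>*"
        using c uv T vS unfolding connected_graph_def reachable_def by blast
      then show "adjs (edges G) T (S - T)" using step uv(3) by blast
    qed
  next
    assume c: "conn (edges G) S"
    have "(u, v) \<in> ?R\<^sup>*" if uv: "u \<in> S" "v \<in> S" for u v
    proof (rule ccontr)
      assume n: "(u, v) \<notin> ?R\<^sup>*"
      let ?P = "{w. (u, w) \<in> ?R\<^sup>*}"
      have u: "u \<in> ?P" and v: "v \<notin> ?P" using n by auto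
      obtain a b where ab: "a \<in> S" "a \<in> ?P" "b \<in> S" "b \<notin> ?P" "{a, b} \<in> edges G"
        by (rule conn_cut[OF c uv(1) u uv(2) v])
      have "(a, b) \<in> ?R" using ab eS by simp
      then have "(u, b) \<in> ?R\<^sup>*" using ab(2) rtrancl_into_rtrancl[of u a ?R b] by simp
      then show False using ab(4) by simp
    qed
    then show "connected_graph (induced G S)"
      unfolding connected_graph_def reachable_def vS using conn_nonempty[OF c] by blast
  qed
qed

lemma connected_graph_iff: "simple_graph G \<Longrightarrow> connected_graph G \<longleftrightarrow> conn (edges G) (verts G)"
  using connected_graph_induced_iff[of "verts G" G] induced_verts[of G] by simp

lemma outer_path_imp_xy_outerplanar:
  assumes sg: "simple_graph H" and op: "outer_path (edges H) (verts H) x y vs"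
  shows "xy_outerplanar x y H"
proof -
  obtain p g where d: "drawing H p g" "drawing_points H p g \<subseteq> cball 0 1" "p ` verts H \<subseteq> sphere 0 1"
    "\<And>i. Suc i < length vs \<Longrightarrow> path_image (g {vs ! i, vs ! Suc i}) \<subseteq> sphere 0 1"
    by (rule outer_path_drawing[OF sg op]) (rule that)
  have vs: "vs \<noteq> []" "hd vs = x" "last vs = y" "distinct vs" "set vs = verts H" "walk (edges H) vs"
    using op unfolding outer_path_def by auto
  have "connected_graph H" using walk_conn[OF vs(6,1)] vs(5) connected_graph_iff[OF sg] by simp
  moreover have "hamilton_path H x y vs"
    using vs unfolding hamilton_path_def by (auto simp: successively_conv_nth)
  moreover have "x \<in> verts H" "y \<in> verts H" using hd_in_set[OF vs(1)] last_in_set[OF vs(1)] vs(2,3,5) by simp_all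
  ultimately show ?thesis using sg d vs(5) unfolding xy_outerplanar_def by blast
qed

lemma outer_path_imp_outerplanar:
  assumes sg: "simple_graph H" and op: "outer_path (edges H) (verts H) x y vs"
  shows "outerplanar H"
proof -
  obtain p g where d: "drawing H p g" "drawing_points H p g \<subseteq> cball 0 1" "p ` verts H \<subseteq> sphere 0 1"
    by (rule outer_path_drawing[OF sg op]) (rule that)
  let ?D = "drawing_points H p g"
  have "p ` verts H \<subseteq> closure (outside ?D)" using d(3) sphere_subset_closure_outside[OF d(2)] by blast
  moreover have "p ` verts H \<subseteq> ?D" unfolding drawing_points_def by blast
  then have "p ` verts H \<inter> interior (outside ?D) = {}"
    using outside_no_overlap[of ?D] interior_subset[of "outside ?D"] by blast
  ultimately show ?thesis using d(1) unfolding outerplanar_def frontier_def by blast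
qed

lemma has_K2_branch_verts:
  assumes "simple_graph G" "K2_model (edges G) {..<4::nat} A B S"
  shows "A \<subseteq> verts G" "B \<subseteq> verts G" "i < 4 \<Longrightarrow> S i \<subseteq> verts G"
proof -
  have *: "\<Union>(edges G) \<subseteq> verts G" "{..<4::nat} \<noteq> {}"
    using assms(1) unfolding simple_graph_def by (auto simp: lessThan_empty_iff)
  show "A \<subseteq> verts G" "B \<subseteq> verts G" "i < 4 \<Longrightarrow> S i \<subseteq> verts G"
    using K2_model_subset_edges[OF assms(2) *] by auto
qed

lemma K24_minor_free_iff:
  assumes sg: "simple_graph G"
  shows "K24_minor_free G \<longleftrightarrow> \<not> has_K2 (edges G) 4"
proof -
  let ?K = "complete_bipartite 2 4"
  have vK: "Inl 0 \<in> verts ?K" "Inl 1 \<in> verts ?K" "i < 4 \<Longrightarrow> Inr i \<in> verts ?K" for i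
    unfolding complete_bipartite_def by auto
  have "is_minor ?K G \<longleftrightarrow> has_K2 (edges G) 4"
  proof
    assume "is_minor ?K G"
    then obtain B where B': "\<forall>u\<in>verts ?K. B u \<subseteq> verts G \<and> connected_graph (induced G (B u))"
      "\<forall>u\<in>verts ?K. \<forall>v\<in>verts ?K. u \<noteq> v \<longrightarrow> B u \<inter> B v = {}"
      "\<forall>u v. {u, v} \<in> edges ?K \<longrightarrow> (\<exists>a\<in>B u. \<exists>b\<in>B v. {a, b} \<in> edges G)"
      unfolding is_minor_def by (elim exE conjE) (rule that)
    note B = B'(1)[rule_format] B'(2)[rule_format] B'(3)[rule_format]
    have c: "conn (edges G) (B u)" if "u \<in> verts ?K" for u
      using B(1)[OF that] connected_graph_induced_iff by blast
    have e: "{Inl h, Inr i} \<in> edges ?K" if "h < 2" "i < 4" for h i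
      unfolding complete_bipartite_def using that by auto
    have a: "adjs (edges G) (B (Inl h)) (B (Inr i))" if "h < 2" "i < 4" for h i
      using B(3)[OF e[OF that]] unfolding adjs_def .
    have "K2_model (edges G) {..<4} (B (Inl 0)) (B (Inl 1)) (\<lambda>i. B (Inr i))"
      unfolding K2_model_def using c vK a[of 0] a[of 1] B(2) by auto
    then show "has_K2 (edges G) 4" unfolding has_K2_def by blast
  next
    assume "has_K2 (edges G) 4"
    then obtain A B S where M: "K2_model (edges G) {..<4::nat} A B S" unfolding has_K2_def by blast
    note m = K2_model_lessThanD[OF M]
    note V = has_K2_branch_verts[OF sg M]
    define F where "F u = (case u of Inl h \<Rightarrow> if h = 0 then A else B | Inr i \<Rightarrow> S i)" for u :: "nat + nat"
    have vs: "u = Inl 0 \<or> u = Inl 1 \<or> (\<exists>i<4. u = Inr i)" if "u \<in> verts ?K" for u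
      using that unfolding complete_bipartite_def by (auto simp: less_2_cases_iff)
    have FV: "F u \<subseteq> verts G \<and> conn (edges G) (F u)" if "u \<in> verts ?K" for u
      using vs[OF that] by (elim disjE exE conjE) (simp_all add: F_def V m)
    show "is_minor ?K G" unfolding is_minor_def
    proof (intro exI[of _ F] conjI ballI allI impI)
      fix u assume "u \<in> verts ?K"
      from FV[OF this] show "F u \<subseteq> verts G" "connected_graph (induced G (F u))"
        using connected_graph_induced_iff by blast+
    next
      fix u v assume uv: "u \<in> verts ?K" "v \<in> verts ?K" "u \<noteq> v"
      have m': "B \<inter> A = {}" "\<And>i. i < 4 \<Longrightarrow> A \<inter> S i = {}" "\<And>i. i < 4 \<Longrightarrow> B \<inter> S i = {}"
        using m(3,5,6) by (simp_all add: Int_commute)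
      show "F u \<inter> F v = {}"
        using vs[OF uv(1)] vs[OF uv(2)] uv(3)
        by (elim disjE exE conjE) (simp_all add: F_def m m')
    next
      fix u v assume "{u, v} \<in> edges ?K"
      then obtain h i where hi: "{u, v} = {Inl h, Inr i}" "h < 2" "i < 4"
        unfolding complete_bipartite_def by auto
      have "adjs (edges G) (F (Inl h)) (F (Inr i))"
        using m(7,8) hi unfolding F_def by (auto simp: less_2_cases_iff)
      moreover have "u = Inl h \<and> v = Inr i \<or> u = Inr i \<and> v = Inl h"
        using hi(1) by (auto simp: doubleton_eq_iff)
      ultimately have "adjs (edges G) (F u) (F v)" using adjs_sym by blast
      then show "\<exists>a\<in>F u. \<exists>b\<in>F v. {a, b} \<in> edges G" unfolding adjs_def .
    qed
  qed
  then show ?thesis unfolding K24_minor_free_def by blast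
qed

section \<open>Graphs of the three types are minor-free\<close>

lemma has_K2_mono: "has_K2 E n \<Longrightarrow> m \<le> n \<Longrightarrow> has_K2 E m"
  unfolding has_K2_def using K2_model_subset[of E "{..<n}" _ _ _ "{..<m}"] by (metis lessThan_subset_iff)

text \<open>A proper part \<open>T\<close> of the union either cuts some \<open>\<phi> v\<close>,
  which is connected, or is composed of whole sets and then corresponds to a cut of
  \<open>X\<close>.\<close>

lemma conn_expand:
  assumes X: "conn E1 X" and c: "\<And>v. v \<in> X \<Longrightarrow> conn E2 (\<phi> v)"
    and a: "\<And>v w. v \<in> X \<Longrightarrow> w \<in> X \<Longrightarrow> v \<noteq> w \<Longrightarrow> {v, w} \<in> E1 \<Longrightarrow> adjs E2 (\<phi> v) (\<phi> w)"
  shows "conn E2 (\<Union>(\<phi> ` X))"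
  unfolding conn_def
proof (intro conjI allI impI)
  have ne: "\<phi> v \<noteq> {}" if "v \<in> X" for v using c[OF that] conn_nonempty by blast
  show "\<Union>(\<phi> ` X) \<noteq> {}" using conn_nonempty[OF X] ne by auto
  fix T assume T: "T \<subseteq> \<Union>(\<phi> ` X)" "T \<noteq> {}" "T \<noteq> \<Union>(\<phi> ` X)"
  show "adjs E2 T (\<Union>(\<phi> ` X) - T)"
  proof (cases "\<exists>v\<in>X. \<phi> v \<inter> T \<noteq> {} \<and> \<not> \<phi> v \<subseteq> T")
    case True
    then obtain v where v: "v \<in> X" "\<phi> v \<inter> T \<noteq> {}" "\<not> \<phi> v \<subseteq> T" by blast
    have "\<phi> v \<inter> T \<subseteq> \<phi> v" "\<phi> v \<inter> T \<noteq> \<phi> v" using v by blast+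
    then have "adjs E2 (\<phi> v \<inter> T) (\<phi> v - \<phi> v \<inter> T)" using c[OF v(1)] v(2) unfolding conn_def by blast
    then show ?thesis by (rule adjs_mono) (use v in auto)
  next
    case False
    let ?P = "{v. \<phi> v \<subseteq> T}"
    obtain t where "t \<in> T" using T(2) by blast
    then obtain s where s: "s \<in> X" "t \<in> \<phi> s" using T(1) by blast
    have sP: "s \<in> ?P" using False s \<open>t \<in> T\<close> by blast
    obtain r where r: "r \<in> X" "r \<notin> ?P" using T by blast
    obtain v w where vw: "v \<in> X" "v \<in> ?P" "w \<in> X" "w \<notin> ?P" "{v, w} \<in> E1"
      by (rule conn_cut[OF X s(1) sP r])
    have "adjs E2 (\<phi> v) (\<phi> w)" using a[OF vw(1,3) _ vw(5)] vw by blast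
    moreover have "\<phi> w \<inter> T = {}" using False vw by blast
    ultimately show ?thesis using vw by (intro adjs_mono[of E2 "\<phi> v" "\<phi> w" E2 T]) auto
  qed
qed

text \<open>Transitivity of the minor relation, with \<open>\<phi>\<close> as a model of
  \<open>E1\<close> in \<open>E2\<close>. By \<open>0 < n\<close> all branch sets consist of ends of
  edges, which is where \<open>\<phi>\<close> is controlled.\<close>

lemma has_K2_expand:
  assumes K: "has_K2 E1 n" and n: "0 < n"
    and c: "\<And>v. v \<in> \<Union>E1 \<Longrightarrow> conn E2 (\<phi> v)"
    and d: "\<And>v w. v \<in> \<Union>E1 \<Longrightarrow> w \<in> \<Union>E1 \<Longrightarrow> v \<noteq> w \<Longrightarrow> \<phi> v \<inter> \<phi> w = {}"
    and a: "\<And>v w. v \<noteq> w \<Longrightarrow> {v, w} \<in> E1 \<Longrightarrow> adjs E2 (\<phi> v) (\<phi> w)"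
  shows "has_K2 E2 n"
proof -
  obtain A B S where M: "K2_model E1 {..<n} A B S" using K unfolding has_K2_def by blast
  have ne: "{..<n} \<noteq> {}" using n by auto
  note sub = K2_model_subset_edges[OF M order_refl ne]
  let ?F = "\<lambda>X. \<Union>(\<phi> ` X)"
  have cF: "conn E2 (?F X)" if "conn E1 X" "X \<subseteq> \<Union>E1" for X
    using that c a by (intro conn_expand[OF that(1)]) auto
  have dF: "?F X \<inter> ?F Y = {}" if "X \<inter> Y = {}" "X \<subseteq> \<Union>E1" "Y \<subseteq> \<Union>E1" for X Y
  proof -
    have "\<phi> v \<inter> \<phi> w = {}" if "v \<in> X" "w \<in> Y" for v w
      using d[of v w] that \<open>X \<inter> Y = {}\<close> \<open>X \<subseteq> \<Union>E1\<close> \<open>Y \<subseteq> \<Union>E1\<close> by blast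
    then show ?thesis by blast
  qed
  have aF: "adjs E2 (?F X) (?F Y)" if XY: "X \<inter> Y = {}" "adjs E1 X Y" for X Y
  proof -
    obtain u v where uv: "u \<in> X" "v \<in> Y" "{u, v} \<in> E1" using XY(2) unfolding adjs_def by blast
    then have "adjs E2 (\<phi> u) (\<phi> v)" using a[of u v] XY(1) by blast
    then show ?thesis by (rule adjs_mono) (use uv in auto)
  qed
  have "K2_model E2 {..<n} (?F A) (?F B) (\<lambda>i. ?F (S i))"
    unfolding K2_model_def
  proof (intro conjI ballI impI)
    show "conn E2 (?F A)" "conn E2 (?F B)" using cF sub(1,2) M unfolding K2_model_def by blast+
    show "?F A \<inter> ?F B = {}" using dF[OF _ sub(1,2)] M unfolding K2_model_def by blast
  next
    fix i assume i: "i \<in> {..<n}"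
    note si = sub(3)[OF i]
    have m: "conn E1 (S i)" "S i \<inter> A = {}" "S i \<inter> B = {}" "A \<inter> S i = {}" "B \<inter> S i = {}" "adjs E1 A (S i)" "adjs E1 B (S i)"
      using M i unfolding K2_model_def by blast+
    show "conn E2 (?F (S i))" by (rule cF[OF m(1) si])
    show "?F (S i) \<inter> ?F A = {}" by (rule dF[OF m(2) si sub(1)])
    show "?F (S i) \<inter> ?F B = {}" by (rule dF[OF m(3) si sub(2)])
    show "adjs E2 (?F A) (?F (S i))" by (rule aF[OF m(4,6)])
    show "adjs E2 (?F B) (?F (S i))" by (rule aF[OF m(5,7)])
  next
    fix i j assume ij: "i \<in> {..<n}" "j \<in> {..<n}" "i \<noteq> j"
    have "S i \<inter> S j = {}" using M ij unfolding K2_model_def by blast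
    then show "?F (S i) \<inter> ?F (S j) = {}" by (rule dF[OF _ sub(3)[OF ij(1)] sub(3)[OF ij(2)]])
  qed
  then show ?thesis unfolding has_K2_def by blast
qed

lemma has_K24_card:
  assumes K: "has_K2 E 4" and E: "\<Union>E \<subseteq> U" and fin: "finite U"
  shows "6 \<le> card U"
proof -
  obtain A B S where M: "K2_model E {..<4::nat} A B S" using K unfolding has_K2_def by blast
  have m: "A \<noteq> {}" "B \<noteq> {}" "A \<inter> B = {}" "\<And>i. i < 4 \<Longrightarrow> S i \<noteq> {}"
    "\<And>i. i < 4 \<Longrightarrow> S i \<inter> A = {}" "\<And>i. i < 4 \<Longrightarrow> S i \<inter> B = {}"
    "\<And>i j. i < 4 \<Longrightarrow> j < 4 \<Longrightarrow> i \<noteq> j \<Longrightarrow> S i \<inter> S j = {}"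
    using M conn_nonempty unfolding K2_model_def by auto
  have sub: "A \<subseteq> U" "B \<subseteq> U" "\<And>i. i < 4 \<Longrightarrow> S i \<subseteq> U"
    using K2_model_subset_edges[OF M E] by (simp_all add: lessThan_empty_iff)
  obtain a b where ab: "a \<in> A" "b \<in> B" using m(1,2) by blast
  have "\<exists>s. s \<in> S i" if "i < 4" for i using m(4)[OF that] by blast
  then obtain s where s: "\<And>i. i < 4 \<Longrightarrow> s i \<in> S i" by metis
  have neq: "s i \<noteq> s j" if "i < 4" "j < 4" "i \<noteq> j" for i j
    using s[OF that(1)] s[OF that(2)] m(7)[OF that] by auto
  have inj: "inj_on s {..<4}" by (rule inj_onI) (use neq in auto)
  have n: "s i \<noteq> a" "s i \<noteq> b" if "i < 4" for i using s[OF that] m(5,6)[OF that] ab by auto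
  have "a \<noteq> b" using ab m(3) by auto
  moreover have "a \<notin> s ` {..<4}" "b \<notin> s ` {..<4}" using n by auto
  ultimately have "card (insert a (insert b (s ` {..<4}))) = 6"
    using card_image[OF inj] by simp
  moreover have "s i \<in> U" if "i < 4" for i using s[OF that] sub(3)[OF that] by blast
  then have "insert a (insert b (s ` {..<4})) \<subseteq> U" using ab sub(1,2) by auto
  ultimately show ?thesis using card_mono[OF fin] by metis
qed

lemma outerplanar_imp_K24_minor_free:
  "outerplanar G \<Longrightarrow> simple_graph G \<Longrightarrow> K24_minor_free G"
  using outerplanar_no_K23[of G] K24_minor_free_iff[of G] has_K2_mono[of "edges G" 4 3] by auto

lemma xy_outerplanar_attachment:
  assumes H: "xy_outerplanar x y H" and xy: "x \<noteq> y"
    and E1: "\<Union>E1 \<subseteq> V1" and VU: "V1 \<inter> verts H = {x, y}" and w: "w \<notin> V1"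
    and K: "has_K2 (E1 \<union> edges H) 4"
  shows "has_K2 (E1 \<union> {{x, w}, {w, y}}) 4"
proof -
  obtain vs where vs: "outer_path (edges H) (verts H) x y vs" using xy_outerplanar_imp_outer_path[OF H] .
  have "\<Union>(edges H) \<subseteq> verts H" using H unfolding xy_outerplanar_def simple_graph_def by auto
  then interpret outer_attachment E1 "edges H" V1 "verts H" x y w vs
    by unfold_locales (use assms vs in auto)
  show ?thesis using has_K24_replace[OF K] .
qed

text \<open>Each piece in turn is exchanged for a path through one of its own inner vertices, which
  exists because the piece has at least three vertices.\<close>

lemma three_outerplanar_K24_minor_free:
  assumes sg: "simple_graph G" and xy: "x \<noteq> y"
    and H: "xy_outerplanar x y H1" "xy_outerplanar x y H2" "xy_outerplanar x y H3"
    and c: "3 \<le> card (verts H1)" "3 \<le> card (verts H2)" "3 \<le> card (verts H3)"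
    and int: "verts H1 \<inter> verts H2 = {x, y}" "verts H1 \<inter> verts H3 = {x, y}" "verts H2 \<inter> verts H3 = {x, y}"
    and E: "edges G = edges H1 \<union> edges H2 \<union> edges H3 \<union> Z" and Z: "Z \<subseteq> {{x, y}}"
  shows "K24_minor_free G"
proof -
  have "\<exists>w. w \<in> verts H \<and> w \<notin> {x, y}" if "3 \<le> card (verts H)" for H :: "'a ugraph"
  proof (rule ccontr)
    assume "\<not> ?thesis"
    then have "verts H \<subseteq> {x, y}" by blast
    then have "card (verts H) \<le> card {x, y}" by (intro card_mono) auto
    then show False using that xy by simp
  qed
  then obtain w1 w2 w3 where w: "w1 \<in> verts H1" "w1 \<notin> {x, y}" "w2 \<in> verts H2" "w2 \<notin> {x, y}" "w3 \<in> verts H3" "w3 \<notin> {x, y}"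
    using c by metis
  have sub: "\<Union>(edges H1) \<subseteq> verts H1" "\<Union>(edges H2) \<subseteq> verts H2" "\<Union>(edges H3) \<subseteq> verts H3"
    using H unfolding xy_outerplanar_def simple_graph_def by auto
  have "\<not> has_K2 (edges G) 4"
  proof
    assume "has_K2 (edges G) 4"
    then have "has_K2 ((edges H2 \<union> edges H3 \<union> Z) \<union> edges H1) 4" by (simp add: E Un_ac)
    then have "has_K2 ((edges H2 \<union> edges H3 \<union> Z) \<union> {{x, w1}, {w1, y}}) 4"
      by (rule xy_outerplanar_attachment[OF H(1) xy, of _ "verts H2 \<union> verts H3", rotated 3])
        (use sub int w Z in auto)
    then have "has_K2 ((edges H3 \<union> Z \<union> {{x, w1}, {w1, y}}) \<union> edges H2) 4" by (simp only: Un_ac)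
    then have "has_K2 ((edges H3 \<union> Z \<union> {{x, w1}, {w1, y}}) \<union> {{x, w2}, {w2, y}}) 4"
      by (rule xy_outerplanar_attachment[OF H(2) xy, of _ "verts H3 \<union> {w1}", rotated 3])
        (use sub int w Z in auto)
    then have "has_K2 ((Z \<union> {{x, w1}, {w1, y}} \<union> {{x, w2}, {w2, y}}) \<union> edges H3) 4" by (simp only: Un_ac)
    then have "has_K2 ((Z \<union> {{x, w1}, {w1, y}} \<union> {{x, w2}, {w2, y}}) \<union> {{x, w3}, {w3, y}}) 4"
      by (rule xy_outerplanar_attachment[OF H(3) xy, of _ "{x, y, w1, w2}", rotated 3])
        (use sub int w Z in auto)
    \<comment> \<open>The six disjoint branch sets of a K_{2,4} do not fit on the five vertices that
      remain.\<close>
    from has_K24_card[OF this, of "set [x, y, w1, w2, w3]"]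
    have "6 \<le> card (set [x, y, w1, w2, w3])" using Z by auto
    also have "\<dots> \<le> length [x, y, w1, w2, w3]" by (rule card_length)
    finally show False by simp
  qed
  then show ?thesis using K24_minor_free_iff[OF sg] by blast
qed

text \<open>Transports outer paths of the pieces into the sum type on which subdivided graphs
  live.\<close>

lemma outer_path_map:
  assumes f: "inj f" and op: "outer_path E U x y vs"
  shows "outer_path ((`) f ` E) (f ` U) (f x) (f y) (map f vs)"
proof -
  have im: "{f a, f b} \<in> (`) f ` E \<longleftrightarrow> {a, b} \<in> E" for a b
  proof
    assume "{f a, f b} \<in> (`) f ` E"
    moreover have "{f a, f b} = f ` {a, b}" by simp
    ultimately obtain e where e: "e \<in> E" "f ` {a, b} = f ` e" unfolding image_iff by metis
    have "{a, b} = e" using e(2) unfolding inj_image_eq_iff[OF f] .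
    then show "{a, b} \<in> E" using e(1) by metis
  next
    assume "{a, b} \<in> E"
    then have "f ` {a, b} \<in> (`) f ` E" by (rule imageI)
    then show "{f a, f b} \<in> (`) f ` E" by simp
  qed
  have "vs \<noteq> []" using op unfolding outer_path_def by blast
  moreover have "walk ((`) f ` E) (map f vs) = walk E vs" by (simp add: successively_map im)
  moreover have "noncrossing ((`) f ` E) (map f vs) = noncrossing E vs"
    unfolding noncrossing_def by (auto simp: im)
  ultimately show ?thesis using op f unfolding outer_path_def
    by (simp add: hd_map last_map distinct_map inj_on_subset[OF f subset_UNIV])
qed

lemma simple_graph_finite_edges: "simple_graph G \<Longrightarrow> finite (edges G)"
  unfolding simple_graph_def by (rule finite_subset[of _ "Pow (verts G)"]) auto

lemma simple_graph_subdivide: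
  assumes sg: "simple_graph G" and F: "F \<subseteq> edges G"
  shows "simple_graph (subdivide G F)"
proof -
  have "finite F" using F simple_graph_finite_edges[OF sg] finite_subset by blast
  moreover have "card (Inl ` e) = 2" if "e \<in> edges G" for e :: "'a set"
    using that sg unfolding simple_graph_def by (simp add: card_image)
  moreover have "v \<in> verts G" if "v \<in> e" "e \<in> edges G" for v e
    using that sg unfolding simple_graph_def by blast
  moreover have "v \<in> verts G" if "v \<in> e" "e \<in> F" for v e
    using that sg F unfolding simple_graph_def by blast
  ultimately show ?thesis using sg unfolding simple_graph_def subdivide_def by auto
qed

text \<open>The pieces are exchanged one at a time, with the subdividing vertex \<open>Inr e\<close>
  in the role of \<open>w\<close>. The disjointness conditions ensure that a piece meets everything
  else only at its ends.\<close>

lemma replace_edges_K24_minor_free: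
  assumes sg: "simple_graph G" and G: "G = replace_edges G0 F H" and sg0: "simple_graph G0"
    and sd: "subdividable G0 F"
    and H: "\<And>e. e \<in> F \<Longrightarrow> \<exists>x y. e = {x, y} \<and> xy_outerplanar x y (H e) \<and> verts (H e) \<inter> verts G0 = {x, y}"
    and HH: "\<And>e f. e \<in> F \<Longrightarrow> f \<in> F \<Longrightarrow> e \<noteq> f \<Longrightarrow> verts (H e) \<inter> verts (H f) \<subseteq> verts G0"
  shows "K24_minor_free G"
proof -
  have FE: "F \<subseteq> edges G0" and K: "K24_minor_free (subdivide G0 F)" using sd unfolding subdividable_def by auto
  have finF: "finite F" using FE simple_graph_finite_edges[OF sg0] finite_subset by blast
  let ?L = "(`) Inl :: 'a set \<Rightarrow> ('a + 'a set) set"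
  \<comment> \<open>Interpolates between the two graphs: the edges in \<open>F'\<close> carry their
    pieces, those in \<open>F - F'\<close> are subdivided. \<open>Ed {}\<close> belongs to the
    subdivided graph, and \<open>Ed F\<close> is a copy of the edges of \<open>G\<close>.\<close>
  define Ed where "Ed F' = ?L ` (edges G0 - F) \<union> (\<Union>e\<in>F'. ?L ` edges (H e)) \<union>
    {{Inl v, Inr e} | v e. e \<in> F - F' \<and> v \<in> e}" for F'
  have step: "has_K2 (Ed F') 4 \<Longrightarrow> has_K2 (Ed {}) 4" if "finite F'" "F' \<subseteq> F" for F'
    using that
  proof (induction F')
    case (insert e F')
    obtain x y where e: "e = {x, y}" "xy_outerplanar x y (H e)" "verts (H e) \<inter> verts G0 = {x, y}"
      using H[of e] insert.prems by blast
    have "card e = 2" "e \<subseteq> verts G0" using sg0 FE insert.prems unfolding simple_graph_def by auto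
    then have xy: "x \<noteq> y" using e(1) by auto
    obtain vs where vs: "outer_path (edges (H e)) (verts (H e)) x y vs" using xy_outerplanar_imp_outer_path[OF e(2)] .
    define E1 where "E1 = ?L ` (edges G0 - F) \<union> (\<Union>e\<in>F'. ?L ` edges (H e)) \<union>
      {{Inl v, Inr f} | v f. f \<in> F - insert e F' \<and> v \<in> f}"
    define V1 where "V1 = Inl ` verts G0 \<union> (\<Union>f\<in>F'. Inl ` verts (H f)) \<union> Inr ` (F - insert e F')"
    have subH: "\<Union>(edges (H f)) \<subseteq> verts (H f)" if "f \<in> F" for f
      using H[OF that] unfolding xy_outerplanar_def simple_graph_def by auto
    have sub0: "\<Union>(edges G0) \<subseteq> verts G0" using sg0 unfolding simple_graph_def by auto
    interpret outer_attachment E1 "?L ` edges (H e)" V1 "Inl ` verts (H e)" "Inl x" "Inl y" "Inr e" "map Inl vs"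
    proof
      show "outer_path (?L ` edges (H e)) (Inl ` verts (H e)) (Inl x) (Inl y) (map Inl vs)"
        by (rule outer_path_map[OF _ vs]) simp
      show "\<Union>(?L ` edges (H e)) \<subseteq> Inl ` verts (H e)" using subH[of e] insert.prems by auto
      show "Inl x \<noteq> (Inl y :: 'a + 'a set)" using xy by simp
      show "\<Union>E1 \<subseteq> V1"
      proof -
        have "\<Union>(?L ` (edges G0 - F)) \<subseteq> V1" using sub0 unfolding V1_def by auto
        moreover have "\<Union>(\<Union>e\<in>F'. ?L ` edges (H e)) \<subseteq> V1"
        proof
          fix z assume "z \<in> \<Union>(\<Union>e\<in>F'. ?L ` edges (H e))"
          then obtain f d where f: "f \<in> F'" "d \<in> edges (H f)" "z \<in> Inl ` d" by blast
          then have "d \<subseteq> verts (H f)" using subH[of f] insert.prems by blast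
          then show "z \<in> V1" using f unfolding V1_def by blast
        qed
        moreover have "v \<in> verts G0" if "v \<in> f" "f \<in> F" for v f
          using that sub0 FE by blast
        then have "\<Union>{{Inl v, Inr f} | v f. f \<in> F - insert e F' \<and> v \<in> f} \<subseteq> V1"
          unfolding V1_def by auto
        ultimately show ?thesis unfolding E1_def by auto
      qed
      have "verts (H f) \<inter> verts (H e) \<subseteq> {x, y}" if "f \<in> F'" for f
        using HH[of f e] that insert.prems insert.hyps e(3) by blast
      then show "V1 \<inter> Inl ` verts (H e) = {Inl x, Inl y}"
        using e(3) unfolding V1_def by auto
      show "Inr e \<notin> V1" unfolding V1_def by auto
    qed
    have "Ed (insert e F') = E1 \<union> ?L ` edges (H e)" unfolding Ed_def E1_def by auto
    moreover have "Ed F' = E1 \<union> {{Inl x, Inr e}, {Inr e, Inl y}}"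
    proof -
      have "e \<in> F - F'" using insert by auto
      then have "{{Inl v, Inr f} | v f. f \<in> F - F' \<and> v \<in> f} =
        {{Inl v, Inr f} | v f. f \<in> F - insert e F' \<and> v \<in> f} \<union> {{Inl v, Inr e} | v. v \<in> e}" by blast
      moreover have "{{Inl v, Inr e} | v. v \<in> e} = {{Inl x, Inr e}, {Inr e, Inl y}}"
        unfolding e(1) by (auto simp: insert_commute)
      ultimately show ?thesis unfolding Ed_def E1_def by (simp add: Un_assoc)
    qed
    ultimately show ?case using has_K24_replace insert by simp
  qed simp
  have "edges (subdivide G0 F) = Ed {}" unfolding subdivide_def Ed_def by simp
  then have "\<not> has_K2 (Ed {}) 4"
    using K K24_minor_free_iff[OF simple_graph_subdivide[OF sg0 FE]] by simp
  then have nF: "\<not> has_K2 (Ed F) 4" using step[OF finF] by blast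
  have Ed: "Ed F = ?L ` edges G" unfolding Ed_def G replace_edges_def by auto
  have "\<not> has_K2 (edges G) 4"
  proof
    assume "has_K2 (edges G) 4"
    then have "has_K2 (Ed F) 4"
    proof (rule has_K2_expand[of _ _ _ "\<lambda>v. {Inl v}"])
      fix v w :: 'a assume "{v, w} \<in> edges G"
      then have "?L {v, w} \<in> Ed F" unfolding Ed by blast
      then show "adjs (Ed F) {Inl v} {Inl w}" unfolding adjs_def by simp
    qed (auto simp: conn_singleton)
    then show False using nF by blast
  qed
  then show ?thesis using K24_minor_free_iff[OF sg] by blast
qed

section \<open>Rooted models in biconnected graphs\<close>

lemma outer_path_mono:
  assumes "outer_path E U x y vs"
  shows "outer_path {e \<in> E. e \<subseteq> U} U x y vs"
proof -
  have vs: "vs \<noteq> []" "hd vs = x" "last vs = y" "distinct vs" "set vs = U" "walk E vs" "noncrossing E vs"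
    using assms unfolding outer_path_def by auto
  have "walk {e \<in> E. e \<subseteq> U} vs"
    using vs(5,6) unfolding successively_conv_nth by (auto simp: Suc_lessD)
  moreover have "noncrossing {e \<in> E. e \<subseteq> U} vs" using vs(7) unfolding noncrossing_def by blast
  ultimately show ?thesis using vs unfolding outer_path_def by blast
qed

lemma split_list_two:
  assumes "p \<in> set P" "q \<in> set P" "p \<noteq> q"
  obtains as a bs b cs where "P = as @ a # bs @ b # cs" "{a, b} = {p, q}"
proof -
  obtain ys zs where yz: "P = ys @ p # zs" using assms(1) by (meson split_list)
  then consider "q \<in> set ys" | "q \<in> set zs" using assms(2,3) by auto
  then show thesis
  proof cases
    case 1
    then obtain us ws where "ys = us @ q # ws" by (meson split_list)
    then show thesis using that[of us q ws p zs] yz by auto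
  next
    case 2
    then obtain us ws where "zs = us @ q # ws" by (meson split_list)
    then show thesis using that[of ys p us q ws] yz by auto
  qed
qed

lemma conn_segment:
  assumes "walk E vs" "a < b" "b \<le> length vs"
  shows "conn E ((!) vs ` {a..<b})"
  using walk_conn[OF walk_segment[OF assms(1,3), of a]] assms(2) by simp

text \<open>The path is cut into four consecutive segments: up to \<open>i\<close>, then up to
  \<open>k\<close>, then up to the vertex before \<open>l\<close>, then from \<open>l\<close> on.
  The outer two are the hubs, the middle two the spokes; each hub reaches one spoke along the path
  and the other one along a crossing edge.\<close>

lemma rooted_K22_crossing:
  assumes vs: "vs \<noteq> []" "hd vs = x" "last vs = y" "distinct vs" "set vs \<subseteq> U" "walk E vs"
    and o: "i < k" "k < j" "j < l" "l < length vs"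
    and e: "{vs ! i, vs ! j} \<in> E" "{vs ! k, vs ! l} \<in> E"
  shows "rooted_K22 E U x y"
proof -
  let ?f = "(!) vs"
  have injf: "inj_on ?f {..<length vs}" using vs(4) by (simp add: inj_on_nth)
  have int: "?f ` X \<inter> ?f ` Y = {}" if "X \<subseteq> {..<length vs}" "Y \<subseteq> {..<length vs}" "X \<inter> Y = {}" for X Y
    using inj_on_image_Int[OF injf that(1,2)] that(3) by simp
  have suc: "{?f m, ?f (Suc m)} \<in> E" if "Suc m < length vs" for m
    using vs(6) that by (simp add: successively_conv_nth)
  have sub: "?f ` X \<subseteq> U" if "X \<subseteq> {..<length vs}" for X using that vs(5) by (auto simp: subset_iff)
  show ?thesis
  proof (rule rooted_K22I[of E "?f ` {0..<Suc i}" "?f ` {l..<length vs}" "?f ` {Suc i..<Suc k}" "?f ` {Suc k..<l}"])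
    show "conn E (?f ` {0..<Suc i})" "conn E (?f ` {l..<length vs})"
      "conn E (?f ` {Suc i..<Suc k})" "conn E (?f ` {Suc k..<l})"
      using o by (auto intro!: conn_segment[OF vs(6)])
    have "x = ?f 0" "y = ?f (length vs - 1)" using vs(1-3) hd_conv_nth last_conv_nth by metis+
    moreover have "0 \<in> {0..<Suc i}" "length vs - 1 \<in> {l..<length vs}" using o by auto
    ultimately show "x \<in> ?f ` {0..<Suc i}" "y \<in> ?f ` {l..<length vs}" by blast+
    show "?f ` {0..<Suc i} \<union> ?f ` {l..<length vs} \<union> ?f ` {Suc i..<Suc k} \<union> ?f ` {Suc k..<l} \<subseteq> U"
      using o by (intro Un_least sub) auto
    show "?f ` {0..<Suc i} \<inter> ?f ` {l..<length vs} = {}" "?f ` {0..<Suc i} \<inter> ?f ` {Suc i..<Suc k} = {}"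
      "?f ` {0..<Suc i} \<inter> ?f ` {Suc k..<l} = {}" "?f ` {l..<length vs} \<inter> ?f ` {Suc i..<Suc k} = {}"
      "?f ` {l..<length vs} \<inter> ?f ` {Suc k..<l} = {}" "?f ` {Suc i..<Suc k} \<inter> ?f ` {Suc k..<l} = {}"
      using o by (intro int; auto)+
    show "adjs E (?f ` {0..<Suc i}) (?f ` {Suc i..<Suc k})"
      using o suc[of i] by (intro adjsI[of "?f i" _ "?f (Suc i)"]) auto
    show "adjs E (?f ` {l..<length vs}) (?f ` {Suc i..<Suc k})"
      using o e(2) by (intro adjsI[of "?f l" _ "?f k"]) (auto simp: insert_commute)
    show "adjs E (?f ` {0..<Suc i}) (?f ` {Suc k..<l})"
      using o e(1) by (intro adjsI[of "?f i" _ "?f j"]) auto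
    have "Suc (l - 1) = l" using o by simp
    then show "adjs E (?f ` {l..<length vs}) (?f ` {Suc k..<l})"
      using o suc[of "l - 1"] by (intro adjsI[of "?f l" _ "?f (l - 1)"]) (auto simp: insert_commute)
  qed
qed

text \<open>Models with \<open>x\<close> and \<open>y\<close> in their hubs and otherwise disjoint can be glued, which adds up
  their numbers of spokes.\<close>

definition has_bundle :: "'a set set \<Rightarrow> 'a \<Rightarrow> 'a \<Rightarrow> 'a set \<Rightarrow> nat \<Rightarrow> bool" where
  "has_bundle E x y U n \<longleftrightarrow> (\<exists>A B S. K2_model E {..<n} A B S \<and> x \<in> A \<and> y \<in> B \<and>
     A \<subseteq> U \<union> {x, y} \<and> B \<subseteq> U \<union> {x, y} \<and> (\<forall>i<n. S i \<subseteq> U))"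

lemma has_bundle_rooted: "rooted_K22 E (K \<union> {x, y}) x y \<Longrightarrow> has_bundle E x y K 2"
proof -
  assume "rooted_K22 E (K \<union> {x, y}) x y"
  then obtain A B S where M: "K2_model E {..<2::nat} A B S" and s: "x \<in> A" "y \<in> B" "A \<subseteq> K \<union> {x, y}"
    "B \<subseteq> K \<union> {x, y}" "\<And>i. i < 2 \<Longrightarrow> S i \<subseteq> K \<union> {x, y}" unfolding rooted_K22_def by blast
  have "S i \<subseteq> K" if i: "i < 2" for i
  proof -
    have "S i \<inter> A = {}" "S i \<inter> B = {}" using M i unfolding K2_model_def by auto
    then show ?thesis using s(1,2) s(5)[OF i] by blast
  qed
  then show ?thesis unfolding has_bundle_def using M s by blast
qed

lemma has_bundle_conn:
  assumes "conn E K" "x \<notin> K" "y \<notin> K" "x \<noteq> y" "adjs E {x} K" "adjs E {y} K"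
  shows "has_bundle E x y K 1"
  unfolding has_bundle_def
  by (rule exI[of _ "{x}"], rule exI[of _ "{y}"], rule exI[of _ "\<lambda>_. K"])
    (use assms in \<open>auto simp: K2_model_def conn_singleton\<close>)

lemma has_bundle_Un:
  assumes b: "has_bundle E x y U n" "has_bundle E x y U' m"
    and d: "U \<inter> U' = {}" "x \<notin> U" "y \<notin> U" "x \<notin> U'" "y \<notin> U'"
  shows "has_bundle E x y (U \<union> U') (n + m)"
proof -
  obtain A B S where M: "K2_model E {..<n} A B S" and s: "x \<in> A" "y \<in> B" "A \<subseteq> U \<union> {x, y}"
    "B \<subseteq> U \<union> {x, y}" "\<And>i. i < n \<Longrightarrow> S i \<subseteq> U" using b(1) unfolding has_bundle_def by blast
  obtain A' B' S' where M': "K2_model E {..<m} A' B' S'" and s': "x \<in> A'" "y \<in> B'" "A' \<subseteq> U' \<union> {x, y}"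
    "B' \<subseteq> U' \<union> {x, y}" "\<And>i. i < m \<Longrightarrow> S' i \<subseteq> U'" using b(2) unfolding has_bundle_def by blast
  note m = K2_model_lessThanD[OF M]
  note m' = K2_model_lessThanD[OF M']
  have xy: "x \<notin> B" "y \<notin> A" "x \<notin> B'" "y \<notin> A'" using s(1,2) s'(1,2) m(3) m'(3) by blast+
  define T where "T i = (if i < n then S i else S' (i - n))" for i
  have T1: "S i \<inter> (A \<union> A') = {} \<and> S i \<inter> (B \<union> B') = {}" if "i < n" for i
    using m(5,6)[OF that] s(5)[OF that] s'(3,4) d by blast
  have T2: "S' i \<inter> (A \<union> A') = {} \<and> S' i \<inter> (B \<union> B') = {}" if "i < m" for i
    using m'(5,6)[OF that] s'(5)[OF that] s(3,4) d by blast
  have SS: "S i \<inter> S' j = {}" if "i < n" "j < m" for i j using s(5)[OF that(1)] s'(5)[OF that(2)] d(1) by blast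
  have "K2_model E {..<n + m} (A \<union> A') (B \<union> B') T" unfolding K2_model_def
  proof (intro conjI ballI impI)
    show "conn E (A \<union> A')" "conn E (B \<union> B')"
      using conn_Un[OF m(1) m'(1)] conn_Un[OF m(2) m'(2)] s(1,2) s'(1,2) by blast+
    have "A \<inter> B' \<subseteq> {x, y}" "A' \<inter> B \<subseteq> {x, y}"
      using s(3,4) s'(3,4) d(1) by blast+
    then have "A \<inter> B' = {}" "A' \<inter> B = {}" using xy by blast+
    then show "(A \<union> A') \<inter> (B \<union> B') = {}" using m(3) m'(3) by (simp add: Int_Un_distrib Int_Un_distrib2)
  next
    fix i assume "i \<in> {..<n + m}"
    then consider "i < n" | "\<not> i < n" "i - n < m" by fastforce
    then have "conn E (T i) \<and> T i \<inter> (A \<union> A') = {} \<and> T i \<inter> (B \<union> B') = {} \<and>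
      adjs E (A \<union> A') (T i) \<and> adjs E (B \<union> B') (T i)"
    proof cases
      case 1
      then show ?thesis
        using m(4)[OF 1] T1[OF 1] adjs_mono[OF m(7)[OF 1] order_refl Un_upper1 order_refl]
          adjs_mono[OF m(8)[OF 1] order_refl Un_upper1 order_refl] unfolding T_def by simp
    next
      case 2
      then show ?thesis
        using m'(4)[OF 2(2)] T2[OF 2(2)] adjs_mono[OF m'(7)[OF 2(2)] order_refl Un_upper2 order_refl]
          adjs_mono[OF m'(8)[OF 2(2)] order_refl Un_upper2 order_refl] unfolding T_def by simp
    qed
    then show "conn E (T i)" "T i \<inter> (A \<union> A') = {}" "T i \<inter> (B \<union> B') = {}"
      "adjs E (A \<union> A') (T i)" "adjs E (B \<union> B') (T i)" by blast+
  next
    fix i j assume ij: "i \<in> {..<n + m}" "j \<in> {..<n + m}" "i \<noteq> j"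
    consider "i < n" "j < n" | "i < n" "\<not> j < n" | "\<not> i < n" "j < n" | "\<not> i < n" "\<not> j < n" by blast
    then show "T i \<inter> T j = {}"
    proof cases
      case 1 then show ?thesis using m(9)[of i j] ij unfolding T_def by simp
    next
      case 2 then show ?thesis using SS[of i "j - n"] ij unfolding T_def by simp
    next
      case 3 then show ?thesis using SS[of j "i - n"] ij unfolding T_def by (simp add: Int_commute)
    next
      case 4 then show ?thesis using m'(9)[of "i - n" "j - n"] ij unfolding T_def by auto
    qed
  qed
  moreover have "T i \<subseteq> U \<union> U'" if "i < n + m" for i
  proof (cases "i < n")
    case False
    then have "i - n < m" using that by linarith
    then show ?thesis using s'(5) False unfolding T_def by auto
  qed (use s(5) in \<open>auto simp: T_def\<close>)
  ultimately show ?thesis unfolding has_bundle_def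
    using s(1-4) s'(1-4) by (intro exI[of _ "A \<union> A'"] exI[of _ "B \<union> B'"] exI[of _ T]) auto
qed

lemma has_bundle_imp_has_K2: "has_bundle E x y U n \<Longrightarrow> has_K2 E n"
  unfolding has_bundle_def has_K2_def by blast

section \<open>Outer paths and components in biconnected graphs\<close>

locale biconnected =
  fixes V :: "'a set" and E :: "'a set set"
  assumes finV: "finite V" and edgeV: "\<And>e. e \<in> E \<Longrightarrow> e \<subseteq> V \<and> card e = 2"
    and connV: "conn E V" and connV1: "\<And>c. c \<in> V \<Longrightarrow> V - {c} \<noteq> {} \<Longrightarrow> conn E (V - {c})"
begin

lemma edge_mem: "{a, b} \<in> E \<Longrightarrow> a \<in> V \<and> b \<in> V \<and> a \<noteq> b"
  using edgeV[of "{a, b}"] by auto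

text \<open>Otherwise \<open>c\<close> would separate \<open>Q\<close> from the remaining vertices,
  or, if \<open>c\<close> is not in \<open>V - Q\<close>, the graph itself would be
  disconnected.\<close>

lemma not_one_nbr:
  assumes Q: "Q \<subseteq> V" "Q \<noteq> {}" and n: "nbrs E Q \<subseteq> {c}" and ne: "V - Q - {c} \<noteq> {}"
  shows False
proof -
  obtain s where s: "s \<in> Q" using Q(2) by blast
  obtain t where t: "t \<in> V" "t \<notin> Q" "t \<noteq> c" using ne by blast
  show False
  proof (cases "c \<in> V - Q")
    case True
    then have c: "conn E (V - {c})" using connV1 t by blast
    have st: "s \<in> V - {c}" "t \<in> V - {c}" using s t True Q by blast+
    obtain a b where "a \<in> V - {c}" "a \<in> Q" "b \<in> V - {c}" "b \<notin> Q" "{a, b} \<in> E"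
      by (rule conn_cut[OF c st(1) s st(2) t(2)])
    then show False using n unfolding nbrs_def by blast
  next
    case False
    have st: "s \<in> V" using s Q by blast
    obtain a b where "a \<in> V" "a \<in> Q" "b \<in> V" "b \<notin> Q" "{a, b} \<in> E"
      by (rule conn_cut[OF connV st s t(1,2)])
    then show False using n False unfolding nbrs_def by blast
  qed
qed

lemma two_nbrs:
  assumes Q: "Q \<subseteq> V" "Q \<noteq> {}" and xy: "x \<in> V - Q" "y \<in> V - Q" "x \<noteq> y"
  obtains p q where "p \<in> nbrs E Q" "q \<in> nbrs E Q" "p \<noteq> q"
proof -
  have "\<not> nbrs E Q \<subseteq> {x}" using not_one_nbr[OF Q, of x] xy by blast
  then obtain p where p: "p \<in> nbrs E Q" by blast
  have "V - Q - {p} \<noteq> {}" using xy by blast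
  then have "\<not> nbrs E Q \<subseteq> {p}" using not_one_nbr[OF Q, of p] by blast
  then show thesis using p that by blast
qed

text \<open>By \<open>closed\<close>, a component \<open>Q\<close> of what a longest path misses
  stays in \<open>U\<close> once it meets \<open>U\<close>. Having no cutvertex, the graph provides
  two neighbours of \<open>Q\<close>, and these are on the path.\<close>

lemma ex_outer_path:
  assumes xy: "x \<noteq> y" "x \<in> U" "y \<in> U" and UV: "U \<subseteq> V" and cU: "conn E U"
    and closed: "\<And>a b. a \<in> U \<Longrightarrow> a \<noteq> x \<Longrightarrow> a \<noteq> y \<Longrightarrow> {a, b} \<in> E \<Longrightarrow> b \<in> U"
    and nr: "\<not> rooted_K22 E U x y"
  obtains vs where "outer_path E U x y vs"
proof -
  define good where "good vs \<longleftrightarrow> vs \<noteq> [] \<and> distinct vs \<and> walk E vs \<and> hd vs = x \<and> last vs = y \<and> set vs \<subseteq> U" for vs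
  have finU: "finite U" using finV UV finite_subset by blast
  obtain vs0 where "good vs0" using conn_path[OF cU xy(2,3)] unfolding good_def by metis
  moreover have "\<forall>vs. good vs \<longrightarrow> length vs < Suc (card U)"
    unfolding good_def using card_mono[OF finU] distinct_card by (metis le_imp_less_Suc)
  ultimately obtain P where P: "good P" and max: "\<And>vs. good vs \<Longrightarrow> length vs \<le> length P"
    using ex_has_greatest_nat[of good vs0 length] by blast
  have p: "P \<noteq> []" "distinct P" "walk E P" "hd P = x" "last P = y" "set P \<subseteq> U" using P unfolding good_def by auto
  have xyP: "x \<in> set P" "y \<in> set P" using p hd_in_set last_in_set by metis+
  have "set P = U"
  proof (rule ccontr)
    assume "set P \<noteq> U"
    then obtain v where v: "v \<in> U" "v \<notin> set P" using p(6) by blast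
    obtain Q where Q: "is_comp E (V - set P) Q" "v \<in> Q"
      using ex_comp[of v "V - set P" E] v UV by blast
    have Qs: "Q \<subseteq> V - set P" "conn E Q" "\<not> adjs E Q (V - set P - Q)" using Q(1) unfolding is_comp_def by auto
    have QU: "Q \<subseteq> U"
    proof (rule ccontr)
      assume "\<not> Q \<subseteq> U"
      then obtain z where z: "z \<in> Q" "z \<notin> U" by blast
      obtain a b where "a \<in> Q" "a \<in> U" "b \<in> Q" "b \<notin> U" "{a, b} \<in> E"
        by (rule conn_cut[OF Qs(2) Q(2) v(1) z])
      then show False using closed[of a b] xyP Qs(1) by blast
    qed
    have QV: "Q \<subseteq> V" "Q \<noteq> {}" "x \<in> V - Q" "y \<in> V - Q" using Qs Q(2) xyP xy UV by blast+
    obtain r s where rs: "r \<in> nbrs E Q" "s \<in> nbrs E Q" "r \<noteq> s" using two_nbrs[OF QV xy(1)] .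
    have nP: "nbrs E Q \<subseteq> set P" using Qs(3) edge_mem unfolding nbrs_def adjs_def by blast
    obtain as a bs b cs where sp: "P = as @ a # bs @ b # cs" "{a, b} = {r, s}"
      using split_list_two[of r P s] rs nP by blast
    have "a \<in> nbrs E Q" "b \<in> nbrs E Q" using rs sp(2) by (auto simp: doubleton_eq_iff)
    then obtain a' b' where ab: "a' \<in> Q" "{a', a} \<in> E" "b' \<in> Q" "{b', b} \<in> E" unfolding nbrs_def by blast
    then have ab2: "{a, a'} \<in> E" "{b, b'} \<in> E" by (simp_all add: insert_commute)
    have "P = (as @ [a]) @ bs @ (b # cs)" using sp(1) by simp
    then have "walk E ((as @ [a]) @ bs @ (b # cs))" using p(3) by simp
    then have w: "walk E (as @ [a])" "walk E (b # cs)" unfolding successively_append_iff by blast+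
    \<comment> \<open>If the two neighbours are consecutive on \<open>P\<close>, a detour through
      \<open>Q\<close> makes the path longer. Otherwise the stretch \<open>bs\<close> between them
      and \<open>Q\<close> are the spokes, and the two remaining parts of \<open>P\<close> are the
      hubs.\<close>
    show False
    proof (cases "bs = []")
      case True
      obtain zs where zs: "zs \<noteq> []" "distinct zs" "walk E zs" "hd zs = a'" "last zs = b'" "set zs \<subseteq> Q"
        using conn_path[OF Qs(2) ab(1,3)] .
      let ?R = "(as @ [a]) @ zs @ (b # cs)"
      have "walk E (zs @ (b # cs))" unfolding successively_append_iff using w(2) zs ab by simp
      then have "walk E ?R" using w(1) zs ab2 unfolding successively_append_iff[of _ "as @ [a]"] by simp
      moreover have "distinct ?R" using p(2) zs(2,6) Qs(1) sp(1) by auto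
      moreover have "hd ?R = x" using p(4) sp(1) by (cases as) auto
      moreover have "last ?R = y" using p(5) sp(1) True by simp
      moreover have "set ?R \<subseteq> U" using p(6) zs(6) QU sp(1) by auto
      ultimately have "good ?R" unfolding good_def by simp
      then have "length ?R \<le> length P" by (rule max)
      then show False using sp(1) True zs(1) by simp
    next
      case False
      have wbs: "walk E bs" "{a, hd bs} \<in> E" "{last bs, b} \<in> E"
        using p(3) False unfolding sp(1) by (auto simp: successively_append_iff successively_Cons)
      have "rooted_K22 E U x y"
      proof (rule rooted_K22I[of E "set (as @ [a])" "set (b # cs)" "set bs" Q])
        show "conn E (set (as @ [a]))" "conn E (set (b # cs))" "conn E (set bs)"
          using walk_conn w wbs(1) False by blast+
        show "x \<in> set (as @ [a])" using p(4) sp(1) by (cases as) auto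
        show "y \<in> set (b # cs)" using p(5) sp(1) by auto
        show "adjs E (set (as @ [a])) (set bs)" using wbs(2) False by (intro adjsI[of a _ "hd bs"]) auto
        show "adjs E (set (b # cs)) (set bs)"
          using wbs(3) False by (intro adjsI[of b _ "last bs"]) (auto simp: insert_commute)
        show "adjs E (set (as @ [a])) Q" using ab ab2 by (intro adjsI[of a _ a']) auto
        show "adjs E (set (b # cs)) Q" using ab ab2 by (intro adjsI[of b _ b']) auto
      qed (use Qs p(2,6) QU sp(1) in auto)
      then show False using nr by blast
    qed
  qed
  moreover have "noncrossing E P" unfolding noncrossing_def
    using rooted_K22_crossing[OF p(1,4,5,2,6,3)] nr by blast
  ultimately show thesis using that[of P] p unfolding outer_path_def by blast
qed

lemma comp_adjs:
  assumes xy: "x \<in> V" "y \<in> V" "x \<noteq> y" and K: "is_comp E (V - {x, y}) K"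
  shows "adjs E {x} K" "adjs E {y} K"
proof -
  have k: "K \<subseteq> V - {x, y}" "K \<noteq> {}" "\<not> adjs E K (V - {x, y} - K)"
    using K conn_nonempty unfolding is_comp_def by auto
  have n: "nbrs E K \<subseteq> {x, y}" using k(3) edge_mem unfolding nbrs_def adjs_def by blast
  have K': "K \<subseteq> V" using k(1) by blast
  have "\<not> nbrs E K \<subseteq> {y}" "\<not> nbrs E K \<subseteq> {x}"
    using not_one_nbr[OF K' k(2), of y] not_one_nbr[OF K' k(2), of x] xy k(1) by blast+
  then have "x \<in> nbrs E K" "y \<in> nbrs E K" using n by blast+
  then show "adjs E {x} K" "adjs E {y} K" unfolding nbrs_def adjs_def by (auto simp: insert_commute)
qed

lemma comp_bundle:
  assumes xy: "x \<in> V" "y \<in> V" "x \<noteq> y" and K: "is_comp E (V - {x, y}) K"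
  shows "has_bundle E x y K 1"
  using has_bundle_conn[OF _ _ _ xy(3) comp_adjs[OF xy K]] K unfolding is_comp_def by auto

abbreviation "good x y K \<equiv> \<not> rooted_K22 E (K \<union> {x, y}) x y"

lemma comp_outer_path:
  assumes xy: "x \<in> V" "y \<in> V" "x \<noteq> y" and K: "is_comp E (V - {x, y}) K" and g: "good x y K"
  obtains vs where "outer_path E (K \<union> {x, y}) x y vs"
proof -
  have k: "K \<subseteq> V - {x, y}" "conn E K" "\<not> adjs E K (V - {x, y} - K)"
    using K unfolding is_comp_def by auto
  have "conn E (K \<union> {x})"
    by (rule conn_Un[OF k(2) conn_singleton]) (use comp_adjs(1)[OF xy K] adjs_sym in blast)
  then have "conn E (K \<union> {x} \<union> {y})"
    by (rule conn_Un[OF _ conn_singleton])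
      (use adjs_mono[OF adjs_sym[OF comp_adjs(2)[OF xy K]], of E "K \<union> {x}" "{y}"] in blast)
  then have c: "conn E (K \<union> {x, y})" by (simp add: insert_commute)
  show thesis
  proof (rule ex_outer_path[OF xy(3) _ _ _ c _ g that])
    show "b \<in> K \<union> {x, y}" if "a \<in> K \<union> {x, y}" "a \<noteq> x" "a \<noteq> y" "{a, b} \<in> E" for a b
      using that k(3) edge_mem[OF that(4)] unfolding adjs_def by blast
  qed (use xy k in auto)
qed

lemma comp_disjoint:
  "is_comp E S K \<Longrightarrow> is_comp E S K' \<Longrightarrow> K \<noteq> K' \<Longrightarrow> K \<inter> K' = {}"
  using comp_eq by metis

text \<open>Applied with the components permuted, the second conclusion makes all three of them
  good.\<close>

lemma at_most_three_comps:
  assumes nK: "\<not> has_K2 E 4" and xy: "x \<in> V" "y \<in> V" "x \<noteq> y"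
    and K: "is_comp E (V - {x, y}) K1" "is_comp E (V - {x, y}) K2" "is_comp E (V - {x, y}) K3"
    and ne: "K1 \<noteq> K2" "K1 \<noteq> K3" "K2 \<noteq> K3"
  shows "K1 \<union> K2 \<union> K3 = V - {x, y}" "good x y K1"
proof -
  have d: "K1 \<inter> K2 = {}" "K1 \<inter> K3 = {}" "K2 \<inter> K3 = {}" using K ne comp_disjoint by blast+
  have k: "K1 \<subseteq> V - {x, y}" "K2 \<subseteq> V - {x, y}" "K3 \<subseteq> V - {x, y}" using K unfolding is_comp_def by auto
  note b = comp_bundle[OF xy K(1)] comp_bundle[OF xy K(2)] comp_bundle[OF xy K(3)]
  have b23: "has_bundle E x y (K2 \<union> K3) 2"
    using has_bundle_Un[OF b(2,3) d(3)] k by (auto simp: numeral_2_eq_2)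
  show "good x y K1"
  proof
    assume "rooted_K22 E (K1 \<union> {x, y}) x y"
    from has_bundle_rooted[OF this] have "has_bundle E x y (K1 \<union> (K2 \<union> K3)) (2 + 2)"
      by (rule has_bundle_Un[OF _ b23]) (use d k in auto)
    then show False using nK has_bundle_imp_has_K2[of E x y _ 4] by auto
  qed
  show "K1 \<union> K2 \<union> K3 = V - {x, y}"
  proof (rule ccontr)
    assume "\<not> ?thesis"
    then obtain u where u: "u \<in> V - {x, y}" "u \<notin> K1" "u \<notin> K2" "u \<notin> K3" using k by blast
    obtain K4 where K4: "is_comp E (V - {x, y}) K4" "u \<in> K4" using ex_comp[OF u(1)] .
    have d4: "K1 \<inter> K4 = {}" "K2 \<inter> K4 = {}" "K3 \<inter> K4 = {}"
      using comp_disjoint[OF _ K4(1)] K K4(2) u by blast+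
    have k4: "K4 \<subseteq> V - {x, y}" using K4(1) unfolding is_comp_def by auto
    have b14: "has_bundle E x y (K1 \<union> K4) 2"
      using has_bundle_Un[OF b(1) comp_bundle[OF xy K4(1)] d4(1)] k k4 by (auto simp: numeral_2_eq_2)
    have "has_bundle E x y ((K1 \<union> K4) \<union> (K2 \<union> K3)) (2 + 2)"
      by (rule has_bundle_Un[OF b14 b23]) (use d d4 k k4 in auto)
    then show False using nK has_bundle_imp_has_K2[of E x y _ 4] by auto
  qed
qed

lemma not_both_bad:
  assumes nK: "\<not> has_K2 E 4" and xy: "x \<in> V" "y \<in> V" "x \<noteq> y"
    and K: "is_comp E (V - {x, y}) K1" "is_comp E (V - {x, y}) K2" "K1 \<noteq> K2"
  shows "good x y K1 \<or> good x y K2"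
proof (rule ccontr)
  assume "\<not> ?thesis"
  then have b: "has_bundle E x y K1 2" "has_bundle E x y K2 2" by (auto intro: has_bundle_rooted)
  have "has_bundle E x y (K1 \<union> K2) (2 + 2)"
    by (rule has_bundle_Un[OF b]) (use K comp_disjoint[OF K] in \<open>auto simp: is_comp_def\<close>)
  then show False using nK has_bundle_imp_has_K2[of E x y _ 4] by auto
qed

lemma comp_nbrs:
  assumes xy: "x \<in> V" "y \<in> V" "x \<noteq> y" and K: "is_comp E (V - {x, y}) K"
  shows "nbrs E K = {x, y}"
proof -
  have k: "K \<subseteq> V - {x, y}" "\<not> adjs E K (V - {x, y} - K)" using K unfolding is_comp_def by auto
  have "nbrs E K \<subseteq> {x, y}" using k(2) edge_mem unfolding nbrs_def adjs_def by blast
  moreover have "x \<in> nbrs E K" "y \<in> nbrs E K"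
    using comp_adjs[OF xy K] k(1) unfolding nbrs_def adjs_def by (auto simp: insert_commute)
  ultimately show ?thesis by blast
qed

text \<open>Edges leaving \<open>C\<close> end in \<open>x\<close> or \<open>y\<close>, so
  \<open>C\<close> remains a component when the rest of \<open>W\<close> is put back.\<close>

lemma comp_of_nbrs:
  assumes C: "is_comp E (V - W) C" and n: "nbrs E C = {x, y}"
  shows "is_comp E (V - {x, y}) C"
  using C n unfolding is_comp_def nbrs_def adjs_def by blast

lemma good_swap: "good x y K \<longleftrightarrow> good y x K"
  using rooted_K22_swap[of E "K \<union> {x, y}"] by (metis insert_commute)

text \<open>The path through \<open>K1\<close> is continued from \<open>y\<close> back through
  \<open>K2\<close> and stops before returning to \<open>x\<close>. No edge joins \<open>K1\<close>
  and \<open>K2\<close>, so two crossing edges would cross with respect to one of the given paths,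
  the vertex \<open>x\<close> serving as an end of both.\<close>

lemma two_good_outer_path:
  assumes xy: "x \<in> V" "y \<in> V" "x \<noteq> y"
    and K: "is_comp E (V - {x, y}) K1" "is_comp E (V - {x, y}) K2" "K1 \<noteq> K2"
    and cov: "K1 \<union> K2 = V - {x, y}" and g: "good x y K1" "good x y K2"
  obtains z rs where "outer_path E V x z rs"
proof -
  obtain ps where ps: "outer_path E (K1 \<union> {x, y}) x y ps" using comp_outer_path[OF xy K(1) g(1)] .
  obtain qs where qs: "outer_path E (K2 \<union> {x, y}) x y qs" using comp_outer_path[OF xy K(2) g(2)] .
  have p: "ps \<noteq> []" "hd ps = x" "last ps = y" "distinct ps" "set ps = K1 \<union> {x, y}" "walk E ps" "noncrossing E ps"
    using ps unfolding outer_path_def by auto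
  have q: "qs \<noteq> []" "hd qs = x" "last qs = y" "distinct qs" "set qs = K2 \<union> {x, y}" "walk E qs" "noncrossing E qs"
    using qs unfolding outer_path_def by auto
  have K12: "K1 \<inter> K2 = {}" using comp_disjoint[OF K] .
  have k: "x \<notin> K1" "y \<notin> K1" "x \<notin> K2" "y \<notin> K2" using K unfolding is_comp_def by auto
  have noedge: "{a, b} \<notin> E" if "a \<in> K1" "b \<in> K2" for a b
    using K(1) K12 cov that unfolding is_comp_def adjs_def by blast
  obtain ms where ms: "qs = x # ms @ [y]"
  proof -
    obtain t where t: "qs = x # t" using q(1,2) by (cases qs) auto
    then have "t \<noteq> []" using q(3) xy(3) by auto
    then have "t = butlast t @ [y]" using q(3) t append_butlast_last_id[of t] by simp
    then show thesis using that[of "butlast t"] t by simp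
  qed
  have setms: "set ms = K2" using q(4,5) k unfolding ms by auto
  have wms: "walk E (rev ms)" and dms: "distinct ms"
    using q(4,6) unfolding ms by (auto simp: walk_rev[of E ms] successively_append_iff successively_Cons simp del: successively_rev)
  define n where "n = length ps"
  define L where "L = length ms"
  define rs where "rs = ps @ rev ms"
  have n2: "2 \<le> n"
  proof -
    have "x \<in> set ps" "y \<in> set ps" using p(5) by auto
    then have "card {x, y} \<le> card (set ps)" by (intro card_mono) auto
    then show ?thesis unfolding n_def using distinct_card[OF p(4)] xy(3) by simp
  qed
  have len: "length rs = n + L" unfolding rs_def n_def L_def by simp
  have rsp: "rs ! i = ps ! i" if "i < n" for i using that unfolding rs_def n_def by (simp add: nth_append)
  have psl: "ps ! (n - 1) = y" "ps ! 0 = x" using p(1-3) unfolding n_def by (metis last_conv_nth, metis hd_conv_nth)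
  \<comment> \<open>From \<open>y\<close> on, the order is that of \<open>qs\<close> reversed:
    position \<open>n - 1\<close> is \<open>y\<close>, and \<open>x\<close> would come at position
    \<open>n + L\<close>, just beyond the end; it stands at position 0 instead.\<close>
  have rsq: "rs ! i = qs ! (L + n - i)" if i: "n - 1 \<le> i" "i < n + L" for i
  proof (cases "i < n")
    case True
    then have "i = n - 1" using i by simp
    moreover have "qs ! (L + 1) = y" unfolding ms L_def by (simp add: nth_append)
    ultimately show ?thesis using rsp[of i] psl n2 by simp
  next
    case False
    have "rs ! i = rev ms ! (i - n)" using False unfolding rs_def n_def by (simp add: nth_append)
    also have "\<dots> = ms ! (L - Suc (i - n))" using i False unfolding L_def by (intro rev_nth) auto
    also have "L - Suc (i - n) = L + n - i - 1" using False i by simp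
    also have "ms ! (L + n - i - 1) = qs ! (L + n - i)"
      using False i n2 unfolding ms L_def by (auto simp: nth_append nth_Cons')
    finally show ?thesis .
  qed
  have rs0: "rs ! 0 = x" "qs ! 0 = x" using rsp[of 0] psl(2) n2 ms by auto
  have inK2: "rs ! i \<in> K2" if "n \<le> i" "i < n + L" for i
  proof -
    have "rs ! i = rev ms ! (i - n)" using that unfolding rs_def n_def by (simp add: nth_append)
    moreover have "i - n < length (rev ms)" using that unfolding L_def by simp
    ultimately show ?thesis using setms nth_mem[of "i - n" "rev ms"] by simp
  qed
  have inK1: "rs ! i \<in> K1" if "0 < i" "i < n - 1" for i
  proof -
    have "ps ! i \<in> K1 \<union> {x, y}" using that p(5) nth_mem[of i ps] unfolding n_def by auto
    moreover have "ps ! i \<noteq> ps ! 0" "ps ! i \<noteq> ps ! (n - 1)"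
      using that nth_eq_iff_index_eq[OF p(4), of i 0] nth_eq_iff_index_eq[OF p(4), of i "n - 1"]
      unfolding n_def by linarith+
    ultimately show ?thesis using psl rsp[of i] that by auto
  qed
  \<comment> \<open>Positions strictly between 0 and \<open>n - 1\<close> belong to
    \<open>K1\<close> and have no neighbours in \<open>K2\<close>.\<close>
  have left: "i = 0 \<or> n - 1 \<le> i" if "{rs ! i, rs ! j} \<in> E" "i < j" "n \<le> j" "j < n + L" for i j
    using inK1[of i] inK2[OF that(3,4)] noedge that(1) by fastforce
  have nc: "noncrossing E rs" unfolding noncrossing_def
  proof (intro allI impI notI)
    fix i k' j l
    assume o: "i < k' \<and> k' < j \<and> j < l \<and> l < length rs"
      and e: "{rs ! i, rs ! j} \<in> E \<and> {rs ! k', rs ! l} \<in> E"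
    show False
    proof (cases "l < n")
      case True
      then show False using noncrossingD[OF p(7), of i j k' l] o e rsp n_def by auto
    next
      case False
      then have k1: "n - 1 \<le> k'" using left[of k' l] o e len by auto
      let ?t = "\<lambda>m. L + n - m"
      have r: "rs ! k' = qs ! ?t k'" "rs ! j = qs ! ?t j" "rs ! l = qs ! ?t l"
        using rsq k1 o len by auto
      have lq: "length qs = L + 2" unfolding ms L_def by simp
      have ord: "0 < ?t l" "?t l < ?t j" "?t j < ?t k'" "?t k' < length qs" using o len k1 lq n2 by auto
      have e2: "{qs ! ?t l, qs ! ?t k'} \<in> E" using e r by (simp add: insert_commute)
      consider "i = 0" | "n - 1 \<le> i" using left[of i j] o e len k1 by fastforce
      then show False
      proof cases
        case 1
        then have "{qs ! 0, qs ! ?t j} \<in> E" using e r rs0 by simp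
        from noncrossingD[OF q(7) this e2 ord] show False .
      next
        case 2
        then have "rs ! i = qs ! ?t i" using rsq[of i] o len by auto
        then have "{qs ! ?t j, qs ! ?t i} \<in> E" using e r by (simp add: insert_commute)
        moreover have "?t k' < ?t i" "?t i < length qs" using o len 2 lq n2 by auto
        ultimately show False using noncrossingD[OF q(7) e2 _ ord(2,3)] by blast
      qed
    qed
  qed
  have "distinct rs" using p(4,5) dms setms K12 k unfolding rs_def by auto
  moreover have "set rs = V" using p(5) setms cov xy unfolding rs_def by auto
  moreover have "walk E rs"
  proof -
    have "ms \<noteq> [] \<Longrightarrow> {y, last ms} \<in> E"
      using q(6) unfolding ms by (auto simp: successively_append_iff successively_Cons insert_commute)
    then show ?thesis unfolding rs_def successively_append_iff using p(3,6) wms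
      by (cases "ms = []") (simp_all add: hd_rev)
  qed
  moreover have "hd rs = x" using p(1,2) unfolding rs_def by simp
  moreover have "rs \<noteq> []" using p(1) unfolding rs_def by simp
  ultimately have "outer_path E V x (last rs) rs" using nc unfolding outer_path_def by blast
  then show thesis by (rule that)
qed

text \<open>Its failure is the case of a union of three pieces. Where it holds, two known components
  of a 2-cut are all there are.\<close>

definition few_comps :: bool where
  "few_comps \<longleftrightarrow> (\<forall>p\<in>V. \<forall>q\<in>V. p \<noteq> q \<longrightarrow> (\<forall>K1 K2 K3. is_comp E (V - {p, q}) K1 \<longrightarrow>
     is_comp E (V - {p, q}) K2 \<longrightarrow> is_comp E (V - {p, q}) K3 \<longrightarrow> K1 = K2 \<or> K1 = K3 \<or> K2 = K3))"

lemma few_compsD: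
  "few_comps \<Longrightarrow> p \<in> V \<Longrightarrow> q \<in> V \<Longrightarrow> p \<noteq> q \<Longrightarrow> is_comp E (V - {p, q}) K1 \<Longrightarrow>
    is_comp E (V - {p, q}) K2 \<Longrightarrow> is_comp E (V - {p, q}) K3 \<Longrightarrow> K1 = K2 \<or> K1 = K3 \<or> K2 = K3"
  unfolding few_comps_def by blast

text \<open>Locates attachment vertices: a hub that reaches a spoke inside \<open>D\<close> without
  lying inside \<open>D\<close> has to enter through a neighbour of \<open>D\<close>.\<close>

lemma adjacent_to_comp:
  assumes D: "D \<noteq> {}" and X: "conn E X" "X \<inter> nbrs E D = {}" "\<not> X \<subseteq> D" and Y: "Y \<subseteq> D"
  shows "\<not> adjs E X Y"
proof
  assume "adjs E X Y"
  then obtain u s where us: "u \<in> X" "s \<in> Y" "{u, s} \<in> E" unfolding adjs_def by blast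
  have "{s, u} \<in> E" using us(3) by (simp add: insert_commute)
  then have uD: "u \<in> D" using us Y X(2) unfolding nbrs_def by blast
  obtain t where t: "t \<in> X" "t \<notin> D" using X(3) by blast
  obtain a b where "a \<in> X" "a \<in> D" "b \<in> X" "b \<notin> D" "{a, b} \<in> E"
    by (rule conn_cut[OF X(1) us(1) uD t])
  then show False using X(2) unfolding nbrs_def by blast
qed

text \<open>If one hub contains both \<open>a\<close> and \<open>c\<close>, the two spokes lie in pieces attached to \<open>b\<close> and \<open>c\<close>.
  There is only one such piece, as \<open>a\<close> lies in another component of \<open>V - {b, c}\<close>.\<close>

lemma good_split_aux:
  assumes V: "a \<in> V" "b \<in> V" "a \<noteq> b"
    and K: "is_comp E (V - {a, b}) K" and c: "c \<in> K"
    and pieces': "\<forall>D. is_comp E (V - {a, b, c}) D \<longrightarrow> D \<subseteq> K \<longrightarrow>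
      (\<exists>p q. p \<noteq> q \<and> {p, q} \<subseteq> {a, b, c} \<and> nbrs E D = {p, q} \<and> good p q D)"
    and two: few_comps
    and M: "K2_model E {..<2::nat} A B S" and ab: "a \<in> A" "b \<in> B" and cA: "c \<in> A"
    and sub: "A \<subseteq> K \<union> {a, b}" "B \<subseteq> K \<union> {a, b}" "\<And>i. i < 2 \<Longrightarrow> S i \<subseteq> K \<union> {a, b}"
  shows False
proof -
  note pieces = pieces'[rule_format]
  note m = K2_model_lessThanD[OF M]
  have k: "K \<subseteq> V - {a, b}" using K unfolding is_comp_def by auto
  have cV: "c \<in> V" "c \<noteq> a" "c \<noteq> b" using k c by auto
  \<comment> \<open>The spoke avoids \<open>a\<close>, \<open>b\<close> and \<open>c\<close>, so it
    lies in a piece \<open>D\<close>. The hub \<open>B\<close> can reach it only through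
    \<open>b\<close>; and the neighbours cannot be \<open>a\<close> and \<open>b\<close>, since
    \<open>D\<close> would then be all of \<open>K\<close>, which contains \<open>c\<close>.\<close>
  have piece: "\<exists>D. is_comp E (V - {a, b, c}) D \<and> S i \<subseteq> D \<and> nbrs E D = {b, c} \<and> good b c D \<and> b \<notin> D \<and> c \<notin> D \<and> a \<notin> D"
    if i: "i < 2" for i
  proof -
    have Sk: "S i \<subseteq> V - {a, b, c}" "S i \<subseteq> K" using sub(3)[OF i] m(5,6)[OF i] ab cA k by blast+
    obtain s where s: "s \<in> S i" using conn_nonempty[OF m(4)[OF i]] by blast
    obtain D where D: "is_comp E (V - {a, b, c}) D" "s \<in> D" using ex_comp[of s "V - {a, b, c}" E] s Sk by blast
    have SD: "S i \<subseteq> D" by (rule conn_subset_comp[OF D(1) m(4)[OF i] Sk(1)]) (use s D in blast)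
    have d: "D \<subseteq> V - {a, b, c}" "conn E D" using D(1) unfolding is_comp_def by auto
    have DK: "D \<subseteq> K" by (rule conn_subset_comp[OF K d(2)]) (use d D s Sk in blast)+
    obtain p q where pq: "p \<noteq> q" "{p, q} \<subseteq> {a, b, c}" "nbrs E D = {p, q}" "good p q D"
      using pieces[OF D(1) DK] by blast
    have "B \<inter> nbrs E D \<noteq> {}"
      using adjacent_to_comp[OF _ m(2) _ _ SD] D(2) m(8)[OF i] ab(2) d(1) by blast
    then have bn: "b \<in> nbrs E D" using pq(2,3) ab cA m(3) by blast
    have "nbrs E D \<noteq> {a, b}"
    proof
      assume "nbrs E D = {a, b}"
      then have "is_comp E (V - {a, b}) D" by (rule comp_of_nbrs[OF D(1)])
      then have "D = K" using comp_eq[OF _ K, of D] D(2) DK by blast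
      then show False using c d(1) by blast
    qed
    then have n: "nbrs E D = {b, c}" using bn pq by auto
    then have "p = b \<and> q = c \<or> p = c \<and> q = b" using pq(3) by (auto simp: doubleton_eq_iff)
    then have "good b c D" using pq(4) good_swap by blast
    then show ?thesis using D(1) SD n d(1) by blast
  qed
  obtain D where D: "is_comp E (V - {a, b, c}) D" "S 0 \<subseteq> D" "nbrs E D = {b, c}" "good b c D" "b \<notin> D" "c \<notin> D" "a \<notin> D"
    using piece[of 0] by auto
  obtain D' where D': "is_comp E (V - {a, b, c}) D'" "S 1 \<subseteq> D'" "nbrs E D' = {b, c}" "a \<notin> D'"
    using piece[of 1] by auto
  have cD: "is_comp E (V - {b, c}) D" "is_comp E (V - {b, c}) D'"
    using comp_of_nbrs[OF D(1,3)] comp_of_nbrs[OF D'(1,3)] by auto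
  have "a \<in> V - {b, c}" using V cV by auto
  then obtain D3 where D3: "is_comp E (V - {b, c}) D3" "a \<in> D3" using ex_comp by metis
  have eq: "D = D'" using few_compsD[OF two V(2) cV(1) cV(3)[symmetric] cD D3(1)] D(7) D'(4) D3(2) by auto
  have SD: "S i \<subseteq> D" if "i < 2" for i using that D(2) D'(2) eq by (auto simp: less_2_cases_iff)
  have nb: "v \<in> D \<or> v = b \<or> v = c" if "u \<in> D" "{u, v} \<in> E" for u v
    using that D(3) unfolding nbrs_def by blast
  have bA: "b \<notin> A" "c \<notin> B" using ab cA m(3) by auto
  \<comment> \<open>Of the two neighbours of \<open>D\<close>, only \<open>c\<close> is in
    \<open>A\<close> and only \<open>b\<close> is in \<open>B\<close>. So each hub enters
    \<open>D\<close> through a single vertex, and its part in \<open>D\<close> together with this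
    vertex stays connected.\<close>
  have "conn E (A \<inter> insert c D \<union> {c})"
    by (rule conn_gate[OF m(1)]) (use cA conn_singleton nb bA in auto)
  moreover have "A \<inter> insert c D \<union> {c} = A \<inter> D \<union> {c}" by auto
  ultimately have cA': "conn E (A \<inter> D \<union> {c})" by simp
  have "conn E (B \<inter> insert b D \<union> {b})"
    by (rule conn_gate[OF m(2)]) (use ab conn_singleton nb bA in auto)
  moreover have "B \<inter> insert b D \<union> {b} = B \<inter> D \<union> {b}" by auto
  ultimately have cB': "conn E (B \<inter> D \<union> {b})" by simp
  have aA: "adjs E (A \<inter> D \<union> {c}) (S i)" if i: "i < 2" for i
  proof -
    obtain u s where us: "u \<in> A" "s \<in> S i" "{u, s} \<in> E" using m(7)[OF i] unfolding adjs_def by blast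
    have "{s, u} \<in> E" using us(3) by (simp add: insert_commute)
    then have "u \<in> D \<or> u = c" using nb[of s u] SD[OF i] us(1,2) bA by blast
    then show ?thesis using us by (intro adjsI[of u _ s]) auto
  qed
  have aB: "adjs E (B \<inter> D \<union> {b}) (S i)" if i: "i < 2" for i
  proof -
    obtain u s where us: "u \<in> B" "s \<in> S i" "{u, s} \<in> E" using m(8)[OF i] unfolding adjs_def by blast
    have "{s, u} \<in> E" using us(3) by (simp add: insert_commute)
    then have "u \<in> D \<or> u = b" using nb[of s u] SD[OF i] us(1,2) bA by blast
    then show ?thesis using us by (intro adjsI[of u _ s]) auto
  qed
  have "rooted_K22 E (D \<union> {b, c}) c b"
  proof (rule rooted_K22I[OF cA' cB' m(4)[of 0] m(4)[of 1]])
    show "A \<inter> D \<union> {c} \<union> (B \<inter> D \<union> {b}) \<union> S 0 \<union> S 1 \<subseteq> D \<union> {b, c}" using SD[of 0] SD[of 1] by auto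
    show "(A \<inter> D \<union> {c}) \<inter> (B \<inter> D \<union> {b}) = {}" using m(3) D cV by auto
    show "(A \<inter> D \<union> {c}) \<inter> S 0 = {}" "(A \<inter> D \<union> {c}) \<inter> S 1 = {}" using m(5)[of 0] m(5)[of 1] cA by auto
    show "(B \<inter> D \<union> {b}) \<inter> S 0 = {}" "(B \<inter> D \<union> {b}) \<inter> S 1 = {}" using m(6)[of 0] m(6)[of 1] ab by auto
    show "S 0 \<inter> S 1 = {}" using m(9)[of 0 1] by simp
  qed (use aA aB in auto)
  from rooted_K22_swap[OF this] D(4) show False by contradiction
qed

text \<open>In a rooted K_{2,2} the vertex \<open>c\<close> must be in a hub: a spoke has to contain
  \<open>c\<close> if no hub does, and two disjoint spokes cannot both contain it. By symmetry of
  the hubs, \<open>good_split_aux\<close> applies.\<close>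

lemma good_split:
  assumes V: "a \<in> V" "b \<in> V" "a \<noteq> b"
    and K: "is_comp E (V - {a, b}) K" and c: "c \<in> K"
    and pieces': "\<forall>D. is_comp E (V - {a, b, c}) D \<longrightarrow> D \<subseteq> K \<longrightarrow>
      (\<exists>p q. p \<noteq> q \<and> {p, q} \<subseteq> {a, b, c} \<and> nbrs E D = {p, q} \<and> good p q D)"
    and two: few_comps
  shows "good a b K"
proof
  note pieces = pieces'[rule_format]
  assume "rooted_K22 E (K \<union> {a, b}) a b"
  then obtain A B S where M: "K2_model E {..<2::nat} A B S" and ab: "a \<in> A" "b \<in> B"
    and sub: "A \<subseteq> K \<union> {a, b}" "B \<subseteq> K \<union> {a, b}" "\<And>i. i < 2 \<Longrightarrow> S i \<subseteq> K \<union> {a, b}"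
    unfolding rooted_K22_def by blast
  note m = K2_model_lessThanD[OF M]
  have k: "K \<subseteq> V - {a, b}" using K unfolding is_comp_def by auto
  \<comment> \<open>A spoke in a piece that both hubs reach, with \<open>c\<close> in neither hub,
    makes \<open>a\<close> and \<open>b\<close> the neighbours of the piece. The piece would then be
    the whole component \<open>K\<close> in spite of \<open>c\<close>.\<close>
  have claim: "c \<in> A \<or> c \<in> B \<or> c \<in> S i" if i: "i < 2" for i
  proof (rule ccontr)
    assume n: "\<not> ?thesis"
    have Sk: "S i \<subseteq> V - {a, b, c}" "S i \<subseteq> K" using sub(3)[OF i] m(5,6)[OF i] ab n k by blast+
    obtain s where s: "s \<in> S i" using conn_nonempty[OF m(4)[OF i]] by blast
    obtain D where D: "is_comp E (V - {a, b, c}) D" "s \<in> D" using ex_comp[of s "V - {a, b, c}" E] s Sk by blast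
    have SD: "S i \<subseteq> D" by (rule conn_subset_comp[OF D(1) m(4)[OF i] Sk(1)]) (use s D in blast)
    have d: "D \<subseteq> V - {a, b, c}" "conn E D" using D(1) unfolding is_comp_def by auto
    have DK: "D \<subseteq> K" by (rule conn_subset_comp[OF K d(2)]) (use d D s Sk in blast)+
    obtain p q where pq: "p \<noteq> q" "{p, q} \<subseteq> {a, b, c}" "nbrs E D = {p, q}" using pieces[OF D(1) DK] by blast
    have "B \<inter> nbrs E D \<noteq> {}"
      using adjacent_to_comp[OF _ m(2) _ _ SD] D(2) m(8)[OF i] ab(2) d(1) by blast
    then have "b \<in> nbrs E D" using pq(2,3) ab n m(3) by blast
    moreover have "A \<inter> nbrs E D \<noteq> {}"
      using adjacent_to_comp[OF _ m(1) _ _ SD] D(2) m(7)[OF i] ab(1) d(1) by blast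
    then have "a \<in> nbrs E D" using pq(2,3) ab n m(3) by blast
    ultimately have "nbrs E D = {a, b}" using pq(3) V(3) by auto
    then have "is_comp E (V - {a, b}) D" by (rule comp_of_nbrs[OF D(1)])
    then have "D = K" using comp_eq[OF _ K, of D] D(2) DK by blast
    then show False using c d(1) by blast
  qed
  have "c \<in> A \<or> c \<in> B" using claim[of 0] claim[of 1] m(9)[of 0 1] by auto
  then show False
  proof
    assume "c \<in> A"
    then show False using good_split_aux[OF V K c pieces' two M ab _ sub] by blast
  next
    assume cB: "c \<in> B"
    have eq: "{b, a} = {a, b}" "{b, a, c} = {a, b, c}" by auto
    show False
    proof (rule good_split_aux[OF V(2,1) V(3)[symmetric] _ c _ two K2_model_swap[OF M] ab(2,1) cB])
      show "is_comp E (V - {b, a}) K" using K eq by simp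
      show "\<forall>D. is_comp E (V - {b, a, c}) D \<longrightarrow> D \<subseteq> K \<longrightarrow>
        (\<exists>p q. p \<noteq> q \<and> {p, q} \<subseteq> {b, a, c} \<and> nbrs E D = {p, q} \<and> good p q D)"
        using pieces' unfolding eq .
    qed (use sub eq in auto)
  qed
qed

end

section \<open>Minimal frames\<close>

context biconnected
begin

text \<open>The bound 4 is what \<open>k_connected 3\<close> demands of the number of
  vertices.\<close>

definition frame :: "'a set \<Rightarrow> bool" where
  "frame W \<longleftrightarrow> W \<subseteq> V \<and> 4 \<le> card W \<and> (\<forall>C. is_comp E (V - W) C \<longrightarrow>
     (\<exists>x y. x \<noteq> y \<and> x \<in> W \<and> y \<in> W \<and> nbrs E C = {x, y} \<and> good x y C))"

text \<open>Edges are sets, so a piece attached to the ends of an existing edge yields this edge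
  again and no parallel one.\<close>

definition torso :: "'a set \<Rightarrow> 'a set set" where
  "torso W = {e \<in> E. e \<subseteq> W} \<union> nbrs E ` {C. is_comp E (V - W) C}"

text \<open>Outside \<open>W - K1\<close> the component \<open>K1\<close> appears as a new good
  piece, swallowing the old pieces inside it. The other pieces are old ones and are not attached to
  vertices of \<open>K1\<close>, since no edge joins \<open>K1\<close> to another component.\<close>

lemma shrink_frame:
  assumes W: "frame W" and xy: "x \<in> W" "y \<in> W" "x \<noteq> y"
    and K: "is_comp E (V - {x, y}) K1" "is_comp E (V - {x, y}) K2" "K1 \<noteq> K2"
    and m: "K1 \<inter> W \<noteq> {}" "K2 \<inter> W \<noteq> {}" and g: "good x y K1" "\<not> good x y K2" and two: few_comps
  shows "frame (W - K1)" "card (W - K1) < card W"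
proof -
  have WV: "W \<subseteq> V" and cW: "4 \<le> card W" using W unfolding frame_def by auto
  have finW: "finite W" using WV finV finite_subset by blast
  have xyV: "x \<in> V" "y \<in> V" using xy WV by auto
  have k: "K1 \<subseteq> V - {x, y}" "K2 \<subseteq> V - {x, y}" "conn E K1" "\<not> adjs E K1 (V - {x, y} - K1)"
    using K unfolding is_comp_def by auto
  have d: "K1 \<inter> K2 = {}" using comp_disjoint[OF K] .
  show "card (W - K1) < card W" using m(1) finW by (intro psubset_card_mono) auto
  have piece: "\<exists>p q. p \<noteq> q \<and> p \<in> W - K1 \<and> q \<in> W - K1 \<and> nbrs E D = {p, q} \<and> good p q D"
    if D: "is_comp E (V - (W - K1)) D" for D
  proof (cases "D \<inter> K1 = {}")
    case False
    have D': "D \<subseteq> V - (W - K1)" "conn E D" using D unfolding is_comp_def by auto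
    have "K1 \<subseteq> D" by (rule conn_subset_comp[OF D k(3)]) (use k(1) False in blast)+
    moreover have "D \<subseteq> K1" by (rule conn_subset_comp[OF K(1) D'(2)]) (use D'(1) xy k(1) False in blast)+
    ultimately have "D = K1" by blast
    then show ?thesis using comp_nbrs[OF xyV xy(3) K(1)] g(1) xy k(1) by blast
  next
    case True
    have "D \<subseteq> V - W" "V - W - D \<subseteq> V - (W - K1) - D" using D True unfolding is_comp_def by blast+
    then have "is_comp E (V - W) D" using D adjs_mono[OF _ order_refl order_refl] unfolding is_comp_def by blast
    then obtain p q where pq: "p \<noteq> q" "p \<in> W" "q \<in> W" "nbrs E D = {p, q}" "good p q D"
      using W unfolding frame_def by blast
    have "r \<notin> K1" if rD: "r \<in> nbrs E D" for r
    proof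
      assume r: "r \<in> K1"
      obtain u where u: "u \<in> D" "{u, r} \<in> E" using rD unfolding nbrs_def by blast
      have "{r, u} \<in> E" using u(2) by (simp add: insert_commute)
      moreover have "u \<in> V - {x, y} - K1" using u(1) True \<open>D \<subseteq> V - W\<close> xy by blast
      ultimately show False using k(4) r unfolding adjs_def by blast
    qed
    then have "p \<notin> K1" "q \<notin> K1" using pq(4) by auto
    then show ?thesis using pq by blast
  qed
  obtain c where c: "c \<in> K2" "c \<in> W" using m(2) by blast
  have sub: "{x, y, c} \<subseteq> W - K1" using c xy k d by blast
  have "c \<noteq> x" "c \<noteq> y" using c(1) k(2) by auto
  then have c3: "card {x, y, c} = 3" using xy(3) by auto
  \<comment> \<open>If only \<open>x\<close>, \<open>y\<close> and \<open>c\<close> were left,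
    \<open>K2\<close> would split at \<open>c\<close> into good pieces and hence be good.\<close>
  have "4 \<le> card (W - K1)"
  proof (rule ccontr)
    assume "\<not> 4 \<le> card (W - K1)"
    then have "{x, y, c} = W - K1" using c3 finW by (intro card_seteq[OF _ sub]) auto
    then have "good x y K2"
      using piece by (intro good_split[OF xyV xy(3) K(2) c(1) _ two]) (metis insertCI insert_subset empty_subsetI)
    then show False using g(2) by blast
  qed
  then show "frame (W - K1)" using WV piece unfolding frame_def by blast
qed

text \<open>A cut of the torso lifts to a cut of the whole graph by the same set \<open>S\<close>.
  Both sides then meet \<open>W\<close>, and removing the good one gives a smaller frame.\<close>

lemma minimal_frame_torso:
  assumes W: "frame W" and min: "\<And>W'. frame W' \<Longrightarrow> card W \<le> card W'"
    and two: few_comps and nK: "\<not> has_K2 E 4"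
    and ng: "\<And>x y K1 K2. x \<in> V \<Longrightarrow> y \<in> V \<Longrightarrow> x \<noteq> y \<Longrightarrow> is_comp E (V - {x, y}) K1 \<Longrightarrow>
      is_comp E (V - {x, y}) K2 \<Longrightarrow> K1 \<noteq> K2 \<Longrightarrow> \<not> (good x y K1 \<and> good x y K2)"
    and S: "S \<subseteq> W" "card S \<le> 2"
  shows "conn (torso W) (W - S)"
proof (rule ccontr)
  assume n: "\<not> conn (torso W) (W - S)"
  have WV: "W \<subseteq> V" and cW: "4 \<le> card W" using W unfolding frame_def by auto
  have finW: "finite W" using WV finV finite_subset by blast
  have finS: "finite S" using S finW finite_subset by blast
  have "card (W - S) = card W - card S" using S(1) finS by (intro card_Diff_subset)
  then have "card (W - S) \<noteq> 0" using cW S(2) by linarith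
  then have "W - S \<noteq> {}" by (intro notI) simp
  then obtain T where T: "T \<subseteq> W - S" "T \<noteq> {}" "T \<noteq> W - S" "\<not> adjs (torso W) T (W - S - T)"
    using n unfolding conn_def by blast
  \<comment> \<open>The side \<open>T\<close> of the torso is completed by all pieces attached to
    it.\<close>
  define T' where "T' = T \<union> \<Union>{C. is_comp E (V - W) C \<and> nbrs E C \<inter> T \<noteq> {}}"
  have T'W: "T' \<inter> W \<subseteq> T" unfolding T'_def is_comp_def by blast
  \<comment> \<open>An edge leaving \<open>T'\<close> inside \<open>W\<close> is an edge of the
    torso. If it enters or leaves a piece, the edge representing this piece does the job: a piece in
    \<open>T'\<close> has one end in \<open>T\<close>, and the other end is then in \<open>T\<close>
    or in \<open>S\<close>.\<close>
  have sep: "b \<in> T'" if ab: "a \<in> T'" "b \<in> V - S" "{a, b} \<in> E" for a b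
  proof (rule ccontr)
    assume nb: "b \<notin> T'"
    then have bT: "b \<notin> T" unfolding T'_def by blast
    show False
    proof (cases "a \<in> T")
      case True
      then have aW: "a \<in> W" using T(1) by blast
      show False
      proof (cases "b \<in> W")
        case True
        then have "{a, b} \<in> torso W" using aW ab(3) unfolding torso_def by auto
        then have "adjs (torso W) T (W - S - T)" using \<open>a \<in> T\<close> True bT ab(2) by (intro adjsI[of a _ b]) auto
        then show False using T(4) by contradiction
      next
        case False
        then obtain C where C: "is_comp E (V - W) C" "b \<in> C" using ex_comp[of b "V - W" E] ab(2) by blast
        have "a \<notin> C" using C(1) aW unfolding is_comp_def by blast
        moreover have "{b, a} \<in> E" using ab(3) by (simp add: insert_commute)
        ultimately have "a \<in> nbrs E C" using C(2) unfolding nbrs_def by blast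
        then show False using nb C True unfolding T'_def by blast
      qed
    next
      case False
      then obtain C where C: "is_comp E (V - W) C" "nbrs E C \<inter> T \<noteq> {}" "a \<in> C" using ab(1) unfolding T'_def by blast
      have bC: "b \<notin> C" using nb C unfolding T'_def by blast
      then have bn: "b \<in> nbrs E C" using C(3) ab(3) unfolding nbrs_def by blast
      have bW: "b \<in> W" using C(1,3) bC ab(2,3) unfolding is_comp_def adjs_def by blast
      obtain t where t: "t \<in> nbrs E C" "t \<in> T" using C(2) by blast
      obtain x y where "nbrs E C = {x, y}" using W C(1) unfolding frame_def by blast
      then have "nbrs E C = {t, b}" using t bn bT by auto
      moreover have "nbrs E C \<in> torso W" using C(1) unfolding torso_def by blast
      ultimately have "{t, b} \<in> torso W" by simp
      then have "adjs (torso W) T (W - S - T)" using t(2) bW bT ab(2) by (intro adjsI[of t _ b]) auto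
      then show False using T(4) by contradiction
    qed
  qed
  obtain t where t: "t \<in> T" using T(2) by blast
  obtain s where s: "s \<in> W - S" "s \<notin> T" using T(1,3) by blast
  have tT': "t \<in> T'" and sT': "s \<notin> T'" using t s T'W unfolding T'_def by blast+
  have tV: "t \<in> V - S" and sV: "s \<in> V - S" using t s T(1) WV by blast+
  have inT': "X \<subseteq> T'" if X: "conn E X" "X \<subseteq> V - S" "t \<in> X" for X
  proof (rule ccontr)
    assume "\<not> X \<subseteq> T'"
    then obtain u where u: "u \<in> X" "u \<notin> T'" by blast
    obtain a b where "a \<in> X" "a \<in> T'" "b \<in> X" "b \<notin> T'" "{a, b} \<in> E"
      by (rule conn_cut[OF X(1,3) tT' u])
    then show False using sep[of a b] X(2) by blast
  qed
  \<comment> \<open>So \<open>S\<close> is neither empty nor a single vertex, as the graph is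
    biconnected.\<close>
  have nc: "\<not> conn E (V - S)" using inT'[of "V - S"] tV sV sT' by blast
  have "S \<noteq> {}" using nc connV by auto
  then have "card S \<noteq> 0" using finS by simp
  moreover have "card S \<noteq> 1"
  proof
    assume "card S = 1"
    then obtain c where "S = {c}" by (rule card_1_singletonE)
    then show False using nc connV1[of c] S(1) WV tV by auto
  qed
  ultimately have "card S = 2" using S(2) by linarith
  then obtain x y where xy: "S = {x, y}" "x \<noteq> y" by (meson card_2_iff)
  have xyW: "x \<in> W" "y \<in> W" using xy S by auto
  then have xyV: "x \<in> V" "y \<in> V" using WV by auto
  obtain K where K: "is_comp E (V - {x, y}) K" "t \<in> K" using ex_comp[of t "V - {x, y}" E] tV xy by blast
  obtain K' where K': "is_comp E (V - {x, y}) K'" "s \<in> K'" using ex_comp[of s "V - {x, y}" E] sV xy by blast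
  have "K \<subseteq> T'" using inT'[of K] K xy unfolding is_comp_def by blast
  then have ne: "K \<noteq> K'" using K'(2) sT' by (metis subsetD)
  have "t \<in> W" "s \<in> W" using t s(1) T(1) by blast+
  then have mW: "K \<inter> W \<noteq> {}" "K' \<inter> W \<noteq> {}" using K(2) K'(2) by blast+
  consider "good x y K" "\<not> good x y K'" | "good x y K'" "\<not> good x y K"
    using not_both_bad[OF nK xyV xy(2) K(1) K'(1) ne] ng[OF xyV xy(2) K(1) K'(1) ne] by blast
  then show False
  proof cases
    case 1
    from shrink_frame[OF W xyW xy(2) K(1) K'(1) ne mW 1 two] min[of "W - K"] show False by linarith
  next
    case 2
    from shrink_frame[OF W xyW xy(2) K'(1) K(1) ne[symmetric] mW(2,1) 2 two] min[of "W - K'"] show False by linarith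
  qed
qed

lemma comp_xy_outerplanar:
  assumes G: "simple_graph G" "verts G = V" "edges G = E"
    and xy: "x \<in> V" "y \<in> V" "x \<noteq> y" and K: "is_comp E (V - {x, y}) K" and g: "good x y K"
  shows "xy_outerplanar x y (induced G (K \<union> {x, y}))" "verts (induced G (K \<union> {x, y})) = K \<union> {x, y}"
proof -
  have sub: "K \<union> {x, y} \<subseteq> V" using K xy unfolding is_comp_def by auto
  then show v: "verts (induced G (K \<union> {x, y})) = K \<union> {x, y}" using G unfolding induced_def by auto
  have e: "edges (induced G (K \<union> {x, y})) = {e \<in> E. e \<subseteq> K \<union> {x, y}}" using G unfolding induced_def by simp
  have "simple_graph (induced G (K \<union> {x, y}))"
    unfolding simple_graph_def v e using edgeV finite_subset[OF sub finV] by auto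
  moreover obtain vs where "outer_path E (K \<union> {x, y}) x y vs" using comp_outer_path[OF xy K g] .
  ultimately show "xy_outerplanar x y (induced G (K \<union> {x, y}))"
    using outer_path_imp_xy_outerplanar outer_path_mono v e by metis
qed

text \<open>The pieces are induced subgraphs, so the edge between \<open>x\<close> and
  \<open>y\<close>, if present, lies in all three of them and the first form of the union
  applies.\<close>

lemma three_comps_decomposition:
  assumes G: "simple_graph G" "verts G = V" "edges G = E" and nK: "\<not> has_K2 E 4" and nt: "\<not> few_comps"
  shows "\<exists>x y H1 H2 H3. x \<noteq> y \<and>
       xy_outerplanar x y H1 \<and> xy_outerplanar x y H2 \<and> xy_outerplanar x y H3 \<and>
       card (verts H1) \<ge> 3 \<and> card (verts H2) \<ge> 3 \<and> card (verts H3) \<ge> 3 \<and>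
       verts H1 \<inter> verts H2 = {x, y} \<and> verts H1 \<inter> verts H3 = {x, y} \<and>
       verts H2 \<inter> verts H3 = {x, y} \<and> G = graph_union (graph_union H1 H2) H3"
proof -
  obtain x y K1 K2 K3 where xy: "x \<in> V" "y \<in> V" "x \<noteq> y"
    and K: "is_comp E (V - {x, y}) K1" "is_comp E (V - {x, y}) K2" "is_comp E (V - {x, y}) K3"
    and ne: "K1 \<noteq> K2" "K1 \<noteq> K3" "K2 \<noteq> K3"
    using nt unfolding few_comps_def by blast
  note c1 = at_most_three_comps[OF nK xy K ne]
  have g2: "good x y K2" using at_most_three_comps(2)[OF nK xy K(2,1,3)] ne by metis
  have g3: "good x y K3" using at_most_three_comps(2)[OF nK xy K(3,1,2)] ne by metis
  define Hh where "Hh C = induced G (C \<union> {x, y})" for C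
  have H: "xy_outerplanar x y (Hh K1)" "xy_outerplanar x y (Hh K2)" "xy_outerplanar x y (Hh K3)"
    and v: "verts (Hh K1) = K1 \<union> {x, y}" "verts (Hh K2) = K2 \<union> {x, y}" "verts (Hh K3) = K3 \<union> {x, y}"
    unfolding Hh_def using comp_xy_outerplanar[OF G xy K(1) c1(2)] comp_xy_outerplanar[OF G xy K(2) g2]
      comp_xy_outerplanar[OF G xy K(3) g3] by auto
  have d: "K1 \<inter> K2 = {}" "K1 \<inter> K3 = {}" "K2 \<inter> K3 = {}" using K ne comp_disjoint by blast+
  have k: "C \<subseteq> V - {x, y}" "C \<noteq> {}" "\<not> adjs E C (V - {x, y} - C)" if "is_comp E (V - {x, y}) C" for C
    using that conn_nonempty unfolding is_comp_def by auto
  have c3: "3 \<le> card (C \<union> {x, y})" if C: "is_comp E (V - {x, y}) C" for C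
  proof -
    obtain u where u: "u \<in> C" using k(2)[OF C] by blast
    then have "u \<noteq> x" "u \<noteq> y" using k(1)[OF C] by auto
    then have "card {u, x, y} = 3" "{u, x, y} \<subseteq> C \<union> {x, y}" using u xy(3) by auto
    moreover have "finite (C \<union> {x, y})" using k(1)[OF C] finV finite_subset by blast
    ultimately show ?thesis using card_mono by metis
  qed
  have inner: "e \<subseteq> C \<union> {x, y}" if C: "is_comp E (V - {x, y}) C" and e: "e \<in> E" "u \<in> e" "u \<in> C" for e u C
  proof
    fix w assume w: "w \<in> e"
    have "e = {u, w} \<or> u = w"
      using edgeV[OF e(1)] e(2) w by (metis card_2_iff doubleton_eq_iff insertE singletonD)
    then show "w \<in> C \<union> {x, y}" using k(3)[OF C] e edgeV[OF e(1)] w unfolding adjs_def by blast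
  qed
  have E3: "E = {e \<in> E. e \<subseteq> K1 \<union> {x, y}} \<union> {e \<in> E. e \<subseteq> K2 \<union> {x, y}} \<union> {e \<in> E. e \<subseteq> K3 \<union> {x, y}}"
  proof
    show "E \<subseteq> {e \<in> E. e \<subseteq> K1 \<union> {x, y}} \<union> {e \<in> E. e \<subseteq> K2 \<union> {x, y}} \<union> {e \<in> E. e \<subseteq> K3 \<union> {x, y}}"
    proof
      fix e assume e: "e \<in> E"
      show "e \<in> {e \<in> E. e \<subseteq> K1 \<union> {x, y}} \<union> {e \<in> E. e \<subseteq> K2 \<union> {x, y}} \<union> {e \<in> E. e \<subseteq> K3 \<union> {x, y}}"
      proof (cases "e \<subseteq> {x, y}")
        case False
        then obtain u where "u \<in> e" "u \<in> K1 \<union> K2 \<union> K3" using c1(1) edgeV[OF e] by blast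
        then show ?thesis using inner[OF K(1) e] inner[OF K(2) e] inner[OF K(3) e] e by blast
      qed (use e in auto)
    qed
  qed auto
  have eHh: "edges (Hh C) = {e \<in> E. e \<subseteq> C \<union> {x, y}}" for C unfolding Hh_def induced_def using G by simp
  have "verts G = verts (graph_union (graph_union (Hh K1) (Hh K2)) (Hh K3))"
    unfolding graph_union_def using v c1(1) G(2) xy by auto
  moreover have "edges G = edges (graph_union (graph_union (Hh K1) (Hh K2)) (Hh K3))"
    unfolding graph_union_def ugraph.sel eHh G(3) using E3 .
  ultimately have "G = graph_union (graph_union (Hh K1) (Hh K2)) (Hh K3)" by (rule ugraph.expand[OF conjI])
  moreover have "verts (Hh K1) \<inter> verts (Hh K2) = {x, y}" "verts (Hh K1) \<inter> verts (Hh K3) = {x, y}"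
    "verts (Hh K2) \<inter> verts (Hh K3) = {x, y}" unfolding v using d by auto
  moreover have "3 \<le> card (verts (Hh K1))" "3 \<le> card (verts (Hh K2))" "3 \<le> card (verts (Hh K3))"
    unfolding v using c3 K by auto
  ultimately show ?thesis using xy(3) H by blast
qed

text \<open>Both the torso and its subdivision are minors of \<open>G\<close>; they differ only in
  where the pieces are contracted.\<close>

lemma frame_decomposition:
  assumes G: "simple_graph G" "verts G = V" "edges G = E" and nK: "\<not> has_K2 E 4"
    and W: "frame W" and two: few_comps
    and tc: "\<And>S. S \<subseteq> W \<Longrightarrow> card S \<le> 2 \<Longrightarrow> conn (torso W) (W - S)"
  shows "\<exists>G0 F H. simple_graph G0 \<and> k_connected 3 G0 \<and> K24_minor_free G0 \<and> subdividable G0 F \<and>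
       (\<forall>e\<in>F. \<exists>x y. e = {x, y} \<and> xy_outerplanar x y (H e) \<and> verts (H e) \<inter> verts G0 = {x, y}) \<and>
       (\<forall>e\<in>F. \<forall>f\<in>F. e \<noteq> f \<longrightarrow> verts (H e) \<inter> verts (H f) \<subseteq> verts G0) \<and>
       G = replace_edges G0 F H"
proof -
  have WV: "W \<subseteq> V" and cW: "4 \<le> card W" using W unfolding frame_def by auto
  have finW: "finite W" using WV finV finite_subset by blast
  define F where "F = nbrs E ` {C. is_comp E (V - W) C}"
  define G0 where "G0 = UGraph W (torso W)"
  define sel where "sel e = (SOME C. is_comp E (V - W) C \<and> nbrs E C = e)" for e
  define H where "H e = induced G (sel e \<union> e)" for e
  have vG0: "verts G0 = W" and eG0: "edges G0 = torso W" unfolding G0_def by auto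
  have tF: "torso W = {e \<in> E. e \<subseteq> W} \<union> F" unfolding torso_def F_def ..
  have sel: "is_comp E (V - W) (sel e)" "nbrs E (sel e) = e" if "e \<in> F" for e
  proof -
    have "\<exists>C. is_comp E (V - W) C \<and> nbrs E C = e" using that unfolding F_def by blast
    from someI_ex[OF this] show "is_comp E (V - W) (sel e)" "nbrs E (sel e) = e" unfolding sel_def by auto
  qed
  have pair: "\<exists>x y. x \<noteq> y \<and> x \<in> W \<and> y \<in> W \<and> e = {x, y} \<and> good x y (sel e)" if "e \<in> F" for e
    using W sel[OF that] unfolding frame_def by blast
  have FW: "e \<subseteq> W" "card e = 2" if "e \<in> F" for e using pair[OF that] by auto
  have sV: "sel e \<subseteq> V - W" "conn E (sel e)" if "e \<in> F" for e
    using sel[OF that] unfolding is_comp_def by auto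
  \<comment> \<open>A pair determines its piece: a second piece on the same pair, together with the
    component of a further vertex of \<open>W\<close>, would make three components.\<close>
  have sel_nbrs: "sel (nbrs E C) = C" if C: "is_comp E (V - W) C" for C
  proof -
    let ?e = "nbrs E C"
    have eF: "?e \<in> F" using C unfolding F_def by blast
    obtain x y where xy: "x \<noteq> y" "x \<in> W" "y \<in> W" "?e = {x, y}" using pair[OF eF] by blast
    have xyV: "x \<in> V" "y \<in> V" using xy WV by auto
    have c: "is_comp E (V - {x, y}) C" "is_comp E (V - {x, y}) (sel ?e)"
      using comp_of_nbrs[OF C xy(4)] comp_of_nbrs[OF sel(1)[OF eF]] sel(2)[OF eF] xy(4) by simp_all
    have "\<not> W \<subseteq> {x, y}"
    proof
      assume "W \<subseteq> {x, y}"
      then have "card W \<le> card {x, y}" by (intro card_mono) auto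
      then show False using cW xy(1) by simp
    qed
    then obtain w where w: "w \<in> W" "w \<notin> {x, y}" by blast
    then obtain D where D: "is_comp E (V - {x, y}) D" "w \<in> D" using ex_comp[of w "V - {x, y}" E] WV by blast
    have "D \<noteq> C" "D \<noteq> sel ?e" using D(2) w(1) C sV(1)[OF eF] unfolding is_comp_def by blast+
    then show ?thesis using few_compsD[OF two xyV xy(1) c D(1)] by auto
  qed
  have seldis: "sel e \<inter> sel f = {}" if "e \<in> F" "f \<in> F" "e \<noteq> f" for e f
  proof -
    have "sel e \<noteq> sel f" using sel(2) that by metis
    then show ?thesis using comp_disjoint[OF sel(1)[OF that(1)] sel(1)[OF that(2)]] by blast
  qed
  have adj: "adjs E {v} (sel e)" "adjs E (sel e) {v}" if "e \<in> F" "v \<in> e" for e v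
  proof -
    have "v \<in> nbrs E (sel e)" using sel(2) that by simp
    then show "adjs E (sel e) {v}" unfolding nbrs_def adjs_def by blast
    then show "adjs E {v} (sel e)" by (rule adjs_sym)
  qed
  have "e \<subseteq> W \<and> card e = 2" if "e \<in> {e \<in> E. e \<subseteq> W} \<union> F" for e
    using that FW[of e] edgeV[of e] by auto
  then have sg0: "simple_graph G0" unfolding simple_graph_def vG0 eG0 tF using finW by blast
  have FE: "F \<subseteq> edges G0" unfolding eG0 tF by blast
  have k3: "k_connected 3 G0"
    unfolding k_connected_def vG0
  proof (intro conjI allI impI)
    show "3 < card W" using cW by simp
    fix S assume S: "S \<subseteq> W" "card S < 3"
    have "conn (torso W) (W - S)" using tc[OF S(1)] S(2) by simp
    then show "connected_graph (delete_verts G0 S)"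
      unfolding delete_verts_def vG0 using connected_graph_induced_iff[of "W - S" G0] vG0 eG0 by auto
  qed
  have K0: "K24_minor_free G0"
  proof -
    \<comment> \<open>For the torso every piece is contracted into one of its two ends, which
      thereby becomes adjacent to the other end.\<close>
    define pick where "pick e = (SOME v. v \<in> e)" for e :: "'a set"
    have pick: "pick e \<in> e" if "e \<in> F" for e using pair[OF that] someI_ex[of "\<lambda>v. v \<in> e"] unfolding pick_def by blast
    define \<phi> where "\<phi> v = {v} \<union> \<Union>(sel ` {e \<in> F. pick e = v})" for v
    have c: "conn E (\<phi> v)" for v
    proof -
      have "conn E ({v} \<union> sel e)" if "e \<in> F" "pick e = v" for e
        using conn_Un[OF conn_singleton sV(2)[OF that(1)]] adj(1)[OF that(1), of v] pick[OF that(1)] that(2) by blast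
      moreover have "\<phi> v = \<Union>(insert {v} ((\<lambda>e. {v} \<union> sel e) ` {e \<in> F. pick e = v}))" unfolding \<phi>_def by auto
      ultimately show ?thesis
        by (simp only:, intro conn_Union[of _ _ v]) (auto simp: conn_singleton)
    qed
    have "\<not> has_K2 (torso W) 4"
    proof
      assume K: "has_K2 (torso W) 4"
      have UW: "\<Union>(torso W) \<subseteq> W" unfolding tF using FW(1) by blast
      have "has_K2 E 4"
      proof (rule has_K2_expand[OF K, of _ \<phi>])
        fix v w assume vw: "v \<in> \<Union>(torso W)" "w \<in> \<Union>(torso W)" "v \<noteq> w"
        then have "v \<in> W" "w \<in> W" using UW by blast+
        then show "\<phi> v \<inter> \<phi> w = {}"
          using vw(3) sV(1) seldis unfolding \<phi>_def by fastforce
      next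
        fix v w :: 'a assume vw: "v \<noteq> w" "{v, w} \<in> torso W"
        show "adjs E (\<phi> v) (\<phi> w)"
        proof (cases "{v, w} \<in> E")
          case True
          then show ?thesis unfolding \<phi>_def by (intro adjsI[of v _ w]) auto
        next
          case False
          then have e: "{v, w} \<in> F" using vw(2) unfolding tF by blast
          from pick[OF e] consider "pick {v, w} = v" | "pick {v, w} = w" by blast
          then show ?thesis
          proof cases
            case 1
            have "adjs E (sel {v, w}) {w}" using adj(2)[OF e] by simp
            then show ?thesis by (rule adjs_mono) (use e 1 in \<open>auto simp: \<phi>_def\<close>)
          next
            case 2
            have "adjs E {v} (sel {v, w})" using adj(1)[OF e] by simp
            then show ?thesis by (rule adjs_mono) (use e 2 in \<open>auto simp: \<phi>_def\<close>)
          qed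
        qed
      qed (use c in auto)
      then show False using nK by contradiction
    qed
    then show ?thesis using K24_minor_free_iff[OF sg0] eG0 by simp
  qed
  have sd: "subdividable G0 F"
  proof -
    \<comment> \<open>For the subdivision the piece itself is the branch set of the subdividing
      vertex.\<close>
    define \<phi> where "\<phi> v = (case v of Inl v \<Rightarrow> {v} | Inr e \<Rightarrow> sel e)" for v :: "'a + 'a set"
    have es: "edges (subdivide G0 F) = (\<lambda>e. Inl ` e) ` (torso W - F) \<union> {{Inl v, Inr e} | v e. e \<in> F \<and> v \<in> e}"
      unfolding subdivide_def eG0 by simp
    have vs: "(\<exists>u\<in>W. v = Inl u) \<or> (\<exists>e\<in>F. v = Inr e)" if "v \<in> \<Union>(edges (subdivide G0 F))" for v
    proof -
      have "v \<in> verts (subdivide G0 F)"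
        using that simple_graph_subdivide[OF sg0 FE] unfolding simple_graph_def by blast
      then show ?thesis unfolding subdivide_def vG0 by auto
    qed
    have "\<not> has_K2 (edges (subdivide G0 F)) 4"
    proof
      assume K: "has_K2 (edges (subdivide G0 F)) 4"
      have "has_K2 E 4"
      proof (rule has_K2_expand[OF K, of _ \<phi>])
        fix v assume "v \<in> \<Union>(edges (subdivide G0 F))"
        from vs[OF this] show "conn E (\<phi> v)" using sV(2) unfolding \<phi>_def by (auto simp: conn_singleton)
      next
        fix v w assume vw: "v \<in> \<Union>(edges (subdivide G0 F))" "w \<in> \<Union>(edges (subdivide G0 F))" "v \<noteq> w"
        from vs[OF vw(1)] vs[OF vw(2)] vw(3) show "\<phi> v \<inter> \<phi> w = {}"
          unfolding \<phi>_def using sV(1) seldis by fastforce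
      next
        fix v w :: "'a + 'a set" assume vw: "v \<noteq> w" "{v, w} \<in> edges (subdivide G0 F)"
        then consider e where "{v, w} = Inl ` e" "e \<in> torso W" "e \<notin> F" | u e where "{v, w} = {Inl u, Inr e}" "e \<in> F" "u \<in> e"
          unfolding es by blast
        then show "adjs E (\<phi> v) (\<phi> w)"
        proof cases
          case 1
          have "v \<in> Inl ` e" "w \<in> Inl ` e" using 1(1) by blast+
          then obtain a b where ab: "v = Inl a" "w = Inl b" by blast
          then have "(Inl ` {a, b} :: ('a + 'a set) set) = Inl ` e" using 1(1) by simp
          then have "{a, b} = e" by (rule inj_image_eq_iff[THEN iffD1, rotated]) simp
          then have "{a, b} \<in> E" using 1(2,3) unfolding tF by auto
          then show ?thesis unfolding \<phi>_def ab adjs_def by simp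
        next
          case 2
          then have "v = Inl u \<and> w = Inr e \<or> v = Inr e \<and> w = Inl u" by (auto simp: doubleton_eq_iff)
          then show ?thesis using adj[OF 2(2,3)] unfolding \<phi>_def by auto
        qed
      qed simp
      then show False using nK by contradiction
    qed
    then show ?thesis using FE K24_minor_free_iff[OF simple_graph_subdivide[OF sg0 FE]] unfolding subdividable_def by simp
  qed
  have vH: "verts (H e) = sel e \<union> e" if "e \<in> F" for e
    unfolding H_def induced_def using G(2) sV(1)[OF that] FW(1)[OF that] WV by auto
  have eH: "edges (H e) = {f \<in> E. f \<subseteq> sel e \<union> e}" for e
    unfolding H_def induced_def using G(3) by simp
  have HW: "verts (H e) \<inter> W = e" if "e \<in> F" for e
    using vH[OF that] sV(1)[OF that] FW(1)[OF that] by blast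
  have pieces: "\<exists>x y. e = {x, y} \<and> xy_outerplanar x y (H e) \<and> verts (H e) \<inter> verts G0 = {x, y}" if e: "e \<in> F" for e
  proof -
    obtain x y where xy: "x \<noteq> y" "x \<in> W" "y \<in> W" "e = {x, y}" "good x y (sel e)" using pair[OF e] by blast
    have xyV: "x \<in> V" "y \<in> V" using xy WV by auto
    have "nbrs E (sel e) = {x, y}" using sel(2)[OF e] xy(4) by simp
    from comp_xy_outerplanar(1)[OF G xyV xy(1) comp_of_nbrs[OF sel(1)[OF e] this] xy(5)]
    have "xy_outerplanar x y (H e)" unfolding H_def using xy(4) by simp
    then show ?thesis using xy(4) HW[OF e] unfolding vG0 by auto
  qed
  have disj: "verts (H e) \<inter> verts (H f) \<subseteq> verts G0" if "e \<in> F" "f \<in> F" "e \<noteq> f" for e f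
    using vH[OF that(1)] vH[OF that(2)] seldis[OF that] FW(1)[OF that(1)] FW(1)[OF that(2)] unfolding vG0 by blast
  have hidden: "\<exists>e\<in>F. u \<in> sel e" if u: "u \<in> V" "u \<notin> W" for u
  proof -
    obtain C where C: "is_comp E (V - W) C" "u \<in> C" using ex_comp[of u "V - W" E] u by blast
    then show ?thesis using sel_nbrs[OF C(1)] unfolding F_def by blast
  qed
  have "V = W \<union> (\<Union>e\<in>F. verts (H e))"
  proof
    show "V \<subseteq> W \<union> (\<Union>e\<in>F. verts (H e))" using hidden vH by blast
    have "verts (H e) \<subseteq> V" if "e \<in> F" for e
      unfolding vH[OF that] using sV(1)[OF that] FW(1)[OF that] WV by blast
    then show "W \<union> (\<Union>e\<in>F. verts (H e)) \<subseteq> V" using WV by blast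
  qed
  \<comment> \<open>An edge of \<open>G\<close> joining the ends of a piece belongs to
    \<open>F\<close> and is deleted from the torso, but the induced piece contains it.\<close>
  moreover have "E = (torso W - F) \<union> (\<Union>e\<in>F. edges (H e))"
  proof
    show "E \<subseteq> (torso W - F) \<union> (\<Union>e\<in>F. edges (H e))"
    proof
      fix f assume f: "f \<in> E"
      show "f \<in> (torso W - F) \<union> (\<Union>e\<in>F. edges (H e))"
      proof (cases "f \<subseteq> W")
        case True
        then show ?thesis using f eH unfolding tF by blast
      next
        case False
        then obtain u where u: "u \<in> f" "u \<notin> W" by blast
        then obtain e where e: "e \<in> F" "u \<in> sel e" using hidden edgeV[OF f] by blast
        have "f \<subseteq> sel e \<union> e"
        proof
          fix w assume w: "w \<in> f"
          have "f = {u, w} \<or> u = w"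
            using edgeV[OF f] u(1) w by (metis card_2_iff doubleton_eq_iff insertE singletonD)
          then show "w \<in> sel e \<union> e"
          proof
            assume fuw: "f = {u, w}"
            then have "{u, w} \<in> E" using f by simp
            then have "w \<in> sel e \<or> w \<in> nbrs E (sel e)" using e(2) unfolding nbrs_def by blast
            then show ?thesis using sel(2)[OF e(1)] by blast
          qed (use e in blast)
        qed
        then show ?thesis using f e(1) eH by blast
      qed
    qed
    show "(torso W - F) \<union> (\<Union>e\<in>F. edges (H e)) \<subseteq> E" unfolding tF eH by blast
  qed
  ultimately have "verts G = verts (replace_edges G0 F H)" "edges G = edges (replace_edges G0 F H)"
    unfolding replace_edges_def ugraph.sel vG0 eG0 using G(2,3) by auto
  then have eq: "G = replace_edges G0 F H" by (rule ugraph.expand[OF conjI])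
  show ?thesis
    by (rule exI[of _ G0], rule exI[of _ F], rule exI[of _ H])
      (use sg0 k3 K0 sd pieces disj eq in blast)
qed

end

section \<open>Blocks and the characterization\<close>

lemma block_biconnected:
  assumes sg: "simple_graph G" and b: "block G"
  shows "biconnected (verts G) (edges G)"
proof
  show "finite (verts G)" "\<And>e. e \<in> edges G \<Longrightarrow> e \<subseteq> verts G \<and> card e = 2"
    using sg unfolding simple_graph_def by auto
  have c: "connected_graph G" using b unfolding block_def by blast
  then show "conn (edges G) (verts G)" using connected_graph_iff[OF sg] by blast
  fix c assume cV: "c \<in> verts G" "verts G - {c} \<noteq> {}"
  have "connected_graph (induced G (verts G - {c}))"
    unfolding connected_graph_def
  proof (intro conjI ballI)
    have v: "verts (induced G (verts G - {c})) = verts G - {c}" unfolding induced_def by auto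
    then show "verts (induced G (verts G - {c})) \<noteq> {}" using cV(2) by simp
    fix u w assume "u \<in> verts (induced G (verts G - {c}))" "w \<in> verts (induced G (verts G - {c}))"
    then have uw: "u \<in> verts G - {c}" "w \<in> verts G - {c}" unfolding v by auto
    have "reachable G u w" using \<open>connected_graph G\<close> uw unfolding connected_graph_def by blast
    moreover have "\<not> cutvertex G c" using b unfolding block_def by blast
    ultimately show "reachable (induced G (verts G - {c})) u w"
      using uw cV(1) unfolding cutvertex_def delete_verts_def by blast
  qed
  then show "conn (edges G) (verts G - {c})" using connected_graph_induced_iff[of "verts G - {c}" G] by simp
qed

lemma rooted_K22_card:
  assumes "rooted_K22 E U x y" "finite U"
  shows "4 \<le> card U"
proof -
  obtain A B S where M: "K2_model E {..<2::nat} A B S" and s: "x \<in> A" "y \<in> B" "A \<subseteq> U" "B \<subseteq> U"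
    "\<And>i. i < 2 \<Longrightarrow> S i \<subseteq> U" using assms(1) unfolding rooted_K22_def by blast
  have m: "A \<inter> B = {}" "S 0 \<noteq> {}" "S 1 \<noteq> {}" "S 0 \<inter> A = {}" "S 1 \<inter> A = {}" "S 0 \<inter> B = {}" "S 1 \<inter> B = {}" "S 0 \<inter> S 1 = {}"
    using M conn_nonempty[of E "S 0"] conn_nonempty[of E "S 1"] unfolding K2_model_def by auto
  obtain a b where ab: "a \<in> S 0" "b \<in> S 1" using m(2,3) by blast
  have "x \<noteq> y" "x \<noteq> a" "x \<noteq> b" "y \<noteq> a" "y \<noteq> b" "a \<noteq> b" using m s(1,2) ab by blast+
  then have "card {x, y, a, b} = 4" by simp
  moreover have "{x, y, a, b} \<subseteq> U" using s(1-4) s(5)[of 0] s(5)[of 1] ab by auto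
  ultimately show ?thesis using card_mono[OF assms(2)] by metis
qed

text \<open>A rooted K_{2,2} takes four vertices, so below this order any two vertices are the ends
  of an outer path. Frames take over from four vertices on.\<close>

lemma small_block_outerplanar:
  assumes sg: "simple_graph G" and b: "block G" and c: "card (verts G) < 4"
  shows "outerplanar G"
proof -
  interpret biconnected "verts G" "edges G" using block_biconnected[OF sg b] .
  obtain v where v: "v \<in> verts G" using conn_nonempty[OF connV] by blast
  show ?thesis
  proof (cases "verts G = {v}")
    case True
    have "outer_path (edges G) (verts G) v v [v]" unfolding True outer_path_def noncrossing_def by simp
    then show ?thesis by (rule outer_path_imp_outerplanar[OF sg])
  next
    case False
    then obtain w where w: "w \<in> verts G" "v \<noteq> w" using v by blast
    have "\<not> rooted_K22 (edges G) (verts G) v w" using rooted_K22_card finV c by fastforce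
    then obtain vs where "outer_path (edges G) (verts G) v w vs"
      using ex_outer_path[OF w(2) v w(1) order_refl connV] edge_mem by metis
    then show ?thesis by (rule outer_path_imp_outerplanar[OF sg])
  qed
qed

theorem theorem3p5:
  fixes G :: "'a ugraph"
  assumes "simple_graph G" and "block G"
  shows "K24_minor_free G \<longleftrightarrow>
    outerplanar G \<or>
    (\<exists>x y H\<^sub>1 H\<^sub>2 H\<^sub>3. x \<noteq> y \<and>
       xy_outerplanar x y H\<^sub>1 \<and> xy_outerplanar x y H\<^sub>2 \<and> xy_outerplanar x y H\<^sub>3 \<and>
       card (verts H\<^sub>1) \<ge> 3 \<and> card (verts H\<^sub>2) \<ge> 3 \<and> card (verts H\<^sub>3) \<ge> 3 \<and>
       verts H\<^sub>1 \<inter> verts H\<^sub>2 = {x, y} \<and> verts H\<^sub>1 \<inter> verts H\<^sub>3 = {x, y} \<and>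
       verts H\<^sub>2 \<inter> verts H\<^sub>3 = {x, y} \<and>
       (G = graph_union (graph_union H\<^sub>1 H\<^sub>2) H\<^sub>3 \<or>
        G = graph_union (graph_union (graph_union H\<^sub>1 H\<^sub>2) H\<^sub>3) (UGraph {x, y} {{x, y}}))) \<or>
    (\<exists>G\<^sub>0 F H. simple_graph G\<^sub>0 \<and> k_connected 3 G\<^sub>0 \<and> K24_minor_free G\<^sub>0 \<and>
       subdividable G\<^sub>0 F \<and>
       (\<forall>e\<in>F. \<exists>x y. e = {x, y} \<and> xy_outerplanar x y (H e) \<and>
          verts (H e) \<inter> verts G\<^sub>0 = {x, y}) \<and>
       (\<forall>e\<in>F. \<forall>f\<in>F. e \<noteq> f \<longrightarrow> verts (H e) \<inter> verts (H f) \<subseteq> verts G\<^sub>0) \<and>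
       G = replace_edges G\<^sub>0 F H)"
    (is "?K \<longleftrightarrow> ?i \<or> ?ii \<or> ?iii")
proof
  interpret biconnected "verts G" "edges G" using block_biconnected[OF assms] .
  assume ?K
  then have nK: "\<not> has_K2 (edges G) 4" using K24_minor_free_iff[OF assms(1)] by blast
  show "?i \<or> ?ii \<or> ?iii"
  proof (cases "card (verts G) < 4 \<or> \<not> few_comps")
    case True
    then show ?thesis
    proof
      assume "card (verts G) < 4"
      then show ?thesis using small_block_outerplanar[OF assms] by blast
    next
      assume "\<not> few_comps"
      from three_comps_decomposition[OF assms(1) refl refl nK this] have ?ii by blast
      then show ?thesis by blast
    qed
  next
    case False
    then have two: few_comps and c4: "4 \<le> card (verts G)" by auto
    show ?thesis
    proof (cases "\<exists>x\<in>verts G. \<exists>y\<in>verts G. x \<noteq> y \<and> (\<exists>K1 K2. is_comp (edges G) (verts G - {x, y}) K1 \<and>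
        is_comp (edges G) (verts G - {x, y}) K2 \<and> K1 \<noteq> K2 \<and> good x y K1 \<and> good x y K2)")
      case True
      then obtain x y K1 K2 where xy: "x \<in> verts G" "y \<in> verts G" "x \<noteq> y"
        and K: "is_comp (edges G) (verts G - {x, y}) K1" "is_comp (edges G) (verts G - {x, y}) K2" "K1 \<noteq> K2"
        and g: "good x y K1" "good x y K2" by blast
      have "K1 \<union> K2 = verts G - {x, y}"
      proof
        show "K1 \<union> K2 \<subseteq> verts G - {x, y}" using K unfolding is_comp_def by blast
        show "verts G - {x, y} \<subseteq> K1 \<union> K2"
        proof
          fix u assume "u \<in> verts G - {x, y}"
          then obtain D where D: "is_comp (edges G) (verts G - {x, y}) D" "u \<in> D" by (rule ex_comp)
          then show "u \<in> K1 \<union> K2" using few_compsD[OF two xy K(1,2) D(1)] K(3) by blast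
        qed
      qed
      then obtain z rs where "outer_path (edges G) (verts G) x z rs"
        using two_good_outer_path[OF xy K _ g] by blast
      then have ?i by (rule outer_path_imp_outerplanar[OF assms(1)])
      then show ?thesis by blast
    next
      case False
      \<comment> \<open>The whole vertex set is a frame because nothing is left to be attached; so a
        smallest frame exists.\<close>
      have "\<And>C. \<not> is_comp (edges G) {} C" unfolding is_comp_def using conn_nonempty by blast
      then have "frame (verts G)" unfolding frame_def using c4 by simp
      then obtain W where W: "frame W" and min: "\<And>W'. frame W' \<Longrightarrow> card W \<le> card W'"
        using ex_has_least_nat[of frame "verts G" card] by blast
      have "conn (torso W) (W - S)" if "S \<subseteq> W" "card S \<le> 2" for S
        by (rule minimal_frame_torso[OF W min two nK _ that]) (use False in blast)+
      from frame_decomposition[OF assms(1) refl refl nK W two this] show ?thesis by blast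
    qed
  qed
next
  assume "?i \<or> ?ii \<or> ?iii"
  then consider ?i | ?ii | ?iii by blast
  then show ?K
  proof cases
    case 1
    then show ?thesis using outerplanar_imp_K24_minor_free assms(1) by blast
  next
    case 2
    then obtain x y H1 H2 H3 where H: "x \<noteq> y"
      "xy_outerplanar x y H1" "xy_outerplanar x y H2" "xy_outerplanar x y H3"
      "3 \<le> card (verts H1)" "3 \<le> card (verts H2)" "3 \<le> card (verts H3)"
      "verts H1 \<inter> verts H2 = {x, y}" "verts H1 \<inter> verts H3 = {x, y}" "verts H2 \<inter> verts H3 = {x, y}"
      and G: "G = graph_union (graph_union H1 H2) H3 \<or>
        G = graph_union (graph_union (graph_union H1 H2) H3) (UGraph {x, y} {{x, y}})" by blast
    \<comment> \<open>\<open>Z\<close> treats the union with and without the additional edge at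
      once.\<close>
    have "\<exists>Z. edges G = edges H1 \<union> edges H2 \<union> edges H3 \<union> Z \<and> Z \<subseteq> {{x, y}}"
      using G unfolding graph_union_def by (elim disjE) (auto intro: exI[of _ "{}"] exI[of _ "{{x, y}}"])
    then obtain Z where "edges G = edges H1 \<union> edges H2 \<union> edges H3 \<union> Z" "Z \<subseteq> {{x, y}}" by blast
    from three_outerplanar_K24_minor_free[OF assms(1) H this] show ?thesis .
  next
    case 3
    then obtain G0 F H where G0: "simple_graph G0" "subdividable G0 F" "G = replace_edges G0 F H"
      and H: "\<forall>e\<in>F. \<exists>x y. e = {x, y} \<and> xy_outerplanar x y (H e) \<and> verts (H e) \<inter> verts G0 = {x, y}"
      and HH: "\<forall>e\<in>F. \<forall>f\<in>F. e \<noteq> f \<longrightarrow> verts (H e) \<inter> verts (H f) \<subseteq> verts G0"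
      by (elim exE conjE) (rule that)
    show ?thesis
      by (rule replace_edges_K24_minor_free[OF assms(1) G0(3,1,2)]) (use H HH in blast)+
  qed
qed

end
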